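(* Let $\Sigma=(A,G,\alpha,\sigma)$ be a unital discrete twisted C$^*$-dynamical system. Then the Fourier-Stieltjes algebra $B(\Sigma)$, with the algebra operations inherited from $L(\Sigma)$ (addition, scalar multiplication, the product $\times$, and the unit $I$), is a unital Banach algebra with respect to the norm $\|T\|=\inf\{\|x\|\,\|y\| : T=T_{\rho,v,x,y}\}$.
   Context: Conventions: all C$^*$-algebras are unital and homomorphisms between them are unital and $*$-preserving. $\Sigma=(A,G,\alpha,\sigma)$ is a unital discrete twisted C$^*$-dynamical system: $A$ is a C$^*$-algebra with unit $1$, $G$ is a discrete group with identity $e$, $\alpha:G\to \mathrm{Aut}(A)$ and $\sigma:G\times G\to \mathcal{U}(A)$ (the unitary group of $A$) are maps satisfying $\alpha_g\alpha_h=\mathrm{Ad}(\sigma(g,h))\,\alpha_{gh}$, $\sigma(g,h)\sigma(gh,k)=\alpha_g(\sigma(h,k))\sigma(g,hk)$ and $\sigma(g,e)=\sigma(e,g)=1$ for all $g,h,k\in G$. Hilbert $A$-modules are right modules, with $A$-valued inner product linear in the second variable; $\mathcal{L}(X)$ denotes the adjointable operators on $X$. An equivariant representation of $\Sigma$ on a Hilbert $A$-module $X$ is a pair $(\rho,v)$ where $\rho:A\to\mathcal{L}(X)$ is a (unital $*$-) homomorphism and $v:G\to\mathcal{I}(X)$ is a map into the group of $\mathbb{C}$-linear, invertible, bounded maps $X\to X$, such that for all $g,h\in G$, $a\in A$, $x,x'\in X$: (i) $\rho(\alpha_g(a))=v(g)\rho(a)v(g)^{-1}$; (ii) $v(g)v(h)=\mathrm{ad}_\rho(\sigma(g,h))\,v(gh)$,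 where $\mathrm{ad}_\rho(\sigma(g,h))x=(\rho(\sigma(g,h))x)\cdot\sigma(g,h)^*$; (iii) $\alpha_g(\langle x,x'\rangle)=\langle v(g)x,v(g)x'\rangle$; (iv) $v(g)(x\cdot a)=(v(g)x)\cdot\alpha_g(a)$. $L(\Sigma)$ is the set of all maps $T:G\times A\to A$ that are linear in the second variable; it is a unital algebra with pointwise addition and scalar multiplication, product $(T\times T')(g,a)=T(g,T'(g,a))$ and unit $I(g,a)=a$. For an equivariant representation $(\rho,v)$ of $\Sigma$ on $X$ and $x,y\in X$, $T_{\rho,v,x,y}\in L(\Sigma)$ is defined by $T_{\rho,v,x,y}(g,a)=\langle x,\rho(a)v(g)y\rangle$. $B(\Sigma)$ is the set of all maps of the form $T_{\rho,v,x,y}$, for some equivariant representation $(\rho,v)$ of $\Sigma$ on some Hilbert $A$-module $X$ and $x,y\in X$. For $T\in B(\Sigma)$, $\|T\|$ is the infimum of $\|x\|\,\|y\|$ over all possible decompositions $T=T_{\rho,v,x,y}$. *)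

theory Defs
  imports "HOL-Analysis.Analysis"
begin

section \<open>Unital C*-algebras\<close>

text \<open>
  The class does not require \<open>0 \<noteq> 1\<close>, so the zero algebra is an instance. This is why it
  extends \<^class>\<open>real_normed_algebra\<close> and \<^class>\<open>monoid_mult\<close> rather than
  \<^class>\<open>real_normed_algebra_1\<close>.
\<close>

class cstar_algebra = real_normed_algebra + banach + monoid_mult +
  fixes scaleC :: "complex \<Rightarrow> 'a \<Rightarrow> 'a" (infixr "*\<^sub>C" 75)
    and star :: "'a \<Rightarrow> 'a"
  assumes scaleR_scaleC: "scaleR r x = complex_of_real r *\<^sub>C x"
    and scaleC_add_right: "c *\<^sub>C (x + y) = c *\<^sub>C x + c *\<^sub>C y"
    and scaleC_add_left: "(c + d) *\<^sub>C x = c *\<^sub>C x + d *\<^sub>C x"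
    and scaleC_scaleC: "c *\<^sub>C (d *\<^sub>C x) = (c * d) *\<^sub>C x"
    and scaleC_one: "1 *\<^sub>C x = x"
    and mult_scaleC_left: "(c *\<^sub>C x) * y = c *\<^sub>C (x * y)"
    and mult_scaleC_right: "x * (c *\<^sub>C y) = c *\<^sub>C (x * y)"
    and norm_scaleC: "norm (c *\<^sub>C x) = cmod c * norm x"
    and star_star: "star (star x) = x"
    and star_add: "star (x + y) = star x + star y"
    and star_scaleC: "star (c *\<^sub>C x) = cnj c *\<^sub>C star x"
    and star_mult: "star (x * y) = star y * star x"
    and cstar_identity: "norm (star x * x) = (norm x)\<^sup>2"

definition positive_element :: "'a::cstar_algebra \<Rightarrow> bool" where
  "positive_element a \<longleftrightarrow> (\<exists>b. a = star b * b)"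

definition unitary_element :: "'a::cstar_algebra \<Rightarrow> bool" where
  "unitary_element u \<longleftrightarrow> star u * u = 1 \<and> u * star u = 1"

definition clinear :: "('a::cstar_algebra \<Rightarrow> 'a) \<Rightarrow> bool" where
  "clinear f \<longleftrightarrow> (\<forall>x y. f (x + y) = f x + f y) \<and> (\<forall>c x. f (c *\<^sub>C x) = c *\<^sub>C f x)"

definition star_automorphism :: "('a::cstar_algebra \<Rightarrow> 'a) \<Rightarrow> bool" where
  "star_automorphism f \<longleftrightarrow> bij f \<and> clinear f \<and> (\<forall>x y. f (x * y) = f x * f y) \<and> f 1 = 1
     \<and> (\<forall>x. f (star x) = star (f x))"


section \<open>Twisted C*-dynamical systems\<close>

text \<open>
  \<^class>\<open>group_add\<close> is the class of arbitrary, not necessarily commutative, groups. The product of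
  \<open>g\<close> and \<open>h\<close> is written \<open>g + h\<close> and the identity is \<open>0\<close>.
\<close>

locale twisted_system =
  fixes \<alpha> :: "'g::group_add \<Rightarrow> 'a::cstar_algebra \<Rightarrow> 'a"
    and \<sigma> :: "'g \<Rightarrow> 'g \<Rightarrow> 'a"
  assumes alpha_automorphism: "star_automorphism (\<alpha> g)"
    and sigma_unitary: "unitary_element (\<sigma> g h)"
    and alpha_alpha: "\<alpha> g (\<alpha> h a) = \<sigma> g h * \<alpha> (g + h) a * star (\<sigma> g h)"
    and sigma_cocycle: "\<sigma> g h * \<sigma> (g + h) k = \<alpha> g (\<sigma> h k) * \<sigma> g (h + k)"
    and sigma_right: "\<sigma> g 0 = 1"
    and sigma_left: "\<sigma> 0 g = 1"


section \<open>Vector spaces on a carrier set\<close>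

locale cvector_space_on =
  fixes V :: "'v set"
    and add :: "'v \<Rightarrow> 'v \<Rightarrow> 'v"
    and zero :: 'v
    and smul :: "complex \<Rightarrow> 'v \<Rightarrow> 'v"
  assumes add_closed: "\<lbrakk>x \<in> V; y \<in> V\<rbrakk> \<Longrightarrow> add x y \<in> V"
    and zero_closed: "zero \<in> V"
    and scale_closed: "x \<in> V \<Longrightarrow> smul c x \<in> V"
    and add_assoc: "\<lbrakk>x \<in> V; y \<in> V; z \<in> V\<rbrakk> \<Longrightarrow> add (add x y) z = add x (add y z)"
    and add_commute: "\<lbrakk>x \<in> V; y \<in> V\<rbrakk> \<Longrightarrow> add x y = add y x"
    and add_zero: "x \<in> V \<Longrightarrow> add x zero = x"
    and add_inverse: "x \<in> V \<Longrightarrow> \<exists>y\<in>V. add x y = zero"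
    and scale_add_right: "\<lbrakk>x \<in> V; y \<in> V\<rbrakk> \<Longrightarrow> smul c (add x y) = add (smul c x) (smul c y)"
    and scale_add_left: "x \<in> V \<Longrightarrow> smul (c + d) x = add (smul c x) (smul d x)"
    and scale_scale: "x \<in> V \<Longrightarrow> smul c (smul d x) = smul (c * d) x"
    and scale_one: "x \<in> V \<Longrightarrow> smul 1 x = x"

definition complete_on :: "'v set \<Rightarrow> ('v \<Rightarrow> 'v \<Rightarrow> 'v) \<Rightarrow> (complex \<Rightarrow> 'v \<Rightarrow> 'v) \<Rightarrow> ('v \<Rightarrow> real) \<Rightarrow> bool"
  where "complete_on V add smul N \<longleftrightarrow>
    (\<forall>f. (\<forall>n::nat. f n \<in> V)
        \<and> (\<forall>e>0. \<exists>n\<^sub>0. \<forall>m\<ge>n\<^sub>0. \<forall>n\<ge>n\<^sub>0. N (add (f m) (smul (-1) (f n))) < e)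
      \<longrightarrow> (\<exists>l\<in>V. (\<lambda>n. N (add (f n) (smul (-1) l))) \<longlonglongrightarrow> 0))"

locale unital_banach_algebra_on = cvector_space_on V add zero smul
  for V :: "'v set"
    and add :: "'v \<Rightarrow> 'v \<Rightarrow> 'v"
    and zero :: 'v
    and smul :: "complex \<Rightarrow> 'v \<Rightarrow> 'v" +
  fixes mult :: "'v \<Rightarrow> 'v \<Rightarrow> 'v"
    and one :: 'v
    and N :: "'v \<Rightarrow> real"
  assumes mult_closed: "\<lbrakk>x \<in> V; y \<in> V\<rbrakk> \<Longrightarrow> mult x y \<in> V"
    and one_closed: "one \<in> V"
    and mult_assoc: "\<lbrakk>x \<in> V; y \<in> V; z \<in> V\<rbrakk> \<Longrightarrow> mult (mult x y) z = mult x (mult y z)"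
    and mult_add_left: "\<lbrakk>x \<in> V; y \<in> V; z \<in> V\<rbrakk> \<Longrightarrow> mult (add x y) z = add (mult x z) (mult y z)"
    and mult_add_right: "\<lbrakk>x \<in> V; y \<in> V; z \<in> V\<rbrakk> \<Longrightarrow> mult x (add y z) = add (mult x y) (mult x z)"
    and mult_scale_left: "\<lbrakk>x \<in> V; y \<in> V\<rbrakk> \<Longrightarrow> mult (smul c x) y = smul c (mult x y)"
    and mult_scale_right: "\<lbrakk>x \<in> V; y \<in> V\<rbrakk> \<Longrightarrow> mult x (smul c y) = smul c (mult x y)"
    and one_mult: "x \<in> V \<Longrightarrow> mult one x = x"
    and mult_one: "x \<in> V \<Longrightarrow> mult x one = x"
    and norm_nonneg: "x \<in> V \<Longrightarrow> 0 \<le> N x"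
    and norm_eq_zero: "x \<in> V \<Longrightarrow> N x = 0 \<longleftrightarrow> x = zero"
    and norm_triangle: "\<lbrakk>x \<in> V; y \<in> V\<rbrakk> \<Longrightarrow> N (add x y) \<le> N x + N y"
    and norm_scale: "x \<in> V \<Longrightarrow> N (smul c x) = cmod c * N x"
    and norm_mult: "\<lbrakk>x \<in> V; y \<in> V\<rbrakk> \<Longrightarrow> N (mult x y) \<le> N x * N y"
    and norm_one: "one \<noteq> zero \<Longrightarrow> N one = 1" \<comment> \<open>the zero algebra is allowed\<close>
    and complete: "complete_on V add smul N"


section \<open>Hilbert modules\<close>

record ('x, 'a) hmodule =
  vecs :: "'x set"
  hadd :: "'x \<Rightarrow> 'x \<Rightarrow> 'x"
  hzero :: 'x
  hscale :: "complex \<Rightarrow> 'x \<Rightarrow> 'x"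
  hact :: "'x \<Rightarrow> 'a \<Rightarrow> 'x"
  hinner :: "'x \<Rightarrow> 'x \<Rightarrow> 'a"

definition hnorm :: "('x, 'a::cstar_algebra) hmodule \<Rightarrow> 'x \<Rightarrow> real" where
  "hnorm X x = sqrt (norm (hinner X x x))"

locale hilbert_module =
  cvector_space_on "vecs X" "hadd X" "hzero X" "hscale X"
  for X :: "('x, 'a::cstar_algebra) hmodule" +
  assumes act_closed: "x \<in> vecs X \<Longrightarrow> hact X x a \<in> vecs X"
    and act_add_left: "\<lbrakk>x \<in> vecs X; y \<in> vecs X\<rbrakk>
          \<Longrightarrow> hact X (hadd X x y) a = hadd X (hact X x a) (hact X y a)"
    and act_add_right: "x \<in> vecs X \<Longrightarrow> hact X x (a + b) = hadd X (hact X x a) (hact X x b)"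
    and act_mult: "x \<in> vecs X \<Longrightarrow> hact X x (a * b) = hact X (hact X x a) b"
    and act_one: "x \<in> vecs X \<Longrightarrow> hact X x 1 = x"
    and act_scale_left: "x \<in> vecs X \<Longrightarrow> hact X (hscale X c x) a = hscale X c (hact X x a)"
    and act_scale_right: "x \<in> vecs X \<Longrightarrow> hact X x (c *\<^sub>C a) = hscale X c (hact X x a)"
    and inner_add: "\<lbrakk>x \<in> vecs X; y \<in> vecs X; z \<in> vecs X\<rbrakk>
          \<Longrightarrow> hinner X x (hadd X y z) = hinner X x y + hinner X x z"
    and inner_scale: "\<lbrakk>x \<in> vecs X; y \<in> vecs X\<rbrakk>
          \<Longrightarrow> hinner X x (hscale X c y) = c *\<^sub>C hinner X x y"
    and inner_act: "\<lbrakk>x \<in> vecs X; y \<in> vecs X\<rbrakk> \<Longrightarrow> hinner X x (hact X y a) = hinner X x y * a"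
    and inner_star: "\<lbrakk>x \<in> vecs X; y \<in> vecs X\<rbrakk> \<Longrightarrow> hinner X y x = star (hinner X x y)"
    and inner_positive: "x \<in> vecs X \<Longrightarrow> positive_element (hinner X x x)"
    and inner_definite: "\<lbrakk>x \<in> vecs X; hinner X x x = 0\<rbrakk> \<Longrightarrow> x = hzero X"
    and complete: "complete_on (vecs X) (hadd X) (hscale X) (hnorm X)"

definition adjoint_pair :: "('x, 'a::cstar_algebra) hmodule \<Rightarrow> ('x \<Rightarrow> 'x) \<Rightarrow> ('x \<Rightarrow> 'x) \<Rightarrow> bool" where
  "adjoint_pair X S S' \<longleftrightarrow> S \<in> vecs X \<rightarrow> vecs X \<and> S' \<in> vecs X \<rightarrow> vecs X
     \<and> (\<forall>x\<in>vecs X. \<forall>y\<in>vecs X. hinner X (S x) y = hinner X x (S' y))"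

definition adjointable :: "('x, 'a::cstar_algebra) hmodule \<Rightarrow> ('x \<Rightarrow> 'x) set" where
  "adjointable X = {S. \<exists>S'. adjoint_pair X S S'}"

text \<open>
  Operators on \<open>X\<close> are functions on the ambient type of which only the values on \<^term>\<open>vecs X\<close>
  matter, so identities between operators are required on \<^term>\<open>vecs X\<close> only.
\<close>

definition adjointable_rep ::
  "('x, 'a::cstar_algebra) hmodule \<Rightarrow> ('a \<Rightarrow> 'x \<Rightarrow> 'x) \<Rightarrow> bool" where
  "adjointable_rep X \<rho> \<longleftrightarrow>
     (\<forall>a. \<rho> a \<in> adjointable X) \<and> (\<forall>a. adjoint_pair X (\<rho> a) (\<rho> (star a)))
     \<and> (\<forall>x\<in>vecs X. (\<forall>a b. \<rho> (a + b) x = hadd X (\<rho> a x) (\<rho> b x))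
          \<and> (\<forall>c a. \<rho> (c *\<^sub>C a) x = hscale X c (\<rho> a x))
          \<and> (\<forall>a b. \<rho> (a * b) x = \<rho> a (\<rho> b x))
          \<and> \<rho> 1 x = x)"

definition bounded_invertible :: "('x, 'a::cstar_algebra) hmodule \<Rightarrow> ('x \<Rightarrow> 'x) \<Rightarrow> bool" where
  "bounded_invertible X S \<longleftrightarrow> bij_betw S (vecs X) (vecs X)
     \<and> (\<forall>x\<in>vecs X. \<forall>y\<in>vecs X. S (hadd X x y) = hadd X (S x) (S y))
     \<and> (\<forall>c. \<forall>x\<in>vecs X. S (hscale X c x) = hscale X c (S x))
     \<and> (\<exists>K. \<forall>x\<in>vecs X. hnorm X (S x) \<le> K * hnorm X x)
     \<and> (\<exists>K. \<forall>x\<in>vecs X. hnorm X (inv_into (vecs X) S x) \<le> K * hnorm X x)"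


section \<open>Equivariant representations and their coefficient functions\<close>

locale equivariant_rep = twisted_system \<alpha> \<sigma> + hilbert_module X
  for \<alpha> :: "'g::group_add \<Rightarrow> 'a::cstar_algebra \<Rightarrow> 'a"
    and \<sigma> :: "'g \<Rightarrow> 'g \<Rightarrow> 'a"
    and X :: "('x, 'a) hmodule" +
  fixes \<rho> :: "'a \<Rightarrow> 'x \<Rightarrow> 'x"
    and v :: "'g \<Rightarrow> 'x \<Rightarrow> 'x"
  assumes rho_rep: "adjointable_rep X \<rho>"
    and v_invertible: "bounded_invertible X (v g)"
    and rho_alpha: "x \<in> vecs X \<Longrightarrow> \<rho> (\<alpha> g a) x = v g (\<rho> a (inv_into (vecs X) (v g) x))"
    and v_v: "x \<in> vecs X
          \<Longrightarrow> v g (v h x) = hact X (\<rho> (\<sigma> g h) (v (g + h) x)) (star (\<sigma> g h))"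
    and alpha_inner: "\<lbrakk>x \<in> vecs X; y \<in> vecs X\<rbrakk>
          \<Longrightarrow> \<alpha> g (hinner X x y) = hinner X (v g x) (v g y)"
    and v_act: "x \<in> vecs X \<Longrightarrow> v g (hact X x a) = hact X (v g x) (\<alpha> g a)"

definition coefficient_map :: "('x, 'a::cstar_algebra) hmodule \<Rightarrow> ('a \<Rightarrow> 'x \<Rightarrow> 'x) \<Rightarrow> ('g \<Rightarrow> 'x \<Rightarrow> 'x)
    \<Rightarrow> 'x \<Rightarrow> 'x \<Rightarrow> 'g \<Rightarrow> 'a \<Rightarrow> 'a" where
  "coefficient_map X \<rho> v x y = (\<lambda>g a. hinner X x (\<rho> a (v g y)))"

text \<open>
  HOL cannot quantify over Hilbert modules on all types inside a definition, so the modules in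
  the definition of the Fourier-Stieltjes algebra have their carriers in one fixed type. It
  consists of the terms below, which name the elements of the sub-representation generated by two
  vectors (\<open>Term_Lim\<close> names limits of sequences). This is no restriction: by
  \<open>equivariant_rep_on_rep_terms\<close>, proved at the end of this theory, a coefficient function of an
  equivariant representation on a module over any type is also one of a representation on a
  module over this type, with vectors of the same norms.
\<close>

datatype ('g, 'a) rep_term =
    Term_Fst
  | Term_Snd
  | Term_Zero
  | Term_Add "('g, 'a) rep_term" "('g, 'a) rep_term"
  | Term_Scale complex "('g, 'a) rep_term"
  | Term_Act "('g, 'a) rep_term" 'a
  | Term_Rho 'a "('g, 'a) rep_term"
  | Term_V 'g "('g, 'a) rep_term"
  | Term_V_Inv 'g "('g, 'a) rep_term"
  | Term_Lim "nat \<Rightarrow> ('g, 'a) rep_term"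

definition decomposition :: "('g::group_add \<Rightarrow> 'a::cstar_algebra \<Rightarrow> 'a) \<Rightarrow> ('g \<Rightarrow> 'g \<Rightarrow> 'a)
    \<Rightarrow> ('x, 'a) hmodule \<Rightarrow> ('a \<Rightarrow> 'x \<Rightarrow> 'x) \<Rightarrow> ('g \<Rightarrow> 'x \<Rightarrow> 'x) \<Rightarrow> 'x \<Rightarrow> 'x
    \<Rightarrow> ('g \<Rightarrow> 'a \<Rightarrow> 'a) \<Rightarrow> bool" where
  "decomposition \<alpha> \<sigma> X \<rho> v x y T \<longleftrightarrow>
     equivariant_rep \<alpha> \<sigma> X \<rho> v \<and> x \<in> vecs X \<and> y \<in> vecs X \<and> T = coefficient_map X \<rho> v x y"

definition fourier_stieltjes ::
  "('g::group_add \<Rightarrow> 'a::cstar_algebra \<Rightarrow> 'a) \<Rightarrow> ('g \<Rightarrow> 'g \<Rightarrow> 'a) \<Rightarrow> ('g \<Rightarrow> 'a \<Rightarrow> 'a) set" where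
  "fourier_stieltjes \<alpha> \<sigma> =
     {T. \<exists>(X :: (('g, 'a) rep_term, 'a) hmodule) \<rho> v x y. decomposition \<alpha> \<sigma> X \<rho> v x y T}"

definition fs_norm :: "('g::group_add \<Rightarrow> 'a::cstar_algebra \<Rightarrow> 'a) \<Rightarrow> ('g \<Rightarrow> 'g \<Rightarrow> 'a)
    \<Rightarrow> ('g \<Rightarrow> 'a \<Rightarrow> 'a) \<Rightarrow> real" where
  "fs_norm \<alpha> \<sigma> T = Inf {hnorm X x * hnorm X y | (X :: (('g, 'a) rep_term, 'a) hmodule) \<rho> v x y.
     decomposition \<alpha> \<sigma> X \<rho> v x y T}"


section \<open>The algebra of maps that are linear in the second variable\<close>

definition L_carrier :: "('g \<Rightarrow> 'a::cstar_algebra \<Rightarrow> 'a) set" where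
  "L_carrier = {T. \<forall>g. clinear (T g)}"

definition L_add :: "('g \<Rightarrow> 'a::cstar_algebra \<Rightarrow> 'a) \<Rightarrow> ('g \<Rightarrow> 'a \<Rightarrow> 'a) \<Rightarrow> 'g \<Rightarrow> 'a \<Rightarrow> 'a" where
  "L_add T T' = (\<lambda>g a. T g a + T' g a)"

definition L_zero :: "'g \<Rightarrow> 'a::cstar_algebra \<Rightarrow> 'a" where
  "L_zero = (\<lambda>g a. 0)"

definition L_scale :: "complex \<Rightarrow> ('g \<Rightarrow> 'a::cstar_algebra \<Rightarrow> 'a) \<Rightarrow> 'g \<Rightarrow> 'a \<Rightarrow> 'a" where
  "L_scale c T = (\<lambda>g a. c *\<^sub>C T g a)"

definition L_mult :: "('g \<Rightarrow> 'a::cstar_algebra \<Rightarrow> 'a) \<Rightarrow> ('g \<Rightarrow> 'a \<Rightarrow> 'a) \<Rightarrow> 'g \<Rightarrow> 'a \<Rightarrow> 'a" where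
  "L_mult T T' = (\<lambda>g a. T g (T' g a))"

definition L_one :: "'g \<Rightarrow> 'a::cstar_algebra \<Rightarrow> 'a" where
  "L_one = (\<lambda>g a. a)"

section \<open>Coefficient functions of representations on arbitrary types\<close>

definition some_limit :: "('x, 'a::cstar_algebra) hmodule \<Rightarrow> (nat \<Rightarrow> 'x) \<Rightarrow> 'x" where
  "some_limit X s =
     (if \<exists>l\<in>vecs X. (\<lambda>n. hnorm X (hadd X (s n) (hscale X (-1) l))) \<longlonglongrightarrow> 0
      then SOME l. l \<in> vecs X \<and> (\<lambda>n. hnorm X (hadd X (s n) (hscale X (-1) l))) \<longlonglongrightarrow> 0
      else hzero X)"

lemma some_limit_closed: "hzero X \<in> vecs X \<Longrightarrow> some_limit X s \<in> vecs X"
  unfolding some_limit_def by (auto intro: someI2_ex)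

lemma some_limit_tendsto:
  assumes "l \<in> vecs X" "(\<lambda>n. hnorm X (hadd X (s n) (hscale X (-1) l))) \<longlonglongrightarrow> 0"
  shows "(\<lambda>n. hnorm X (hadd X (s n) (hscale X (-1) (some_limit X s)))) \<longlonglongrightarrow> 0"
proof -
  let ?P = "\<lambda>l. l \<in> vecs X \<and> (\<lambda>n. hnorm X (hadd X (s n) (hscale X (-1) l))) \<longlonglongrightarrow> 0"
  have "?P (Eps ?P)"
    by (rule someI[of ?P l]) (use assms in auto)
  moreover have "some_limit X s = Eps ?P"
    unfolding some_limit_def using assms by auto
  ultimately show ?thesis by simp
qed

primrec rep_eval :: "('x, 'a::cstar_algebra) hmodule \<Rightarrow> ('a \<Rightarrow> 'x \<Rightarrow> 'x) \<Rightarrow> ('g \<Rightarrow> 'x \<Rightarrow> 'x)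
    \<Rightarrow> 'x \<Rightarrow> 'x \<Rightarrow> ('g, 'a) rep_term \<Rightarrow> 'x" where
  "rep_eval X \<rho> v x y Term_Fst = x"
| "rep_eval X \<rho> v x y Term_Snd = y"
| "rep_eval X \<rho> v x y Term_Zero = hzero X"
| "rep_eval X \<rho> v x y (Term_Add s t) = hadd X (rep_eval X \<rho> v x y s) (rep_eval X \<rho> v x y t)"
| "rep_eval X \<rho> v x y (Term_Scale c t) = hscale X c (rep_eval X \<rho> v x y t)"
| "rep_eval X \<rho> v x y (Term_Act t a) = hact X (rep_eval X \<rho> v x y t) a"
| "rep_eval X \<rho> v x y (Term_Rho a t) = \<rho> a (rep_eval X \<rho> v x y t)"
| "rep_eval X \<rho> v x y (Term_V g t) = v g (rep_eval X \<rho> v x y t)"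
| "rep_eval X \<rho> v x y (Term_V_Inv g t) = inv_into (vecs X) (v g) (rep_eval X \<rho> v x y t)"
| "rep_eval X \<rho> v x y (Term_Lim f) = some_limit X (\<lambda>n. rep_eval X \<rho> v x y (f n))"

theorem equivariant_rep_on_rep_terms:
  fixes \<alpha> :: "'g::group_add \<Rightarrow> 'a::cstar_algebra \<Rightarrow> 'a"
    and X :: "('x, 'a) hmodule"
  assumes "decomposition \<alpha> \<sigma> X \<rho> v x y T"
  shows "\<exists>(X' :: (('g, 'a) rep_term, 'a) hmodule) \<rho>' v' x' y'.
    decomposition \<alpha> \<sigma> X' \<rho>' v' x' y' T \<and> hnorm X' x' = hnorm X x \<and> hnorm X' y' = hnorm X y"
proof -
  interpret R: equivariant_rep \<alpha> \<sigma> X \<rho> v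
    using assms by (simp add: decomposition_def)
  have xy: "x \<in> vecs X" "y \<in> vecs X" and T: "T = coefficient_map X \<rho> v x y"
    using assms by (auto simp: decomposition_def)
  have bij: "bij_betw (v g) (vecs X) (vecs X)" for g
    using R.v_invertible by (simp add: bounded_invertible_def)
  define D where "D = (rep_eval X \<rho> v x y :: ('g, 'a) rep_term \<Rightarrow> 'x)"
  have D_simps [simp]:
    "D Term_Fst = x" "D Term_Snd = y" "D Term_Zero = hzero X"
    "D (Term_Add s t) = hadd X (D s) (D t)" "D (Term_Scale c t) = hscale X c (D t)"
    "D (Term_Act t a) = hact X (D t) a" "D (Term_Rho a t) = \<rho> a (D t)"
    "D (Term_V g t) = v g (D t)" "D (Term_V_Inv g t) = inv_into (vecs X) (v g) (D t)"
    "D (Term_Lim f) = some_limit X (\<lambda>n. D (f n))" for s t c a g f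
    by (simp_all add: D_def)
  have rho_closed: "\<rho> a z \<in> vecs X" if "z \<in> vecs X" for a z
    using R.rho_rep that by (auto simp: adjointable_rep_def adjoint_pair_def)
  have v_closed: "v g z \<in> vecs X" if "z \<in> vecs X" for g z
    using bij[of g] that by (meson bij_betwE)
  have v_inv_closed: "inv_into (vecs X) (v g) z \<in> vecs X" if "z \<in> vecs X" for g z
    using bij[of g] that by (metis bij_betw_def inv_into_into)
  have D_closed [simp]: "D t \<in> vecs X" for t
    by (induction t)
      (auto simp: xy R.zero_closed R.add_closed R.scale_closed R.act_closed rho_closed v_closed
        v_inv_closed some_limit_closed)
  define nf where "nf t = inv D (D t)" for t
  have D_nf [simp]: "D (nf t) = D t" for t
    unfolding nf_def by (simp add: f_inv_into_f)
  have nf_nf [simp]: "nf (nf t) = nf t" for t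
    by (simp add: nf_def f_inv_into_f)
  have nf_eqI: "nf s = nf t" if "D s = D t" for s t
    using that by (simp add: nf_def)
  define X' where "X' = \<lparr>vecs = range nf, hadd = (\<lambda>s t. nf (Term_Add s t)), hzero = nf Term_Zero,
    hscale = (\<lambda>c t. nf (Term_Scale c t)), hact = (\<lambda>t a. nf (Term_Act t a)),
    hinner = (\<lambda>s t. hinner X (D s) (D t))\<rparr>"
  define \<rho>' where "\<rho>' = (\<lambda>a t. nf (Term_Rho a t))"
  define v' where "v' = (\<lambda>g t. nf (Term_V g t))"
  have X'_simps [simp]: "vecs X' = range nf" "hadd X' s t = nf (Term_Add s t)"
    "hzero X' = nf Term_Zero" "hscale X' c t = nf (Term_Scale c t)"
    "hact X' t a = nf (Term_Act t a)" "hinner X' s t = hinner X (D s) (D t)" for s t c a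
    by (simp_all add: X'_def)
  have eqI: "s = t" if "s \<in> range nf" "t \<in> range nf" "D s = D t" for s t
    using that nf_eqI[OF that(3)] by auto
  have hnorm' [simp]: "hnorm X' t = hnorm X (D t)" for t
    by (simp add: hnorm_def)
  have v'_closed: "v' g t \<in> range nf" for g t
    by (simp add: v'_def)
  have D_v' [simp]: "D (v' g t) = v g (D t)" and D_rho' [simp]: "D (\<rho>' a t) = \<rho> a (D t)" for g a t
    by (simp_all add: v'_def \<rho>'_def)
  have v_inj: "p = q" if "v g p = v g q" "p \<in> vecs X" "q \<in> vecs X" for g p q
    using bij[of g] that by (metis bij_betw_def inj_onD)
  have v_inv: "v g (inv_into (vecs X) (v g) z) = z" if "z \<in> vecs X" for g z
    using bij[of g] that by (metis bij_betw_def f_inv_into_f)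
  have bij': "bij_betw (v' g) (range nf) (range nf)" for g
    unfolding bij_betw_def
  proof
    show "inj_on (v' g) (range nf)"
    proof (rule inj_onI)
      fix s t assume st: "s \<in> range nf" "t \<in> range nf" "v' g s = v' g t"
      then have "v g (D s) = v g (D t)" by (metis D_v')
      then show "s = t" using v_inj st eqI D_closed by blast
    qed
    show "v' g ` range nf = range nf"
    proof (intro subset_antisym subsetI)
      fix t assume t: "t \<in> range nf"
      have "t = v' g (nf (Term_V_Inv g t))"
        by (rule eqI) (use t in \<open>auto simp: v_inv v'_closed\<close>)
      then show "t \<in> v' g ` range nf" by blast
    qed (auto simp: v'_closed)
  qed
  have inv': "inv_into (range nf) (v' g) t = nf (Term_V_Inv g t)" if "t \<in> range nf" for g t
  proof (rule inv_into_f_eq)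
    show "inj_on (v' g) (range nf)" using bij'[of g] by (simp add: bij_betw_def)
    show "v' g (nf (Term_V_Inv g t)) = t"
      by (rule eqI) (use that in \<open>auto simp: v_inv v'_closed\<close>)
  qed simp
  have vs: "cvector_space_on (range nf) (\<lambda>s t. nf (Term_Add s t)) (nf Term_Zero)
      (\<lambda>c t. nf (Term_Scale c t))"
  proof
    fix s assume s: "s \<in> range nf"
    obtain z where z: "z \<in> vecs X" "hadd X (D s) z = hzero X"
      using R.add_inverse[OF D_closed] by blast
    have zero_smul: "hscale X 0 w = hzero X" if w: "w \<in> vecs X" for w
    proof -
      let ?u = "hscale X 0 w"
      have u: "?u \<in> vecs X" by (rule R.scale_closed[OF w])
      have uu: "hadd X ?u ?u = ?u" using R.scale_add_left[OF w, of 0 0] by simp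
      obtain n where n: "n \<in> vecs X" "hadd X ?u n = hzero X" using R.add_inverse[OF u] by blast
      have "hadd X (hadd X ?u ?u) n = hadd X ?u (hadd X ?u n)" by (rule R.add_assoc[OF u u n(1)])
      then show ?thesis using uu n R.add_zero[OF u] by simp
    qed
    have "hadd X (D s) (hscale X (-1) (D s)) = hzero X"
      using R.scale_add_left[of "D s" 1 "-1"] R.scale_one[of "D s"] zero_smul[of "D s"] by simp
    then have "nf (Term_Add s (nf (Term_Scale (-1) s))) = nf Term_Zero"
      by (intro nf_eqI) simp
    then show "\<exists>t\<in>range nf. nf (Term_Add s t) = nf Term_Zero" by blast
  qed (auto intro!: eqI simp: R.add_assoc R.add_commute R.add_zero R.scale_add_right
      R.scale_add_left R.scale_scale R.scale_one)
  have "hilbert_module X'"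
  proof (rule hilbert_module.intro)
    have fe: "hadd X' = (\<lambda>s t. nf (Term_Add s t))" "hscale X' = (\<lambda>c t. nf (Term_Scale c t))"
      by (simp_all add: X'_def)
    show "cvector_space_on (vecs X') (hadd X') (hzero X') (hscale X')"
      unfolding fe using vs by simp
    have compl: "complete_on (vecs X') (hadd X') (hscale X') (hnorm X')"
      unfolding complete_on_def
    proof (intro allI impI)
      fix f :: "nat \<Rightarrow> ('g, 'a) rep_term"
      assume "(\<forall>n. f n \<in> vecs X') \<and> (\<forall>e>0. \<exists>n\<^sub>0. \<forall>m\<ge>n\<^sub>0. \<forall>n\<ge>n\<^sub>0.
        hnorm X' (hadd X' (f m) (hscale X' (-1) (f n))) < e)"
      then have "\<forall>e>0. \<exists>n\<^sub>0. \<forall>m\<ge>n\<^sub>0. \<forall>n\<ge>n\<^sub>0.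
        hnorm X (hadd X (D (f m)) (hscale X (-1) (D (f n)))) < e"
        by simp
      then obtain l where "l \<in> vecs X"
        "(\<lambda>n. hnorm X (hadd X (D (f n)) (hscale X (-1) l))) \<longlonglongrightarrow> 0"
        using R.complete unfolding complete_on_def by (metis D_closed)
      then have "(\<lambda>n. hnorm X (hadd X (D (f n)) (hscale X (-1) (D (Term_Lim f))))) \<longlonglongrightarrow> 0"
        using some_limit_tendsto[where s = "\<lambda>n. D (f n)"] by simp
      then have "(\<lambda>n. hnorm X' (hadd X' (f n) (hscale X' (-1) (nf (Term_Lim f))))) \<longlonglongrightarrow> 0"
        by simp
      then show "\<exists>l\<in>vecs X'. (\<lambda>n. hnorm X' (hadd X' (f n) (hscale X' (-1) l))) \<longlonglongrightarrow> 0"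
        by (intro bexI[of _ "nf (Term_Lim f)"]) simp_all
    qed
    show "hilbert_module_axioms X'"
    proof
      show "complete_on (vecs X') (hadd X') (hscale X') (hnorm X')"
        by (rule compl)
    qed (auto intro!: eqI simp: R.act_add_left R.act_add_right R.act_mult R.act_one
          R.act_scale_left R.act_scale_right R.inner_add R.inner_scale R.inner_act
          R.inner_positive dest: R.inner_definite[OF D_closed] intro: R.inner_star)
  qed
  moreover have "equivariant_rep_axioms \<alpha> \<sigma> X' \<rho>' v'"
  proof
    have adj: "adjoint_pair X' (\<rho>' a) (\<rho>' (star a))" for a
      using R.rho_rep by (auto simp: adjointable_rep_def adjoint_pair_def \<rho>'_def)
    show "adjointable_rep X' \<rho>'"
      unfolding adjointable_rep_def
    proof (intro conjI allI ballI)
      show "\<rho>' a \<in> adjointable X'" for a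
        using adj by (auto simp: adjointable_def)
      show "adjoint_pair X' (\<rho>' a) (\<rho>' (star a))" for a
        by (rule adj)
    qed (use R.rho_rep in \<open>auto simp: \<rho>'_def adjointable_rep_def intro!: eqI\<close>)
    show "bounded_invertible X' (v' g)" for g
    proof -
      have "bounded_invertible X (v g)" by (rule R.v_invertible)
      then obtain K L where "\<forall>z\<in>vecs X. hnorm X (v g z) \<le> K * hnorm X z"
        "\<forall>z\<in>vecs X. hnorm X (inv_into (vecs X) (v g) z) \<le> L * hnorm X z"
        and lin: "\<forall>p\<in>vecs X. \<forall>q\<in>vecs X. v g (hadd X p q) = hadd X (v g p) (v g q)"
        "\<forall>c. \<forall>p\<in>vecs X. v g (hscale X c p) = hscale X c (v g p)"
        unfolding bounded_invertible_def by blast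
      then have "\<forall>t\<in>vecs X'. hnorm X' (v' g t) \<le> K * hnorm X' t"
        "\<forall>t\<in>vecs X'. hnorm X' (inv_into (vecs X') (v' g) t) \<le> L * hnorm X' t"
        by (simp_all add: inv')
      moreover have "v' g (hadd X' s t) = hadd X' (v' g s) (v' g t)" for s t
        using lin by (intro eqI) (simp_all add: v'_closed)
      moreover have "v' g (hscale X' c t) = hscale X' c (v' g t)" for c t
        using lin by (intro eqI) (simp_all add: v'_closed)
      ultimately show ?thesis
        unfolding bounded_invertible_def using bij' by auto
    qed
    show "\<rho>' (\<alpha> g a) t = v' g (\<rho>' a (inv_into (vecs X') (v' g) t))" if "t \<in> vecs X'" for t g a
      using that by (intro eqI) (simp_all add: \<rho>'_def v'_closed inv' R.rho_alpha)
    show "v' g (v' h t) = hact X' (\<rho>' (\<sigma> g h) (v' (g + h) t)) (star (\<sigma> g h))" for t g h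
      by (intro eqI) (simp_all add: v'_closed R.v_v)
    show "\<alpha> g (hinner X' s t) = hinner X' (v' g s) (v' g t)" for s t g
      by (simp add: R.alpha_inner)
    show "v' g (hact X' t a) = hact X' (v' g t) (\<alpha> g a)" for t g a
      by (intro eqI) (simp_all add: v'_closed R.v_act)
  qed
  ultimately have "equivariant_rep \<alpha> \<sigma> X' \<rho>' v'"
    by (intro equivariant_rep.intro R.twisted_system_axioms)
  moreover have "T = coefficient_map X' \<rho>' v' (nf Term_Fst) (nf Term_Snd)"
    by (simp add: T coefficient_map_def)
  ultimately have "decomposition \<alpha> \<sigma> X' \<rho>' v' (nf Term_Fst) (nf Term_Snd) T"
    by (simp add: decomposition_def)
  then show ?thesis by fastforce
qed

end

theory Submission
  imports Defs "HOL-Library.Function_Algebras"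
begin

text \<open>
  Operations on coefficient functions are realised by operations on representations. If \<open>T\<close> and
  \<open>T'\<close> are the coefficient functions of \<open>x, y\<close> in \<open>X\<close> and of \<open>x', y'\<close> in \<open>X'\<close>, then \<open>T + T'\<close> is one of
  the direct sum of \<open>X\<close> and \<open>X'\<close>, while \<open>T \<times> T'\<close> is the coefficient function of the elementary tensors
  \<open>x' \<otimes> x\<close> and \<open>y' \<otimes> y\<close> in the internal tensor product of \<open>X'\<close> and \<open>X\<close> over the representation on \<open>X\<close>
  (\<open>tensor_decomposition\<close>). The unit \<open>I\<close> is a coefficient function of the algebra as a module over
  itself. As \<open>norm (x' \<otimes> x) \<le> norm x' * norm x\<close>, the norm is submultiplicative.

  The remaining properties of the norm follow from one fact about countable direct sums
  (\<open>bounded_series\<close>). After rescaling, a \<open>T\<close> of norm below \<open>r\<close> has a decomposition in which both vectors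
  have norm at most \<open>sqrt r\<close>. If the sum of the \<open>r n\<close> converges and \<open>T n\<close> has such a decomposition for
  \<open>r n\<close>, then the direct sum of these decompositions shows that the sum of the \<open>T n\<close> exists and has norm
  at most the sum of the \<open>r n\<close>. Two-term series give the triangle inequality, and
  telescoping series give completeness. Definiteness holds because \<open>norm (T g a) \<le> norm a * norm T\<close>.

  Direct sums and tensor products are constructed alike, from a kernel, that is, from a Gram matrix
  of generating vectors on whose indices the algebra and the group act. A kernel is positive if its
  finite submatrices are, and such a kernel comes from an equivariant representation
  (\<open>kernel_representation\<close>) on a space of functions on the index set. The positivity of the kernel of
  a tensor product says that a representation maps positive matrices to positive matrices
  (\<open>positive_matrix_form\<close>), which is shown by elimination of rows and columns.

  All this rests on the order of a C*-algebra: the elements \<open>star b * b\<close> form a closed convex cone on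
  which the norm is monotone. The cone is first described by the condition that \<open>norm (t * 1 - a) \<le> t\<close>
  for some \<open>t\<close>, for which sums are evident and square roots are the limits of an iteration; that it
  contains each \<open>star b * b\<close> is \<open>cone_star_mult\<close>. The Cauchy-Schwarz inequality and the contractivity of
  representations and automorphisms follow.
\<close>


section \<open>Elementary identities in C*-algebras\<close>

lemma scaleC_zero_left [simp]: "0 *\<^sub>C (x::'a::cstar_algebra) = 0"
  using scaleR_scaleC[of 0 x] by simp

lemma scaleC_zero_right [simp]: "c *\<^sub>C (0::'a::cstar_algebra) = 0"
  using scaleC_add_right[of c 0 "0::'a"] by simp

declare scaleC_one [simp]

lemma scaleC_minus_right [simp]: "c *\<^sub>C (- x::'a::cstar_algebra) = - (c *\<^sub>C x)"
  using scaleC_add_right[of c x "- x"] by (simp add: eq_neg_iff_add_eq_0 add.commute)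

lemma scaleC_minus_left [simp]: "(- c) *\<^sub>C (x::'a::cstar_algebra) = - (c *\<^sub>C x)"
  using scaleC_add_left[of c "- c" x] by (simp add: eq_neg_iff_add_eq_0 add.commute)

lemma scaleC_diff_right: "c *\<^sub>C (x - y::'a::cstar_algebra) = c *\<^sub>C x - c *\<^sub>C y"
  using scaleC_add_right[of c x "- y"] by simp

lemma star_zero [simp]: "star (0::'a::cstar_algebra) = 0"
  using star_add[of 0 "0::'a"] by simp

lemma star_minus [simp]: "star (- x::'a::cstar_algebra) = - star x"
  using star_add[of x "- x"] by (simp add: eq_neg_iff_add_eq_0 add.commute)

lemma star_diff: "star (x - y::'a::cstar_algebra) = star x - star y"
  using star_add[of x "- y"] by simp

lemma star_one [simp]: "star (1::'a::cstar_algebra) = 1"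
proof -
  have "star (star (1::'a) * 1) = star 1 * star (star 1)" by (rule star_mult)
  then show ?thesis by (simp add: star_star)
qed

lemma star_scaleR [simp]: "star (r *\<^sub>R x::'a::cstar_algebra) = r *\<^sub>R star x"
  by (simp add: scaleR_scaleC star_scaleC)

lemma star_sum: "star (\<Sum>x\<in>I. f x) = (\<Sum>x\<in>I. star (f x :: 'a::cstar_algebra))"
  by (induction I rule: infinite_finite_induct) (simp_all add: star_add)

lemma norm_star [simp]: "norm (star x) = norm (x::'a::cstar_algebra)"
proof -
  have le: "norm y \<le> norm (star y)" for y :: 'a
  proof (cases "y = 0")
    case False
    have "norm y * norm y = norm (star y * y)"
      by (simp add: cstar_identity power2_eq_square)
    also have "\<dots> \<le> norm (star y) * norm y" by (rule norm_mult_ineq)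
    finally show ?thesis using False by simp
  qed simp
  from le[of x] le[of "star x"] show ?thesis by (simp add: star_star)
qed

lemma bounded_linear_star: "bounded_linear (star :: 'a::cstar_algebra \<Rightarrow> 'a)"
  by (rule bounded_linear_intro[of _ 1]) (simp_all add: star_add)

lemmas tendsto_star [tendsto_intros] = bounded_linear.tendsto[OF bounded_linear_star]
  and continuous_on_star [continuous_intros] = bounded_linear.continuous_on[OF bounded_linear_star]

lemma bounded_linear_scaleC: "bounded_linear (\<lambda>x::'a::cstar_algebra. c *\<^sub>C x)"
  by (rule bounded_linear_intro[of _ "cmod c"])
    (simp_all add: scaleC_add_right scaleR_scaleC scaleC_scaleC norm_scaleC mult.commute)

lemmas tendsto_scaleC [tendsto_intros] = bounded_linear.tendsto[OF bounded_linear_scaleC]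

lemma norm_one_le: "norm (1::'a::cstar_algebra) \<le> 1"
proof -
  have "norm (1::'a) = (norm (1::'a))\<^sup>2"
    using cstar_identity[of "1::'a"] by simp
  then have "norm (1::'a) = 0 \<or> norm (1::'a) = 1" by (auto simp: power2_eq_square)
  then show ?thesis by auto
qed

lemma norm_scaleR_one_le: "0 \<le> t \<Longrightarrow> norm (t *\<^sub>R 1 :: 'a::cstar_algebra) \<le> t"
  using norm_one_le mult_left_mono[of "norm (1::'a)" 1 t] by simp

lemma norm_selfadjoint_square: "star c = c \<Longrightarrow> norm (c * c) = (norm (c::'a::cstar_algebra))\<^sup>2"
  using cstar_identity[of c] by simp


section \<open>Square roots and the positive cone\<close>

text \<open>
  The root of \<open>1 - x\<close> is \<open>1 - y\<close> with \<open>y = (x + y\<^sup>2) / 2\<close>. Iterating this equation from \<open>0\<close>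
  converges even on the boundary \<open>norm x = 1\<close>: the increments are dominated by those of the same
  iteration for the real number \<open>1\<close>, which increases and stays below \<open>1\<close>.
\<close>

lemma square_root_near_one:
  fixes x :: "'a::cstar_algebra"
  assumes "star x = x" "norm x \<le> 1"
  obtains y where "star y = y" "norm y \<le> 1" "(1 - y) * (1 - y) = 1 - x"
    "\<And>z. z * x = x * z \<Longrightarrow> z * y = y * z"
proof -
  define s where "s = rec_nat (0::'a) (\<lambda>_ y. (1/2) *\<^sub>R (x + y * y))"
  define t where "t = rec_nat (0::real) (\<lambda>_ y. (1/2) * (1 + y * y))"
  have s_Suc: "s (Suc n) = (1/2) *\<^sub>R (x + s n * s n)" and s_0: "s 0 = 0" for n
    by (simp_all add: s_def)
  have t_Suc: "t (Suc n) = (1/2) * (1 + t n * t n)" and t_0: "t 0 = 0" for n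
    by (simp_all add: t_def)
  have t01: "0 \<le> t n \<and> t n \<le> 1" for n
  proof (induction n)
    case (Suc n)
    then have "t n * t n \<le> 1" by (simp add: mult_le_one)
    then show ?case by (simp add: t_Suc)
  qed (simp add: t_0)
  have norm_s: "norm (s n) \<le> t n" for n
  proof (induction n)
    case (Suc n)
    have "norm (s n * s n) \<le> t n * t n"
      using norm_mult_ineq[of "s n" "s n"] mult_mono[OF Suc Suc] t01[of n] by simp
    then have "norm (x + s n * s n) \<le> 1 + t n * t n"
      using norm_triangle_ineq[of x "s n * s n"] assms(2) by linarith
    then show ?case by (simp add: s_Suc t_Suc)
  qed (simp add: s_0 t_0)
  have step: "norm (s (Suc n) - s n) \<le> t (Suc n) - t n" for n
  proof (induction n)
    case 0
    then show ?case using assms(2) by (simp add: s_Suc t_Suc s_0 t_0)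
  next
    case (Suc n)
    let ?a = "s (Suc n)" and ?b = "s n"
    have "s (Suc (Suc n)) - ?a = (1/2) *\<^sub>R (?a * (?a - ?b) + (?a - ?b) * ?b)"
      unfolding s_Suc[of "Suc n"]
      by (subst (3) s_Suc) (simp add: algebra_simps flip: scaleR_diff_right)
    then have "norm (s (Suc (Suc n)) - ?a) = (1/2) * norm (?a * (?a - ?b) + (?a - ?b) * ?b)"
      by simp
    also have "norm (?a * (?a - ?b) + (?a - ?b) * ?b)
        \<le> norm ?a * norm (?a - ?b) + norm (?a - ?b) * norm ?b"
      using norm_triangle_ineq[of "?a * (?a - ?b)" "(?a - ?b) * ?b"]
        norm_mult_ineq[of ?a "?a - ?b"] norm_mult_ineq[of "?a - ?b" ?b] by linarith
    also have "\<dots> \<le> t (Suc n) * (t (Suc n) - t n) + (t (Suc n) - t n) * t n"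
      using norm_s[of n] norm_s[of "Suc n"] Suc t01[of n] t01[of "Suc n"]
        order_trans[OF norm_ge_zero Suc]
      by (intro add_mono mult_mono) auto
    finally have "norm (s (Suc (Suc n)) - ?a)
        \<le> (1/2) * (t (Suc n) * (t (Suc n) - t n) + (t (Suc n) - t n) * t n)"
      by simp
    also have "\<dots> = t (Suc (Suc n)) - t (Suc n)"
      unfolding t_Suc[of "Suc n"] by (subst (4) t_Suc) (simp add: algebra_simps)
    finally show ?case .
  qed
  have t_mono: "t n \<le> t (Suc n)" for n
    using order_trans[OF norm_ge_zero step] by simp
  then have "incseq t" by (simp add: incseq_SucI)
  then have "convergent t"
    by (intro Bseq_mono_convergent BseqI'[of _ 1]) (use t01 in \<open>auto simp: incseq_def\<close>)
  then have "summable (\<lambda>n. t (Suc n) - t n)"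
    by (metis convergent_def telescope_summable)
  then have "summable (\<lambda>n. s (Suc n) - s n)"
    by (rule summable_comparison_test'[of _ 0]) (simp add: step)
  then obtain l where "(\<lambda>n. \<Sum>i<n. s (Suc i) - s i) \<longlonglongrightarrow> l"
    by (auto simp: summable_def sums_def)
  moreover have "(\<Sum>i<n. s (Suc i) - s i) = s n" for n
    by (simp add: sum_lessThan_telescope s_0)
  ultimately have lim: "s \<longlonglongrightarrow> l" by simp
  have sa: "star (s n) = s n" for n
    by (induction n) (simp_all add: s_0 s_Suc star_add star_mult assms)
  have "(\<lambda>n. star (s n)) \<longlonglongrightarrow> star l" by (intro tendsto_intros lim)
  then have 1: "star l = l" using lim by (simp add: sa LIMSEQ_unique)
  have "norm (s n) \<le> 1" for n using norm_s t01 order_trans by blast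
  then have 2: "norm l \<le> 1"
    by (intro LIMSEQ_le_const2[OF tendsto_norm[OF lim]]) auto
  have "(\<lambda>n. s (Suc n)) \<longlonglongrightarrow> (1/2) *\<^sub>R (x + l * l)"
    unfolding s_Suc by (intro tendsto_intros lim)
  then have "l = (1/2) *\<^sub>R (x + l * l)"
    using LIMSEQ_Suc[OF lim] LIMSEQ_unique by blast
  then have "2 *\<^sub>R l = 2 *\<^sub>R ((1/2) *\<^sub>R (x + l * l))" by simp
  then have "l + l = x + l * l" by (simp add: scaleR_2)
  then have 3: "(1 - l) * (1 - l) = 1 - x" by (simp add: algebra_simps)
  have 4: "z * l = l * z" if z: "z * x = x * z" for z
  proof -
    have "z * s n = s n * z" for n
    proof (induction n)
      case (Suc n)
      have "z * (s n * s n) = s n * s n * z"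
        by (metis Suc mult.assoc)
      then show ?case by (simp add: s_Suc algebra_simps z)
    qed (simp add: s_0)
    moreover have "(\<lambda>n. z * s n) \<longlonglongrightarrow> z * l" "(\<lambda>n. s n * z) \<longlonglongrightarrow> l * z"
      by (intro tendsto_intros lim)+
    ultimately show ?thesis by (simp add: LIMSEQ_unique)
  qed
  from 1 2 3 4 show thesis by (rule that)
qed

text \<open>
  The cone of positive elements, in a form for which sums are evident. It coincides with the set
  of the elements \<open>star b * b\<close>; see \<open>positive_element_iff_cone\<close> below.
\<close>

definition cone_element :: "'a::cstar_algebra \<Rightarrow> bool" where
  "cone_element a \<longleftrightarrow> star a = a \<and> (\<exists>t. norm (t *\<^sub>R 1 - a) \<le> t)"

lemma cone_selfadjoint: "cone_element a \<Longrightarrow> star a = a"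
  by (simp add: cone_element_def)

lemma cone_add: "cone_element a \<Longrightarrow> cone_element b \<Longrightarrow> cone_element (a + b)"
proof -
  assume "cone_element a" "cone_element b"
  then obtain s t where st: "norm (s *\<^sub>R 1 - a) \<le> s" "norm (t *\<^sub>R 1 - b) \<le> t"
    "star a = a" "star b = b"
    by (auto simp: cone_element_def)
  have "norm ((s + t) *\<^sub>R 1 - (a + b)) \<le> s + t"
    using norm_triangle_ineq[of "s *\<^sub>R 1 - a" "t *\<^sub>R 1 - b"] st by (simp add: algebra_simps)
  then show ?thesis using st by (auto simp: cone_element_def star_add)
qed

lemma cone_scaleR: "cone_element a \<Longrightarrow> 0 \<le> r \<Longrightarrow> cone_element (r *\<^sub>R a)"
proof -
  assume "cone_element a" and r: "0 \<le> r"
  then obtain t where t: "norm (t *\<^sub>R 1 - a) \<le> t" "star a = a"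
    by (auto simp: cone_element_def)
  have "norm ((r * t) *\<^sub>R 1 - r *\<^sub>R a) = r * norm (t *\<^sub>R 1 - a)"
    using r by (simp flip: scaleR_scaleR scaleR_diff_right)
  also have "\<dots> \<le> r * t" using t r by (simp add: mult_left_mono)
  finally show ?thesis using t by (auto simp: cone_element_def)
qed

text \<open>
  As \<open>norm (t * 1 - a) \<le> t\<close> persists when \<open>t\<close> grows, the cone consists of the selfadjoint
  elements that are at distance at most \<open>t\<close> from a large multiple \<open>t * 1\<close> of the unit.
\<close>

lemma cone_norm_minus: "star a = a \<Longrightarrow> norm a \<le> t \<Longrightarrow> cone_element (t *\<^sub>R 1 - a)"
  unfolding cone_element_def by (auto simp: star_diff intro!: exI[of _ t])

lemma cone_scaleR_one: "0 \<le> t \<Longrightarrow> cone_element (t *\<^sub>R 1)"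
  using cone_norm_minus[of 0 t] by simp

lemma cone_square_root:
  fixes a :: "'a::cstar_algebra"
  assumes "cone_element a"
  obtains c where "cone_element c" "c * c = a" "\<And>z. z * a = a * z \<Longrightarrow> z * c = c * z"
proof -
  obtain t where t: "norm (t *\<^sub>R 1 - a) \<le> t" and sa: "star a = a"
    using assms by (auto simp: cone_element_def)
  have "0 \<le> t" using order_trans[OF norm_ge_zero t] .
  show thesis
  proof (cases "t = 0")
    case True
    then have "a = 0" using t by simp
    moreover have "cone_element (0::'a)" using cone_scaleR_one[of 0] by simp
    ultimately show thesis by (intro that[of 0]) auto
  next
    case False
    with \<open>0 \<le> t\<close> have t0: "0 < t" by simp
    define x where "x = 1 - (1/t) *\<^sub>R a"
    have "x = (1/t) *\<^sub>R (t *\<^sub>R 1 - a)" using t0 by (simp add: x_def scaleR_diff_right)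
    then have "norm x = norm (t *\<^sub>R 1 - a) / t" using t0 by simp
    then have "norm x \<le> 1" using t t0 by (simp add: pos_divide_le_eq)
    moreover have "star x = x" by (simp add: x_def star_diff sa)
    ultimately obtain y where y: "star y = y" "norm y \<le> 1" "(1 - y) * (1 - y) = 1 - x"
      "\<And>z. z * x = x * z \<Longrightarrow> z * y = y * z"
      using square_root_near_one[of x] by metis
    define c where "c = sqrt t *\<^sub>R (1 - y)"
    have "cone_element (1 *\<^sub>R 1 - y)" by (rule cone_norm_minus) (use y in auto)
    then have "cone_element c" unfolding c_def by (intro cone_scaleR) (use t0 in auto)
    moreover have "c * c = a"
      using t0 y(3) by (simp add: c_def x_def)
    moreover have "z * c = c * z" if "z * a = a * z" for z
    proof -
      have "z * x = x * z" by (simp add: x_def algebra_simps that)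
      then show ?thesis using y(4) by (simp add: c_def algebra_simps)
    qed
    ultimately show thesis by (rule that)
  qed
qed

lemma norm_le_of_commuting_squares:
  fixes c d :: "'a::cstar_algebra"
  assumes "star c = c" "star d = d" "c * d = d * c" "c * c + d * d = t *\<^sub>R 1" "0 \<le> t"
  shows "(norm c)\<^sup>2 \<le> t"
proof -
  \<comment> \<open>\<open>u\<close> is \<open>sqrt t\<close> times a unitary, and \<open>c\<close> is its real part.\<close>
  define u where "u = c + \<i> *\<^sub>C d"
  have su: "star u = c - \<i> *\<^sub>C d"
    by (simp add: u_def star_add star_scaleC assms)
  have "star u * u = c * c + \<i> *\<^sub>C (c * d) - \<i> *\<^sub>C (d * c) - \<i> *\<^sub>C \<i> *\<^sub>C (d * d)"
    unfolding su
    by (simp add: u_def algebra_simps mult_scaleC_left mult_scaleC_right scaleC_add_right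
        scaleC_diff_right)
  also have "\<dots> = t *\<^sub>R 1"
    using assms(3,4) by (simp add: scaleC_scaleC)
  finally have "(norm u)\<^sup>2 \<le> t"
    using norm_scaleR_one_le[OF assms(5), where 'a='a] cstar_identity[of u] by simp
  moreover have "2 *\<^sub>R c = u + star u" unfolding su by (simp add: u_def scaleR_2)
  then have "2 * norm c \<le> norm u + norm (star u)"
    using norm_triangle_ineq[of u "star u"] by (metis norm_scaleR abs_numeral)
  then have "norm c \<le> norm u" by simp
  then have "(norm c)\<^sup>2 \<le> (norm u)\<^sup>2" by (simp add: power_mono)
  ultimately show ?thesis by linarith
qed

text \<open>
  \<open>c\<close> and the root \<open>d\<close> of \<open>(norm c)\<^sup>2 - c * c\<close> are the real and imaginary parts of a multiple of
  a unitary, so the bound for \<open>c\<close> holds for \<open>d\<close> as well.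
\<close>

lemma selfadjoint_square_bound:
  fixes c :: "'a::cstar_algebra"
  assumes "star c = c"
  shows "norm ((norm c)\<^sup>2 *\<^sub>R 1 - c * c) \<le> (norm c)\<^sup>2"
proof -
  let ?t = "(norm c)\<^sup>2"
  have "cone_element (?t *\<^sub>R 1 - c * c)"
    by (rule cone_norm_minus) (simp_all add: star_mult assms norm_selfadjoint_square)
  then obtain d where d: "cone_element d" "d * d = ?t *\<^sub>R 1 - c * c"
    "\<And>z. z * (?t *\<^sub>R 1 - c * c) = (?t *\<^sub>R 1 - c * c) * z \<Longrightarrow> z * d = d * z"
    using cone_square_root by metis
  have "c * d = d * c" by (rule d(3)) (simp add: algebra_simps)
  then have "(norm d)\<^sup>2 \<le> ?t"
    using d(2) by (intro norm_le_of_commuting_squares[OF cone_selfadjoint[OF d(1)] assms]) auto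
  then show ?thesis
    using d(2) norm_selfadjoint_square[OF cone_selfadjoint[OF d(1)]] by simp
qed

lemma cone_square: "star c = c \<Longrightarrow> cone_element (c * c)"
  using selfadjoint_square_bound unfolding cone_element_def by (auto simp: star_mult)

lemma cone_iff_norm: "cone_element a \<longleftrightarrow> star a = a \<and> norm (norm a *\<^sub>R 1 - a) \<le> norm a"
proof
  assume "cone_element a"
  then obtain c where c: "cone_element c" "c * c = a" using cone_square_root by metis
  have "star c = c" using c cone_selfadjoint by blast
  then show "star a = a \<and> norm (norm a *\<^sub>R 1 - a) \<le> norm a"
    using selfadjoint_square_bound[of c] norm_selfadjoint_square[of c] c
    by (auto simp: star_mult)
qed (auto simp: cone_element_def)

text \<open>
  In \<open>cone_iff_norm\<close> the radius is \<open>norm a\<close>, which depends continuously on \<open>a\<close>.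
\<close>

lemma closed_cone: "closed {a::'a::cstar_algebra. cone_element a}"
  unfolding cone_iff_norm
  by (intro closed_Collect_conj closed_Collect_eq closed_Collect_le continuous_intros)

lemma cone_norm_le:
  fixes a :: "'a::cstar_algebra"
  assumes "cone_element a" "cone_element (t *\<^sub>R 1 - a)" "0 \<le> t"
  shows "norm a \<le> t"
proof -
  obtain c where c: "cone_element c" "c * c = a" "\<And>z. z * a = a * z \<Longrightarrow> z * c = c * z"
    using cone_square_root[OF assms(1)] by metis
  obtain d where d: "cone_element d" "d * d = t *\<^sub>R 1 - a"
    "\<And>z. z * (t *\<^sub>R 1 - a) = (t *\<^sub>R 1 - a) * z \<Longrightarrow> z * d = d * z"
    using cone_square_root[OF assms(2)] by metis
  have "c * a = a * c" by (simp add: c(2)[symmetric] mult.assoc)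
  then have "c * d = d * c" by (intro d(3)) (simp add: algebra_simps)
  then have "(norm c)\<^sup>2 \<le> t"
    using c(2) d(2) assms(3)
    by (intro norm_le_of_commuting_squares[OF cone_selfadjoint[OF c(1)] cone_selfadjoint[OF d(1)]])
      auto
  then show ?thesis
    using norm_selfadjoint_square[OF cone_selfadjoint[OF c(1)]] c(2) by simp
qed

lemma cone_mult_commuting:
  fixes a b :: "'a::cstar_algebra"
  assumes "cone_element a" "cone_element b" "a * b = b * a"
  shows "cone_element (a * b)"
proof -
  obtain c where c: "cone_element c" "c * c = a" "\<And>z. z * a = a * z \<Longrightarrow> z * c = c * z"
    using cone_square_root[OF assms(1)] by metis
  obtain d where d: "cone_element d" "d * d = b" "\<And>z. z * b = b * z \<Longrightarrow> z * d = d * z"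
    using cone_square_root[OF assms(2)] by metis
  have "c * d = d * c" using c(3) d(3) assms(3) by metis
  moreover have "star (c * d) = d * c"
    using c(1) d(1) by (simp add: star_mult cone_selfadjoint)
  moreover have "(c * d) * (c * d) = a * b"
    using \<open>c * d = d * c\<close> by (simp add: c(2)[symmetric] d(2)[symmetric]) (metis mult.assoc)
  ultimately show ?thesis by (metis cone_square)
qed


section \<open>Invertibility and the positivity of \<open>star b * b\<close>\<close>

definition two_sided_inverse :: "'a::monoid_mult \<Rightarrow> 'a \<Rightarrow> bool" where
  "two_sided_inverse a b \<longleftrightarrow> a * b = 1 \<and> b * a = 1"

lemma inverse_commutes:
  fixes a b z :: "'a::monoid_mult"
  assumes "two_sided_inverse a b" "z * a = a * z"
  shows "z * b = b * z"
proof -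
  have ab: "a * b = 1" "b * a = 1" using assms(1) by (simp_all add: two_sided_inverse_def)
  have "z * b = b * (a * z) * b" by (simp add: mult.assoc[symmetric] ab)
  also have "\<dots> = b * (z * a) * b" by (simp only: assms(2))
  also have "\<dots> = b * z" by (simp add: mult.assoc ab)
  finally show ?thesis .
qed

lemma inverse_selfadjoint:
  fixes a b :: "'a::cstar_algebra"
  assumes "two_sided_inverse a b" "star a = a"
  shows "star b = b"
proof -
  have "star (a * b) = 1" using assms by (simp add: two_sided_inverse_def)
  then have "star b * a = 1" by (simp add: star_mult assms)
  then have "star b * a * b = b" by simp
  then show ?thesis using assms by (simp add: mult.assoc two_sided_inverse_def)
qed

lemma neumann_inverse:
  fixes x :: "'a::cstar_algebra"
  assumes "norm x < 1"
  obtains b where "two_sided_inverse (1 - x) b"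
proof -
  have pow: "norm (x ^ n) \<le> norm x ^ n" for n
  proof (induction n)
    case (Suc n)
    then show ?case
      using norm_mult_ineq[of x "x ^ n"] mult_left_mono[OF Suc, of "norm x"] by simp
  qed (simp add: norm_one_le)
  have "summable (\<lambda>n. norm x ^ n)" using assms by (intro summable_geometric) simp
  then have sm: "summable (\<lambda>n. x ^ n)"
    by (rule summable_comparison_test'[of _ 0]) (rule pow)
  let ?b = "\<Sum>n. x ^ n"
  have b: "?b = 1 + (\<Sum>n. x ^ Suc n)"
    using suminf_split_head[OF sm] by (simp del: power_Suc)
  have "x * ?b = (\<Sum>n. x ^ Suc n)" using suminf_mult[OF sm, of x] by simp
  moreover have "?b * x = (\<Sum>n. x ^ Suc n)"
    using suminf_mult2[OF sm, of x] by (simp add: power_commutes)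
  ultimately have "two_sided_inverse (1 - x) ?b"
    using b by (simp add: two_sided_inverse_def algebra_simps)
  then show thesis by (rule that)
qed

lemma cone_plus_invertible:
  fixes a :: "'a::cstar_algebra"
  assumes "cone_element a" "0 < l"
  obtains b where "two_sided_inverse (a + l *\<^sub>R 1) b"
proof -
  obtain t where t: "norm (t *\<^sub>R 1 - a) \<le> t"
    using assms by (auto simp: cone_element_def)
  have "0 \<le> t" using order_trans[OF norm_ge_zero t] .
  then have tl: "0 < t + l" using assms(2) by simp
  define x where "x = (1/(t+l)) *\<^sub>R (t *\<^sub>R 1 - a)"
  have "norm x = norm (t *\<^sub>R 1 - a) / (t + l)" using tl by (simp add: x_def)
  then have "norm x < 1" using t tl assms(2) by (simp add: pos_divide_less_eq)
  then obtain b where b: "two_sided_inverse (1 - x) b" by (rule neumann_inverse)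
  have "(t + l) *\<^sub>R x = t *\<^sub>R 1 - a" using tl by (simp add: x_def)
  then have "(t + l) *\<^sub>R (1 - x) = a + l *\<^sub>R 1"
    by (simp add: scaleR_diff_right scaleR_add_left)
  then have "a + l *\<^sub>R 1 = (t + l) *\<^sub>R (1 - x)" by simp
  then have "two_sided_inverse (a + l *\<^sub>R 1) ((1/(t+l)) *\<^sub>R b)"
    using b tl by (simp add: two_sided_inverse_def)
  then show thesis by (rule that)
qed

lemma cone_inverse:
  fixes a b :: "'a::cstar_algebra"
  assumes "cone_element a" "two_sided_inverse a b"
  shows "cone_element b"
proof -
  have "cone_element (b * b * a)"
  proof (rule cone_mult_commuting)
    show "cone_element (b * b)"
      using assms cone_selfadjoint inverse_selfadjoint by (intro cone_square) blast
    show "b * b * a = a * (b * b)"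
      using assms(2) by (metis mult.assoc mult.right_neutral two_sided_inverse_def mult.left_neutral)
  qed (rule assms)
  then show ?thesis using assms(2) by (simp add: two_sided_inverse_def mult.assoc)
qed

text \<open>
  The least \<open>l\<close> for which \<open>a + l\<close> is in the cone cannot be strictly positive: \<open>a + l\<close> is then
  invertible, so that \<open>a + l - d = (a + l) * (1 - d * (a + l)\<inverse>)\<close> is in the cone for small \<open>d\<close>.
\<close>

lemma cone_if_translates_invertible:
  fixes a :: "'a::cstar_algebra"
  assumes sa: "star a = a" and inv: "\<And>l. 0 < l \<Longrightarrow> \<exists>b. two_sided_inverse (a + l *\<^sub>R 1) b"
  shows "cone_element a"
proof -
  define S where "S = {l. 0 \<le> l \<and> cone_element (a + l *\<^sub>R 1)}"
  have "closed S"
  proof -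
    have "S = {0..} \<inter> (\<lambda>l. a + l *\<^sub>R 1) -` {a. cone_element a}" by (auto simp: S_def)
    moreover have "closed ((\<lambda>l. a + l *\<^sub>R 1) -` {a. cone_element a})"
      by (intro continuous_closed_vimage closed_cone) (intro continuous_intros)
    ultimately show ?thesis by (simp add: closed_Int)
  qed
  moreover have "norm a \<in> S"
    using cone_norm_minus[of "- a" "norm a"] sa by (simp add: S_def add.commute)
  moreover have "bdd_below S" by (auto simp: S_def bdd_below_def)
  ultimately have mem: "Inf S \<in> S" by (intro closed_contains_Inf) auto
  have "Inf S = 0"
  proof (rule ccontr)
    define l where "l = Inf S"
    assume "Inf S \<noteq> 0"
    with mem have l: "0 < l" and cl: "cone_element (a + l *\<^sub>R 1)" by (auto simp: S_def l_def)
    obtain b where b: "two_sided_inverse (a + l *\<^sub>R 1) b" using inv[OF l] by blast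
    define d where "d = min l (1 / (norm b + 1))"
    have nb: "0 < norm b + 1" by (simp add: add_nonneg_pos)
    have d: "0 < d" "d \<le> l" using l nb by (auto simp: d_def)
    have "d * norm b \<le> 1 / (norm b + 1) * norm b"
      by (intro mult_right_mono) (auto simp: d_def)
    also have "\<dots> \<le> 1" using nb by (simp add: field_simps)
    finally have db: "norm (d *\<^sub>R b) \<le> 1" using d by simp
    have "star b = b" using inverse_selfadjoint[OF b] cone_selfadjoint[OF cl] by simp
    then have "cone_element (1 *\<^sub>R 1 - d *\<^sub>R b)"
      using db by (intro cone_norm_minus) auto
    then have "cone_element ((a + l *\<^sub>R 1) * (1 *\<^sub>R 1 - d *\<^sub>R b))"
      using b by (intro cone_mult_commuting cl)
        (simp_all add: two_sided_inverse_def right_diff_distrib left_diff_distrib)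
    moreover have "(a + l *\<^sub>R 1) * (1 *\<^sub>R 1 - d *\<^sub>R b) = (a + l *\<^sub>R 1) - d *\<^sub>R ((a + l *\<^sub>R 1) * b)"
      by (simp add: right_diff_distrib)
    then have "(a + l *\<^sub>R 1) * (1 *\<^sub>R 1 - d *\<^sub>R b) = a + (l - d) *\<^sub>R 1"
      using b by (simp add: two_sided_inverse_def algebra_simps)
    ultimately have "l - d \<in> S" using d by (simp add: S_def)
    then have "l \<le> l - d" unfolding l_def by (intro cInf_lower \<open>bdd_below S\<close>)
    then show False using d by simp
  qed
  then show ?thesis using mem by (simp add: S_def)
qed

text \<open>
  The identity behind the fact that \<open>x * y\<close> and \<open>y * x\<close> have the same spectrum apart from \<open>0\<close>.
\<close>

lemma invertible_swap:
  fixes x y :: "'a::cstar_algebra"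
  assumes "two_sided_inverse (x * y + l *\<^sub>R 1) b" "l \<noteq> 0"
  shows "two_sided_inverse (y * x + l *\<^sub>R 1) ((1/l) *\<^sub>R (1 - y * b * x))"
proof -
  have b1: "x * y * b + l *\<^sub>R b = 1" and b2: "b * x * y + l *\<^sub>R b = 1"
    using assms(1) by (simp_all add: two_sided_inverse_def algebra_simps mult.assoc)
  have "(y * x + l *\<^sub>R 1) * (1 - y * b * x)
      = y * x + l *\<^sub>R 1 - y * (x * y * b + l *\<^sub>R b) * x"
    by (simp add: algebra_simps)
  then have "(y * x + l *\<^sub>R 1) * (1 - y * b * x) = l *\<^sub>R 1" by (simp add: b1)
  moreover have "(1 - y * b * x) * (y * x + l *\<^sub>R 1)
      = y * x + l *\<^sub>R 1 - y * (b * x * y + l *\<^sub>R b) * x"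
    by (simp add: algebra_simps)
  then have "(1 - y * b * x) * (y * x + l *\<^sub>R 1) = l *\<^sub>R 1" by (simp add: b2)
  ultimately show ?thesis using assms(2) by (simp add: two_sided_inverse_def)
qed

text \<open>
  A smoothed absolute value \<open>k = sqrt (h\<^sup>2 + e\<^sup>2)\<close>. It is invertible, and \<open>p = k - h\<close> satisfies
  \<open>2 * k * p = p\<^sup>2 + e\<^sup>2\<close>, so that \<open>p\<close> is a product of commuting elements of the cone.
\<close>

lemma smoothed_abs:
  fixes h :: "'a::cstar_algebra"
  assumes sa: "star h = h" and e: "0 < e"
  obtains k where "cone_element k" "k * k = h * h + e\<^sup>2 *\<^sub>R 1" "h * k = k * h"
    "cone_element (k - h)"
proof -
  have ce: "cone_element (h * h + e\<^sup>2 *\<^sub>R 1)"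
    by (intro cone_add cone_square sa cone_scaleR_one) simp
  obtain k where k: "cone_element k" "k * k = h * h + e\<^sup>2 *\<^sub>R 1"
    "\<And>z. z * (h * h + e\<^sup>2 *\<^sub>R 1) = (h * h + e\<^sup>2 *\<^sub>R 1) * z \<Longrightarrow> z * k = k * z"
    using cone_square_root[OF ce] by metis
  have hk: "h * k = k * h" by (rule k(3)) (simp add: algebra_simps)
  obtain b where b: "two_sided_inverse (k * k) b"
    using cone_plus_invertible[OF cone_square[OF sa], of "e\<^sup>2"] e k(2) by auto
  have "k * b = b * k" by (rule inverse_commutes[OF b]) (simp add: mult.assoc)
  then have kb: "two_sided_inverse k (k * b)"
    using b unfolding two_sided_inverse_def by (metis mult.assoc)
  define p where "p = k - h"
  have sk: "star k = k" using k(1) by (rule cone_selfadjoint)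
  have sp: "star p = p" by (simp add: p_def star_diff sk sa)

  have kp: "2 *\<^sub>R (k * p) = p * p + e\<^sup>2 *\<^sub>R 1"
    by (simp add: p_def algebra_simps hk k(2) scaleR_2 flip: scaleR_add_left)
  have pk: "p * k = k * p" by (simp add: p_def algebra_simps hk)
  have "cone_element ((p * p + e\<^sup>2 *\<^sub>R 1) * (k * b))"
  proof (rule cone_mult_commuting)
    show "cone_element (p * p + e\<^sup>2 *\<^sub>R 1)"
      by (intro cone_add cone_square sp cone_scaleR_one) simp
    show "cone_element (k * b)" by (rule cone_inverse[OF k(1) kb])
    have "p * p * k = k * (p * p)" by (metis pk mult.assoc)
    then show "(p * p + e\<^sup>2 *\<^sub>R 1) * (k * b) = (k * b) * (p * p + e\<^sup>2 *\<^sub>R 1)"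
      by (intro inverse_commutes[OF kb]) (simp add: algebra_simps)
  qed
  moreover have "(p * p + e\<^sup>2 *\<^sub>R 1) * (k * b) = 2 *\<^sub>R p"
    using kb by (simp add: kp[symmetric] pk[symmetric] mult.assoc two_sided_inverse_def)
  ultimately have "cone_element (2 *\<^sub>R p)" by simp
  then have "cone_element ((1/2) *\<^sub>R (2 *\<^sub>R p))" by (rule cone_scaleR) simp
  then have "cone_element (k - h)" by (simp add: p_def)
  with k(1,2) hk show thesis by (rule that)
qed

text \<open>The sum is \<open>(u\<^sup>2 + w\<^sup>2) / 2\<close> for the selfadjoint \<open>u = x + star x\<close> and \<open>w = \<i> * (x - star x)\<close>.\<close>

lemma cone_star_mult_sum: "cone_element (x * star x + star x * (x::'a::cstar_algebra))"
proof -
  define u where "u = x + star x"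
  define w where "w = \<i> *\<^sub>C (x - star x)"
  have su: "star u = u" by (simp add: u_def star_add star_star add.commute)
  have sw: "star w = w"
    by (simp add: w_def star_scaleC star_diff star_star scaleC_diff_right)
  have "w * w = (\<i> * \<i>) *\<^sub>C ((x - star x) * (x - star x))"
    by (simp add: w_def mult_scaleC_left mult_scaleC_right scaleC_scaleC)
  then have "w * w = - ((x - star x) * (x - star x))" by simp
  then have "u * u + w * w = 2 *\<^sub>R (x * star x + star x * x)"
    by (simp add: u_def algebra_simps scaleR_2)
  then have "(1/2) *\<^sub>R (u * u + w * w) = x * star x + star x * x" by simp
  moreover have "cone_element ((1/2) *\<^sub>R (u * u + w * w))"
    by (intro cone_scaleR cone_add cone_square su sw) simp
  ultimately show ?thesis by simp
qed

text \<open>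
  With \<open>h = star b * b\<close> and \<open>p\<close> twice the smoothed negative part of \<open>h\<close>, the element \<open>x = b * p\<close> satisfies
  \<open>2 * star x * x = e\<^sup>2 * p - p\<^sup>3\<close>, which is nearly negative. As \<open>x * star x + star x * x\<close> is
  positive, \<open>x * star x\<close> is nearly positive; and so is \<open>star x * x\<close>, since both have the same
  spectrum apart from \<open>0\<close>. Hence \<open>p\<^sup>3\<close> is small.
\<close>

lemma smoothed_negative_part_small:
  fixes b :: "'a::cstar_algebra"
  assumes e: "0 < e" and k: "cone_element k" "k * k = h * h + e\<^sup>2 *\<^sub>R 1" "h * k = k * h"
    "cone_element (k - h)" and h: "h = star b * b"
  shows "norm (k - h) \<le> 2 * e"
proof -
  define p where "p = k - h"
  define x where "x = b * p"
  \<comment> \<open>\<open>d\<close> bounds the term \<open>e\<^sup>2 * p / 2\<close> of \<open>star x * x\<close>.\<close>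
  define d where "d = e\<^sup>2 * norm p / 2"
  have cp: "cone_element p" using k(4) by (simp add: p_def)
  have sp: "star p = p" by (rule cone_selfadjoint[OF cp])
  have d0: "0 \<le> d" by (simp add: d_def)
  have "p * (k + h) = e\<^sup>2 *\<^sub>R 1" by (simp add: p_def algebra_simps k(2,3))
  then have "p * (k + h) * p = e\<^sup>2 *\<^sub>R p" by simp
  moreover have "2 *\<^sub>R h = (k + h) - p" by (simp add: p_def scaleR_2)
  then have "2 *\<^sub>R (p * h * p) = p * ((k + h) - p) * p"
    by (metis mult_scaleR_left mult_scaleR_right)
  ultimately have "2 *\<^sub>R (p * h * p) = e\<^sup>2 *\<^sub>R p - p * p * p"
    by (simp add: right_diff_distrib left_diff_distrib mult.assoc)
  then have "(1/2) *\<^sub>R (2 *\<^sub>R (p * h * p)) = (1/2) *\<^sub>R (e\<^sup>2 *\<^sub>R p - p * p * p)" by simp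
  then have php: "p * h * p = (1/2) *\<^sub>R (e\<^sup>2 *\<^sub>R p - p * p * p)" by simp
  have "star x * x = p * h * p" by (simp add: x_def star_mult sp h mult.assoc)
  with php have xx: "star x * x = (1/2) *\<^sub>R (e\<^sup>2 *\<^sub>R p - p * p * p)" by simp
  have cppp: "cone_element (p * p * p)"
    by (intro cone_mult_commuting cone_square cp sp) (simp add: mult.assoc)
  have cpn: "cone_element ((e\<^sup>2/2) *\<^sub>R (norm p *\<^sub>R 1 - p))"
    by (intro cone_scaleR cone_norm_minus sp) auto
  have "cone_element ((x * star x + star x * x) + (1/2) *\<^sub>R (p * p * p)
      + (e\<^sup>2/2) *\<^sub>R (norm p *\<^sub>R 1 - p))"
    by (intro cone_add cone_star_mult_sum cpn cone_scaleR cppp) simp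
  then have c1: "cone_element (x * star x + d *\<^sub>R 1)"
    by (simp add: xx algebra_simps d_def)
  have c2: "cone_element (star x * x + d *\<^sub>R 1)"
  proof (rule cone_if_translates_invertible)
    fix l :: real assume l: "0 < l"
    obtain c where "two_sided_inverse ((x * star x + d *\<^sub>R 1) + l *\<^sub>R 1) c"
      using cone_plus_invertible[OF c1 l] by blast
    then have "two_sided_inverse (x * star x + (d + l) *\<^sub>R 1) c" by (simp add: algebra_simps)
    then have "\<exists>c. two_sided_inverse (star x * x + (d + l) *\<^sub>R 1) c"
      using invertible_swap d0 l by (metis add_nonneg_pos less_irrefl)
    then show "\<exists>c. two_sided_inverse ((star x * x + d *\<^sub>R 1) + l *\<^sub>R 1) c"
      by (simp add: algebra_simps)
  qed (simp add: star_add star_mult star_star)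
  have "cone_element (2 *\<^sub>R ((star x * x + d *\<^sub>R 1) + (e\<^sup>2/2) *\<^sub>R (norm p *\<^sub>R 1 - p)))"
    by (intro cone_add c2 cpn cone_scaleR) simp
  moreover have "2 *\<^sub>R ((star x * x + d *\<^sub>R 1) + (e\<^sup>2/2) *\<^sub>R (norm p *\<^sub>R 1 - p))
      = (4 * d) *\<^sub>R 1 - p * p * p"
    by (simp add: xx algebra_simps d_def flip: scaleR_2)
  ultimately have "norm (p * p * p) \<le> 4 * d"
    by (intro cone_norm_le cppp) (use d0 in auto)
  then have p3: "norm (p * p * p) \<le> 2 * e\<^sup>2 * norm p" by (simp add: d_def mult_ac)
  \<comment> \<open>The norm of \<open>p\<^sup>4\<close> is \<open>(norm p)\<^sup>4\<close> by the C*-identity, and \<open>p\<^sup>4\<close> has the small factor \<open>p\<^sup>3\<close>.\<close>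
  have "(norm p)^4 = norm ((p * p) * (p * p))"
    using norm_selfadjoint_square[of p] norm_selfadjoint_square[of "p * p"] sp
    by (simp add: star_mult)
  also have "\<dots> = norm ((p * p * p) * p)" by (simp add: mult.assoc)
  also have "\<dots> \<le> norm (p * p * p) * norm p" by (rule norm_mult_ineq)
  also have "\<dots> \<le> 2 * e\<^sup>2 * norm p * norm p" by (intro mult_right_mono p3) simp
  finally have "(norm p)\<^sup>2 * (norm p)\<^sup>2 \<le> 2 * e\<^sup>2 * (norm p)\<^sup>2"
    by (simp add: power2_eq_square power4_eq_xxxx algebra_simps)
  then have "(norm p)\<^sup>2 \<le> 2 * e\<^sup>2 \<or> (norm p)\<^sup>2 = 0"
    by (metis mult_le_cancel_right_pos zero_less_power2 power_zero_numeral power_eq_0_iff)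
  moreover have "2 * e\<^sup>2 \<le> (2 * e)\<^sup>2" by (simp add: power_mult_distrib)
  ultimately have "(norm p)\<^sup>2 \<le> (2 * e)\<^sup>2"
    by (metis order_trans zero_le_power2)
  then have "norm p \<le> 2 * e" by (rule power2_le_imp_le) (use e in simp)
  then show ?thesis by (simp add: p_def)
qed

text \<open>
  \<open>star b * b\<close> is the limit for \<open>e \<rightarrow> 0\<close> of its smoothed absolute values, which lie in the cone.
\<close>

theorem cone_star_mult: "cone_element (star b * (b::'a::cstar_algebra))"
proof -
  define h where "h = star b * b"
  have sh: "star h = h" by (simp add: h_def star_mult star_star)
  have "\<exists>k. cone_element k \<and> norm (k - h) \<le> 2 * inverse (real (Suc n))" for n
  proof -
    obtain k where "cone_element k" "k * k = h * h + (inverse (real (Suc n)))\<^sup>2 *\<^sub>R 1"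
      "h * k = k * h" "cone_element (k - h)"
      using smoothed_abs[OF sh, of "inverse (real (Suc n))"] by auto
    then show ?thesis
      using smoothed_negative_part_small[of "inverse (real (Suc n))" k h b] h_def by auto
  qed
  then obtain k where k: "cone_element (k n)" "norm (k n - h) \<le> 2 * inverse (real (Suc n))" for n
    by metis
  have "(\<lambda>n. 2 * inverse (real (Suc n))) \<longlonglongrightarrow> 2 * 0"
    by (intro tendsto_intros LIMSEQ_inverse_real_of_nat)
  then have "(\<lambda>n. 2 * inverse (real (Suc n))) \<longlonglongrightarrow> 0" by simp
  then have "(\<lambda>n. k n - h) \<longlonglongrightarrow> 0"
    by (rule Lim_null_comparison[rotated]) (intro always_eventually allI k)
  then have "k \<longlonglongrightarrow> h" by (simp add: LIM_zero_iff)
  then have "h \<in> {a. cone_element a}"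
    by (intro Lim_in_closed_set[OF closed_cone, where f = k and F = sequentially]) (use k in auto)
  then show ?thesis by (simp add: h_def)
qed

lemma positive_element_iff_cone: "positive_element a \<longleftrightarrow> cone_element a"
  using cone_star_mult cone_square_root cone_selfadjoint unfolding positive_element_def by metis


section \<open>The order of a C*-algebra\<close>

lemma positive_add: "positive_element a \<Longrightarrow> positive_element b \<Longrightarrow> positive_element (a + b)"
  by (simp add: positive_element_iff_cone cone_add)

lemma positive_scaleR: "positive_element a \<Longrightarrow> 0 \<le> r \<Longrightarrow> positive_element (r *\<^sub>R a)"
  by (simp add: positive_element_iff_cone cone_scaleR)

lemma positive_zero [simp]: "positive_element 0"
  by (auto simp: positive_element_def intro!: exI[of _ 0])

lemma positive_sum: "(\<And>i. i \<in> I \<Longrightarrow> positive_element (f i)) \<Longrightarrow> positive_element (sum f I)"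
  by (induction I rule: infinite_finite_induct) (simp_all add: positive_add)

lemma positive_selfadjoint: "positive_element a \<Longrightarrow> star a = a"
  by (simp add: positive_element_iff_cone cone_selfadjoint)

lemma positive_star_mult [simp]: "positive_element (star a * a)"
  by (auto simp: positive_element_def)

lemma positive_conj: "positive_element a \<Longrightarrow> positive_element (star z * a * z)"
proof -
  assume "positive_element a"
  then obtain b where "a = star b * b" by (auto simp: positive_element_def)
  then have "star z * a * z = star (b * z) * (b * z)" by (simp add: star_mult mult.assoc)
  then show ?thesis by (metis positive_star_mult)
qed

lemma positive_limit:
  assumes "(f \<longlongrightarrow> l) F" "F \<noteq> bot" "eventually (\<lambda>x. positive_element (f x)) F"
  shows "positive_element l"
  using Lim_in_closed_set[OF closed_cone _ assms(2,1)] assms(3)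
  by (simp add: positive_element_iff_cone)

lemma positive_norm_minus: "star a = a \<Longrightarrow> norm a \<le> t \<Longrightarrow> positive_element (t *\<^sub>R 1 - a)"
  by (simp add: positive_element_iff_cone cone_norm_minus)

lemma positive_norm_mono:
  fixes a b :: "'a::cstar_algebra"
  assumes "positive_element a" "positive_element (b - a)"
  shows "norm a \<le> norm b"
proof -
  have "star b = star (b - a) + star a" by (simp add: star_diff)
  then have "star b = b" using assms by (simp add: positive_selfadjoint)
  then have "positive_element ((norm b *\<^sub>R 1 - b) + (b - a))"
    by (intro positive_add assms positive_norm_minus) auto
  then show ?thesis using assms(1)
    by (intro cone_norm_le) (simp_all add: positive_element_iff_cone)
qed

lemma positive_plus_inverse:
  fixes p :: "'a::cstar_algebra"
  assumes "positive_element p" "0 < e"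
  obtains q where "positive_element q" "two_sided_inverse (p + e *\<^sub>R 1) q"
proof -
  obtain q where q: "two_sided_inverse (p + e *\<^sub>R 1) q"
    using cone_plus_invertible assms by (auto simp: positive_element_iff_cone)
  have "cone_element (p + e *\<^sub>R 1)"
    using assms by (intro cone_add cone_scaleR_one) (auto simp: positive_element_iff_cone)
  then have "positive_element q"
    using cone_inverse q by (auto simp: positive_element_iff_cone)
  with q show thesis using that by blast
qed

text \<open>
  The Cauchy-Schwarz inequality for \<open>p = \<langle>x, x\<rangle>\<close>, \<open>q = \<langle>x, y\<rangle>\<close>, \<open>r = \<langle>y, y\<rangle>\<close>: the hypothesis is the
  positivity of \<open>\<langle>x a + y, x a + y\<rangle>\<close>, which is used for \<open>a = - q / t\<close> with \<open>t\<close> slightly above \<open>norm p\<close>.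
\<close>

lemma cauchy_schwarz_from_positivity:
  fixes p q r :: "'a::cstar_algebra"
  assumes "\<And>a. positive_element (star a * p * a + star a * q + star q * a + r)"
    and p: "positive_element p"
  shows "(norm q)\<^sup>2 \<le> norm p * norm r"
proof (rule field_le_epsilon)
  fix e :: real assume e: "0 < e"
  have n1: "0 < norm r + 1" by (simp add: add_nonneg_pos)
  \<comment> \<open>\<open>t\<close> must be positive even if \<open>p = 0\<close>, and \<open>t * norm r\<close> must exceed \<open>norm p * norm r\<close> by at
    most \<open>e\<close>.\<close>
  define t where "t = norm p + e / (norm r + 1)"
  have t: "0 < t" "norm p \<le> t" using e n1 by (auto simp: t_def add_nonneg_pos)
  have "positive_element ((1/t\<^sup>2) *\<^sub>R (star q * p * q) - (2/t) *\<^sub>R (star q * q) + r)"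
    using assms(1)[of "- (1/t) *\<^sub>R q"] by (simp add: power2_eq_square algebra_simps
        flip: scaleR_add_left)
  moreover have "positive_element ((1/t\<^sup>2) *\<^sub>R (star q * (t *\<^sub>R 1 - p) * q))"
    by (intro positive_scaleR positive_conj positive_norm_minus positive_selfadjoint p t(2)) simp
  ultimately have "positive_element (((1/t\<^sup>2) *\<^sub>R (star q * p * q) - (2/t) *\<^sub>R (star q * q) + r)
      + (1/t\<^sup>2) *\<^sub>R (star q * (t *\<^sub>R 1 - p) * q))"
    by (rule positive_add)
  also have "((1/t\<^sup>2) *\<^sub>R (star q * p * q) - (2/t) *\<^sub>R (star q * q) + r)
      + (1/t\<^sup>2) *\<^sub>R (star q * (t *\<^sub>R 1 - p) * q) = r - (1/t) *\<^sub>R (star q * q)"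
  proof -
    have "(1/t\<^sup>2) *\<^sub>R (star q * (t *\<^sub>R 1 - p) * q)
        = (1/t) *\<^sub>R (star q * q) - (1/t\<^sup>2) *\<^sub>R (star q * p * q)"
      using t by (simp add: algebra_simps power2_eq_square)
    moreover have "(2/t) *\<^sub>R (star q * q) = (1/t) *\<^sub>R (star q * q) + (1/t) *\<^sub>R (star q * q)"
      by (simp flip: scaleR_add_left)
    ultimately show ?thesis by simp
  qed
  finally have "norm ((1/t) *\<^sub>R (star q * q)) \<le> norm r"
    using t by (intro positive_norm_mono positive_scaleR) auto
  then have "(norm q)\<^sup>2 \<le> t * norm r"
    using t by (simp add: cstar_identity field_simps)
  also have "\<dots> = norm p * norm r + e * (norm r / (norm r + 1))" by (simp add: t_def algebra_simps)
  also have "\<dots> \<le> norm p * norm r + e"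
    using n1 e by (simp add: field_simps)
  finally show "(norm q)\<^sup>2 \<le> norm p * norm r + e" .
qed

text \<open>
  \<open>\<phi> (star a * a)\<close> is compared with \<open>\<phi> ((norm a)\<^sup>2 * 1)\<close>; the difference of the arguments is of the
  form \<open>star b * b\<close>. Automorphisms and the maps \<open>a \<mapsto> \<langle>x, \<rho>(a) x\<rangle>\<close> of a representation are of this kind.
\<close>

lemma positive_map_norm_le:
  fixes \<phi> :: "'a::cstar_algebra \<Rightarrow> 'a"
  assumes add: "\<And>x y. \<phi> (x + y) = \<phi> x + \<phi> y" and scale: "\<And>c x. \<phi> (c *\<^sub>C x) = c *\<^sub>C \<phi> x"
    and pos: "\<And>x. positive_element (\<phi> (star x * x))"
  shows "norm (\<phi> (star a * a)) \<le> (norm a)\<^sup>2 * norm (\<phi> 1)"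
proof -
  let ?t = "(norm a)\<^sup>2"
  have "positive_element (?t *\<^sub>R 1 - star a * a)"
    by (intro positive_norm_minus) (simp_all add: star_mult star_star cstar_identity)
  then obtain b where "?t *\<^sub>R 1 - star a * a = star b * b" by (auto simp: positive_element_def)
  then have "?t *\<^sub>R 1 = star b * b + star a * a" by (simp add: algebra_simps)
  then have "\<phi> (?t *\<^sub>R 1) = \<phi> (star b * b) + \<phi> (star a * a)" by (simp add: add)
  then have "?t *\<^sub>R \<phi> 1 - \<phi> (star a * a) = \<phi> (star b * b)"
    by (simp add: scaleR_scaleC scale)
  then have "norm (\<phi> (star a * a)) \<le> norm (?t *\<^sub>R \<phi> 1)"
    by (intro positive_norm_mono) (simp_all add: pos)
  then show ?thesis by simp
qed

lemma star_automorphism_norm_le: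
  assumes "star_automorphism f"
  shows "norm (f a) \<le> norm (a::'a::cstar_algebra)"
proof -
  have "norm (f (star a * a)) \<le> (norm a)\<^sup>2 * norm (f 1)"
    by (rule positive_map_norm_le) (use assms in \<open>auto simp: star_automorphism_def clinear_def\<close>)
  also have "\<dots> \<le> (norm a)\<^sup>2 * 1"
    using assms norm_one_le[where 'a = 'a] by (intro mult_left_mono) (auto simp: star_automorphism_def)
  finally have "(norm (f a))\<^sup>2 \<le> (norm a)\<^sup>2"
    using assms by (simp add: star_automorphism_def cstar_identity)
  then show ?thesis by (rule power2_le_imp_le) simp
qed


section \<open>Hilbert modules and equivariant representations\<close>

lemma hnorm_nonneg [simp]: "0 \<le> hnorm X x"
  by (simp add: hnorm_def)

lemma hnorm_square: "(hnorm X x)\<^sup>2 = norm (hinner X x x)"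
  by (simp add: hnorm_def)

context hilbert_module
begin

lemma inner_add_left:
  assumes "x \<in> vecs X" "y \<in> vecs X" "z \<in> vecs X"
  shows "hinner X (hadd X x y) z = hinner X x z + hinner X y z"
proof -
  have "hinner X (hadd X x y) z = star (hinner X z (hadd X x y))"
    using assms by (intro inner_star) (auto intro: add_closed)
  also have "\<dots> = star (hinner X z x) + star (hinner X z y)"
    using assms by (simp add: inner_add star_add)
  finally show ?thesis using assms inner_star[of z x] inner_star[of z y] by simp
qed

lemma inner_act_left:
  assumes "x \<in> vecs X" "y \<in> vecs X"
  shows "hinner X (hact X x a) y = star a * hinner X x y"
proof -
  have "hinner X (hact X x a) y = star (hinner X y (hact X x a))"
    using assms by (intro inner_star) (auto intro: act_closed)
  also have "\<dots> = star a * star (hinner X y x)"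
    using assms by (simp add: inner_act star_mult)
  finally show ?thesis using assms inner_star[of y x] by simp
qed

lemma inner_zero_right: "x \<in> vecs X \<Longrightarrow> hinner X x (hzero X) = 0"
  using inner_add[of x "hzero X" "hzero X"] add_zero[of "hzero X"] zero_closed by simp

lemma hnorm_scale:
  assumes "x \<in> vecs X"
  shows "hnorm X (hscale X c x) = cmod c * hnorm X x"
proof -
  have "hscale X c x = hact X x (c *\<^sub>C 1)" using assms by (simp add: act_scale_right act_one)
  then have "hinner X (hscale X c x) (hscale X c x)
      = star (c *\<^sub>C 1) * hinner X x x * (c *\<^sub>C 1)"
    using assms by (simp add: inner_act_left inner_act act_closed mult.assoc)
  also have "\<dots> = (c * cnj c) *\<^sub>C hinner X x x"
    by (simp add: star_scaleC mult_scaleC_left mult_scaleC_right scaleC_scaleC)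
  finally have "norm (hinner X (hscale X c x) (hscale X c x)) = (cmod c)\<^sup>2 * norm (hinner X x x)"
    by (simp add: norm_scaleC norm_mult power2_eq_square)
  then show ?thesis by (simp add: hnorm_def real_sqrt_mult)
qed

lemma cauchy_schwarz:
  assumes "x \<in> vecs X" "y \<in> vecs X"
  shows "norm (hinner X x y) \<le> hnorm X x * hnorm X y"
proof -
  have "(norm (hinner X x y))\<^sup>2 \<le> norm (hinner X x x) * norm (hinner X y y)"
  proof (rule cauchy_schwarz_from_positivity)
    fix a
    let ?z = "hadd X (hact X x a) y"
    have "positive_element (hinner X ?z ?z)"
      using assms by (intro inner_positive add_closed act_closed)
    also have "hinner X ?z ?z = star a * hinner X x x * a + star a * hinner X x y
        + star (hinner X x y) * a + hinner X y y"
      using assms inner_star[of x y]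
      by (simp add: inner_add_left inner_add add_closed act_closed inner_act inner_act_left
          mult.assoc distrib_right distrib_left add.assoc)
    finally show "positive_element \<dots>" .
  qed (use assms inner_positive in auto)
  also have "\<dots> = (hnorm X x * hnorm X y)\<^sup>2" by (simp add: power_mult_distrib hnorm_square)
  finally show ?thesis by (rule power2_le_imp_le) simp
qed

text \<open>
  A finite sum of vectors is described by its inner products, which live in a type with a sum
  operator, whereas the addition of the module is only a function on a carrier set.
\<close>

lemma sum_of_vectors:
  assumes "finite I" "\<And>i. i \<in> I \<Longrightarrow> z i \<in> vecs X"
  obtains Z where "Z \<in> vecs X" "\<And>x. x \<in> vecs X \<Longrightarrow> hinner X x Z = (\<Sum>i\<in>I. hinner X x (z i))"
proof -
  have "\<exists>Z\<in>vecs X. \<forall>x\<in>vecs X. hinner X x Z = (\<Sum>i\<in>I. hinner X x (z i))"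
    using assms
  proof (induction I rule: finite_induct)
    case empty
    then show ?case using zero_closed inner_zero_right by auto
  next
    case (insert i I)
    then obtain Z where "Z \<in> vecs X" "\<forall>x\<in>vecs X. hinner X x Z = (\<Sum>i\<in>I. hinner X x (z i))"
      by auto
    then show ?case
      using insert.prems insert.hyps
      by (intro bexI[of _ "hadd X (z i) Z"]) (auto simp: inner_add add_closed)
  qed
  then show thesis using that by blast
qed

lemma positive_gram_sum:
  assumes "finite I" "\<And>i. i \<in> I \<Longrightarrow> z i \<in> vecs X"
  shows "positive_element (\<Sum>i\<in>I. \<Sum>j\<in>I. hinner X (z i) (z j))"
proof -
  obtain Z where Z: "Z \<in> vecs X" "\<And>x. x \<in> vecs X \<Longrightarrow> hinner X x Z = (\<Sum>i\<in>I. hinner X x (z i))"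
    by (rule sum_of_vectors[OF assms]) blast+
  have "hinner X Z Z = (\<Sum>i\<in>I. hinner X Z (z i))" by (rule Z(2)[OF Z(1)])
  also have "\<dots> = (\<Sum>i\<in>I. \<Sum>j\<in>I. hinner X (z j) (z i))"
  proof (rule sum.cong[OF refl])
    fix i assume i: "i \<in> I"
    have "hinner X Z (z i) = star (\<Sum>j\<in>I. hinner X (z i) (z j))"
      using inner_star[OF assms(2)[OF i] Z(1)] Z(2)[OF assms(2)[OF i]] by simp
    also have "\<dots> = (\<Sum>j\<in>I. hinner X (z j) (z i))"
      unfolding star_sum by (intro sum.cong refl inner_star[symmetric] assms(2) i)
    finally show "hinner X Z (z i) = (\<Sum>j\<in>I. hinner X (z j) (z i))" .
  qed
  also have "\<dots> = (\<Sum>i\<in>I. \<Sum>j\<in>I. hinner X (z i) (z j))" by (rule sum.swap)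
  finally show ?thesis using inner_positive[OF Z(1)] by simp
qed

end

context twisted_system
begin

lemma alpha_add: "\<alpha> g (a + b) = \<alpha> g a + \<alpha> g b"
  and alpha_scale: "\<alpha> g (c *\<^sub>C a) = c *\<^sub>C \<alpha> g a"
  and alpha_mult: "\<alpha> g (a * b) = \<alpha> g a * \<alpha> g b"
  and alpha_star: "\<alpha> g (star a) = star (\<alpha> g a)"
  and alpha_one: "\<alpha> g 1 = 1"
  and alpha_bij: "bij (\<alpha> g)"
  using alpha_automorphism[of g] by (auto simp: star_automorphism_def clinear_def)

lemma alpha_zero [simp]: "\<alpha> g 0 = 0"
  using alpha_scale[of g 0 0] by simp

lemma alpha_diff: "\<alpha> g (a - b) = \<alpha> g a - \<alpha> g b"
  using alpha_add[of g "a - b" b] by simp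

lemma alpha_inv [simp]: "\<alpha> g (inv (\<alpha> g) a) = a" "inv (\<alpha> g) (\<alpha> g a) = a"
  using alpha_bij[of g] by (simp_all add: bij_def surj_f_inv_f)

lemma inv_alpha_automorphism: "star_automorphism (inv (\<alpha> g))"
proof -
  have eqI: "x = y" if "\<alpha> g x = \<alpha> g y" for x y
    using that by (metis alpha_inv(2))
  show ?thesis
    unfolding star_automorphism_def clinear_def
    by (intro conjI allI bij_imp_bij_inv alpha_bij; rule eqI)
      (simp_all add: alpha_add alpha_scale alpha_mult alpha_star alpha_one)
qed

lemma alpha_norm: "norm (\<alpha> g a) = norm a"
proof (rule antisym)
  show "norm (\<alpha> g a) \<le> norm a" by (rule star_automorphism_norm_le[OF alpha_automorphism])
  show "norm a \<le> norm (\<alpha> g a)"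
    using star_automorphism_norm_le[OF inv_alpha_automorphism, of g "\<alpha> g a"] by simp
qed

lemma bounded_linear_alpha: "bounded_linear (\<alpha> g)"
  by (rule bounded_linear_intro[of _ 1]) (simp_all add: alpha_add alpha_scale alpha_norm scaleR_scaleC)

lemma inv_alpha_add: "inv (\<alpha> g) (a + b) = inv (\<alpha> g) a + inv (\<alpha> g) b"
  and inv_alpha_scale: "inv (\<alpha> g) (c *\<^sub>C a) = c *\<^sub>C inv (\<alpha> g) a"
  and inv_alpha_mult: "inv (\<alpha> g) (a * b) = inv (\<alpha> g) a * inv (\<alpha> g) b"

  using inv_alpha_automorphism[of g] by (auto simp: star_automorphism_def clinear_def)

lemma inv_alpha_norm: "norm (inv (\<alpha> g) a) = norm a"
  using alpha_norm[of g "inv (\<alpha> g) a"] by simp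

lemma bounded_linear_inv_alpha: "bounded_linear (inv (\<alpha> g))"
  by (rule bounded_linear_intro[of _ 1])
    (simp_all add: inv_alpha_add inv_alpha_scale inv_alpha_norm scaleR_scaleC)

end

context equivariant_rep
begin

lemma rho_closed: "x \<in> vecs X \<Longrightarrow> \<rho> a x \<in> vecs X"
  and rho_adjoint: "x \<in> vecs X \<Longrightarrow> y \<in> vecs X \<Longrightarrow> hinner X (\<rho> a x) y = hinner X x (\<rho> (star a) y)"
  and rho_add: "x \<in> vecs X \<Longrightarrow> \<rho> (a + b) x = hadd X (\<rho> a x) (\<rho> b x)"
  and rho_scale: "x \<in> vecs X \<Longrightarrow> \<rho> (c *\<^sub>C a) x = hscale X c (\<rho> a x)"
  and rho_mult: "x \<in> vecs X \<Longrightarrow> \<rho> (a * b) x = \<rho> a (\<rho> b x)"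
  and rho_one: "x \<in> vecs X \<Longrightarrow> \<rho> 1 x = x"
  using rho_rep by (auto simp: adjointable_rep_def adjoint_pair_def)

lemma rho_norm:
  assumes "x \<in> vecs X"
  shows "hnorm X (\<rho> a x) \<le> norm a * hnorm X x"
proof -
  have "norm (hinner X x (\<rho> (star a * a) x)) \<le> (norm a)\<^sup>2 * norm (hinner X x (\<rho> 1 x))"
  proof (rule positive_map_norm_le)
    fix b
    have "hinner X x (\<rho> (star b * b) x) = hinner X (\<rho> b x) (\<rho> b x)"
      using assms by (simp add: rho_mult rho_adjoint rho_closed)
    then show "positive_element (hinner X x (\<rho> (star b * b) x))"
      using assms by (simp add: inner_positive rho_closed)
  qed (use assms in \<open>simp_all add: rho_add rho_scale inner_add inner_scale rho_closed\<close>)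
  then have "(hnorm X (\<rho> a x))\<^sup>2 \<le> (norm a * hnorm X x)\<^sup>2"
    using assms
    by (simp add: rho_one hnorm_square power_mult_distrib rho_mult rho_adjoint rho_closed)
  then show ?thesis by (rule power2_le_imp_le) simp
qed

lemma v_bij: "bij_betw (v g) (vecs X) (vecs X)"

  and v_scale: "x \<in> vecs X \<Longrightarrow> v g (hscale X c x) = hscale X c (v g x)"
  using v_invertible[of g] by (auto simp: bounded_invertible_def)

lemma v_closed: "x \<in> vecs X \<Longrightarrow> v g x \<in> vecs X"
  using v_bij by (meson bij_betwE)

definition v_inv :: "'g \<Rightarrow> 'x \<Rightarrow> 'x" where
  "v_inv g = inv_into (vecs X) (v g)"

lemma v_inv_closed: "x \<in> vecs X \<Longrightarrow> v_inv g x \<in> vecs X"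
  unfolding v_inv_def using v_bij[of g] by (metis bij_betw_def inv_into_into)

lemma v_v_inv: "x \<in> vecs X \<Longrightarrow> v g (v_inv g x) = x"
  unfolding v_inv_def using v_bij[of g] by (metis bij_betw_def f_inv_into_f)

lemma v_norm: "x \<in> vecs X \<Longrightarrow> hnorm X (v g x) = hnorm X x"
  by (simp add: hnorm_def alpha_inner[symmetric] alpha_norm)

lemma v_rho: 
  assumes "x \<in> vecs X"
  shows "v g (\<rho> a x) = \<rho> (\<alpha> g a) (v g x)"
proof -
  have "inv_into (vecs X) (v g) (v g x) = x"
    using v_bij[of g] assms by (meson bij_betw_inv_into_left)
  then show ?thesis using rho_alpha[OF v_closed[OF assms], of g a g] by simp
qed

lemma coefficient_norm_le:
  assumes "x \<in> vecs X" "y \<in> vecs X"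
  shows "norm (coefficient_map X \<rho> v x y g a) \<le> norm a * (hnorm X x * hnorm X y)"
proof -
  have "norm (coefficient_map X \<rho> v x y g a) \<le> hnorm X x * hnorm X (\<rho> a (v g y))"
    unfolding coefficient_map_def using assms by (intro cauchy_schwarz rho_closed v_closed)
  also have "\<dots> \<le> hnorm X x * (norm a * hnorm X y)"
    using rho_norm[OF v_closed[OF assms(2)], of a g] assms by (intro mult_left_mono) (simp_all add: v_norm)
  finally show ?thesis by (simp add: algebra_simps)
qed

end


section \<open>Inner product modules of functions\<close>

text \<open>
  Vectors are functions with values in the algebra, and all operations are pointwise. Hence
  the module identities are evident, and no quotient by null vectors has to be formed.
\<close>

locale inner_function_module =
  fixes H :: "('s \<Rightarrow> 'a::cstar_algebra) set" and ip :: "('s \<Rightarrow> 'a) \<Rightarrow> ('s \<Rightarrow> 'a) \<Rightarrow> 'a"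
  assumes zero_closed: "0 \<in> H"
    and add_closed: "f \<in> H \<Longrightarrow> g \<in> H \<Longrightarrow> f + g \<in> H"
    and act_closed: "f \<in> H \<Longrightarrow> (\<lambda>t. f t * a) \<in> H"
    and ip_add: "f \<in> H \<Longrightarrow> g \<in> H \<Longrightarrow> h \<in> H \<Longrightarrow> ip f (g + h) = ip f g + ip f h"
    and ip_act: "f \<in> H \<Longrightarrow> g \<in> H \<Longrightarrow> ip f (\<lambda>t. g t * a) = ip f g * a"
    and ip_star: "f \<in> H \<Longrightarrow> g \<in> H \<Longrightarrow> ip g f = star (ip f g)"
    and ip_positive: "f \<in> H \<Longrightarrow> positive_element (ip f f)"
begin

definition nrm :: "('s \<Rightarrow> 'a) \<Rightarrow> real" where
  "nrm f = sqrt (norm (ip f f))"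

lemma nrm_nonneg [simp]: "0 \<le> nrm f"
  by (simp add: nrm_def)

lemma nrm_square: "(nrm f)\<^sup>2 = norm (ip f f)"
  by (simp add: nrm_def)

lemma uminus_act: "- (f :: 's \<Rightarrow> 'a) = (\<lambda>t. f t * (- 1))"
  by (simp add: fun_Compl_def)

lemma uminus_closed: "f \<in> H \<Longrightarrow> - f \<in> H"
  unfolding uminus_act by (rule act_closed)

lemma diff_closed: "f \<in> H \<Longrightarrow> g \<in> H \<Longrightarrow> f - g \<in> H"
  using add_closed[OF _ uminus_closed, of f g] by simp

lemma scale_act: "(\<lambda>t. c *\<^sub>C f t) = (\<lambda>t. f t * (c *\<^sub>C 1 :: 'a))"
  by (simp add: mult_scaleC_right)

lemma scale_closed: "f \<in> H \<Longrightarrow> (\<lambda>t. c *\<^sub>C f t) \<in> H"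
  using act_closed[of f "c *\<^sub>C 1"] by (simp add: scale_act[of c f])

lemma ip_scale: "f \<in> H \<Longrightarrow> g \<in> H \<Longrightarrow> ip f (\<lambda>t. c *\<^sub>C g t) = c *\<^sub>C ip f g"
  using ip_act[of f g "c *\<^sub>C 1"] by (simp add: mult_scaleC_right)

lemma ip_uminus: "f \<in> H \<Longrightarrow> g \<in> H \<Longrightarrow> ip f (- g) = - ip f g"
  using ip_act[of f g "- 1"] by (simp add: fun_Compl_def)

lemma ip_diff: "f \<in> H \<Longrightarrow> g \<in> H \<Longrightarrow> h \<in> H \<Longrightarrow> ip f (g - h) = ip f g - ip f h"
  using ip_add[of f g "- h"] by (simp add: ip_uminus uminus_closed)

lemma ip_add_left:
  assumes "f \<in> H" "g \<in> H" "h \<in> H"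
  shows "ip (f + g) h = ip f h + ip g h"
  using ip_star[OF assms(3) add_closed[OF assms(1,2)]] ip_star[OF assms(3,1)] ip_star[OF assms(3,2)]
  by (simp add: ip_add assms star_add)

lemma ip_act_left:
  assumes "f \<in> H" "g \<in> H"
  shows "ip (\<lambda>t. f t * a) g = star a * ip f g"
  using ip_star[OF assms(2) act_closed[OF assms(1), of a]] ip_star[OF assms(2,1)]
  by (simp add: ip_act assms star_mult)

lemma ip_diff_left:
  assumes "f \<in> H" "g \<in> H" "h \<in> H"
  shows "ip (f - g) h = ip f h - ip g h"
  using ip_star[OF assms(3) diff_closed[OF assms(1,2)]] ip_star[OF assms(3,1)] ip_star[OF assms(3,2)]
  by (simp add: ip_diff assms star_diff)

lemma cauchy_schwarz:
  assumes "f \<in> H" "g \<in> H"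
  shows "norm (ip f g) \<le> nrm f * nrm g"
proof -
  have "(norm (ip f g))\<^sup>2 \<le> norm (ip f f) * norm (ip g g)"
  proof (rule cauchy_schwarz_from_positivity)
    fix a
    let ?f = "\<lambda>t. f t * a"
    have m: "?f \<in> H" by (rule act_closed[OF assms(1)])
    have "positive_element (ip (?f + g) (?f + g))"
      by (intro ip_positive add_closed m assms)
    also have "ip (?f + g) (?f + g)
        = star a * ip f f * a + star a * ip f g + star (ip f g) * a + ip g g"
      using assms ip_star[OF assms]
      by (simp add: ip_add_left ip_add add_closed m ip_act ip_act_left mult.assoc
          distrib_left distrib_right add.assoc)
    finally show "positive_element \<dots>" .
  qed (rule ip_positive[OF assms(1)])
  also have "\<dots> = (nrm f * nrm g)\<^sup>2" by (simp add: power_mult_distrib nrm_square)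
  finally show ?thesis by (rule power2_le_imp_le) simp
qed

lemma nrm_triangle:
  assumes "f \<in> H" "g \<in> H"
  shows "nrm (f + g) \<le> nrm f + nrm g"
proof -
  have "ip (f + g) (f + g) = ip f f + ip f g + (ip g f + ip g g)"
    using assms by (simp add: ip_add ip_add_left add_closed algebra_simps)
  then have "norm (ip (f + g) (f + g))
      \<le> norm (ip f f) + norm (ip f g) + (norm (ip g f) + norm (ip g g))"
    using norm_triangle_ineq[of "ip f f + ip f g" "ip g f + ip g g"]
      norm_triangle_ineq[of "ip f f" "ip f g"] norm_triangle_ineq[of "ip g f" "ip g g"] by simp
  also have "\<dots> \<le> (nrm f)\<^sup>2 + nrm f * nrm g + (nrm g * nrm f + (nrm g)\<^sup>2)"
    unfolding nrm_square
    using cauchy_schwarz[OF assms] cauchy_schwarz[OF assms(2,1)] by linarith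
  also have "\<dots> = (nrm f + nrm g)\<^sup>2" by (simp add: power2_eq_square algebra_simps)
  finally have "(nrm (f + g))\<^sup>2 \<le> (nrm f + nrm g)\<^sup>2" by (simp add: nrm_square)
  then show ?thesis by (rule power2_le_imp_le) simp
qed

lemma nrm_uminus: "f \<in> H \<Longrightarrow> nrm (- f) = nrm f"
  using ip_act[of "- f" f "- 1"] ip_act_left[of f f "- 1"] uminus_closed[of f]
  by (simp add: nrm_def fun_Compl_def)

lemma nrm_minus_commute:
  assumes "f \<in> H" "g \<in> H"
  shows "nrm (f - g) = nrm (g - f)"
  using nrm_uminus[OF diff_closed[OF assms]] by simp

lemma nrm_triangle_diff:
  assumes "f \<in> H" "g \<in> H" "h \<in> H"
  shows "nrm (f - h) \<le> nrm (f - g) + nrm (g - h)"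
  using nrm_triangle[OF diff_closed[OF assms(1,2)] diff_closed[OF assms(2,3)]] by simp

lemma nrm_diff_ineq:
  assumes "f \<in> H" "g \<in> H"
  shows "\<bar>nrm f - nrm g\<bar> \<le> nrm (f - g)"
  using nrm_triangle[OF diff_closed[OF assms] assms(2)]
    nrm_triangle[OF diff_closed[OF assms(2,1)] assms(1)] nrm_minus_commute[OF assms] by simp

lemma nrm_act_le:
  assumes "f \<in> H"
  shows "nrm (\<lambda>t. f t * a) \<le> norm a * nrm f"
proof -
  have "ip (\<lambda>t. f t * a) (\<lambda>t. f t * a) = star a * ip f f * a"
    using assms by (simp add: ip_act ip_act_left act_closed)
  then have "norm (ip (\<lambda>t. f t * a) (\<lambda>t. f t * a)) \<le> norm (star a) * norm (ip f f) * norm a"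
    using norm_mult_ineq[of "star a * ip f f" a]
      mult_right_mono[OF norm_mult_ineq[of "star a" "ip f f"], of "norm a"] by simp
  then have "(nrm (\<lambda>t. f t * a))\<^sup>2 \<le> (norm a * nrm f)\<^sup>2"
    by (simp add: nrm_square power_mult_distrib) (simp add: power2_eq_square algebra_simps)
  then show ?thesis by (rule power2_le_imp_le) simp
qed

end


section \<open>The Hilbert module of a positive kernel\<close>

text \<open>
  A positive kernel \<open>K\<close> is a Gram matrix \<open>K s t = \<langle>k\<^sub>s, k\<^sub>t\<rangle>\<close> that is given without its vectors. A list
  of pairs \<open>(s, a)\<close> stands for the formal combination of the \<open>k\<^sub>s\<close> with coefficients \<open>a\<close>, and
  \<open>k\<^sub>s\<close> is realised as the function \<open>t \<mapsto> K t s\<close>, which determines its inner products with all \<open>k\<^sub>t\<close>.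
\<close>

locale positive_kernel =
  fixes K :: "'s \<Rightarrow> 's \<Rightarrow> 'a::cstar_algebra"
  assumes K_star: "K t s = star (K s t)"
    and K_positive: "positive_element (\<Sum>(s, a)\<leftarrow>L. \<Sum>(t, b)\<leftarrow>L. star a * K s t * b)"
begin

definition comb :: "('s \<times> 'a) list \<Rightarrow> 's \<Rightarrow> 'a" where
  "comb L = (\<lambda>t. \<Sum>(s, a)\<leftarrow>L. K t s * a)"

definition pair :: "('s \<times> 'a) list \<Rightarrow> ('s \<Rightarrow> 'a) \<Rightarrow> 'a" where
  "pair L g = (\<Sum>(s, a)\<leftarrow>L. star a * g s)"

lemma comb_simps [simp]:
  "comb [] = 0" "comb ((s, a) # L) = (\<lambda>t. K t s * a) + comb L" "comb (L @ M) = comb L + comb M"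
  by (simp_all add: comb_def fun_eq_iff)

lemma pair_simps [simp]:
  "pair [] g = 0" "pair ((s, a) # L) g = star a * g s + pair L g"
  by (simp_all add: pair_def)

lemma pair_add: "pair L (g + h) = pair L g + pair L h"
  by (induction L) (auto simp: algebra_simps)

lemma pair_zero: "pair L 0 = 0"
  by (induction L) auto

lemma pair_act: "pair L (\<lambda>t. g t * a) = pair L g * a"
  by (induction L) (auto simp: algebra_simps)

lemma comb_act: "(\<lambda>t. comb L t * b) = comb (map (\<lambda>(s, a). (s, a * b)) L)"
  by (induction L) (auto simp: fun_eq_iff algebra_simps)

lemma pair_comb_star: "pair L (comb M) = star (pair M (comb L))"
proof (induction L)
  case (Cons x L)
  obtain s a where x: "x = (s, a)" by (cases x)
  have "pair M (\<lambda>t. K t s * a) = star (star a * comb M s)"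
    by (induction M) (auto simp: star_add star_mult star_star K_star[of _ s] algebra_simps pair_act
        pair_zero)
  then show ?case
    using pair_add[of M "\<lambda>t. K t s * a" "comb L"] by (simp add: x star_add star_star Cons plus_fun_def)
qed (use pair_zero in \<open>simp add: zero_fun_def\<close>)

definition H0 :: "('s \<Rightarrow> 'a) set" where
  "H0 = range comb"

definition ip0 :: "('s \<Rightarrow> 'a) \<Rightarrow> ('s \<Rightarrow> 'a) \<Rightarrow> 'a" where
  "ip0 f g = pair (SOME L. comb L = f) g"

lemma comb_in_H0 [simp]: "comb L \<in> H0"
  by (simp add: H0_def)

lemma ip0_comb:
  assumes "g \<in> H0"
  shows "ip0 (comb L) g = pair L g"
proof -
  obtain M where g: "g = comb M" using assms by (auto simp: H0_def)
  define L' where "L' = (SOME L'. comb L' = comb L)"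
  have L': "comb L' = comb L" unfolding L'_def by (rule someI[of _ L]) simp
  have "pair L' (comb M) = star (pair M (comb L'))" by (rule pair_comb_star)
  also have "\<dots> = pair L (comb M)" unfolding L' by (rule pair_comb_star[symmetric])
  finally show ?thesis by (simp add: ip0_def L'_def g)
qed

sublocale pre: inner_function_module H0 ip0
proof
  show "0 \<in> H0" using comb_in_H0[of "[]"] by simp
  show add: "f + g \<in> H0" if "f \<in> H0" "g \<in> H0" for f g
    using that comb_simps(3) by (metis H0_def rangeE rangeI)
  show act: "(\<lambda>t. f t * a) \<in> H0" if "f \<in> H0" for f a
    using that by (auto simp: H0_def comb_act)
  fix f g h :: "'s \<Rightarrow> 'a" and a assume f: "f \<in> H0" and g: "g \<in> H0"
  obtain L where L: "f = comb L" using f by (auto simp: H0_def)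
  obtain M where M: "g = comb M" using g by (auto simp: H0_def)
  show "ip0 f (g + h) = ip0 f g + ip0 f h" if "h \<in> H0"
    using f g that by (simp add: L ip0_comb add pair_add)
  show "ip0 f (\<lambda>t. g t * a) = ip0 f g * a"
    using f g by (simp add: L ip0_comb act pair_act)
  show "ip0 g f = star (ip0 f g)"
    using pair_comb_star[of M L] by (simp add: L M ip0_comb)
  have "pair L (comb L) = (\<Sum>(s, a)\<leftarrow>L. \<Sum>(t, b)\<leftarrow>L. star a * K s t * b)"
    unfolding pair_def comb_def by (simp add: split_def mult.assoc sum_list_const_mult)
  then show "positive_element (ip0 f f)"
    using K_positive by (simp add: L ip0_comb)
qed

text \<open>
  The function that represents the vector \<open>k\<^sub>s\<close>. It reproduces values: pairing with it is evaluation
  at \<open>s\<close>, so that convergence in norm implies pointwise convergence.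
\<close>

abbreviation generator :: "'s \<Rightarrow> 's \<Rightarrow> 'a" where
  "generator s \<equiv> (\<lambda>t. K t s)"

lemma generator_eq_comb: "generator s = comb [(s, 1)]"
  by (simp add: fun_eq_iff)

lemma generator_in_H0: "generator s \<in> H0"
  unfolding generator_eq_comb by (rule comb_in_H0)

lemma ip0_generator: "f \<in> H0 \<Longrightarrow> ip0 (generator s) f = f s"
  unfolding generator_eq_comb by (simp add: ip0_comb del: comb_simps)

lemma evaluation_bound: "f \<in> H0 \<Longrightarrow> norm (f s) \<le> pre.nrm (generator s) * pre.nrm f"
  using pre.cauchy_schwarz[OF generator_in_H0, of f s] by (simp add: ip0_generator)

text \<open>
  The completion consists of the pointwise limits of Cauchy sequences of combinations. Its inner
  product is the limit of the inner products of approximating sequences.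
\<close>

definition cauchy :: "(nat \<Rightarrow> 's \<Rightarrow> 'a) \<Rightarrow> bool" where
  "cauchy F \<longleftrightarrow> (\<forall>n. F n \<in> H0) \<and> (\<forall>e>0. \<exists>N. \<forall>m\<ge>N. \<forall>n\<ge>N. pre.nrm (F m - F n) < e)"

definition approximates :: "(nat \<Rightarrow> 's \<Rightarrow> 'a) \<Rightarrow> ('s \<Rightarrow> 'a) \<Rightarrow> bool" where
  "approximates F f \<longleftrightarrow> cauchy F \<and> (\<forall>t. (\<lambda>n. F n t) \<longlonglongrightarrow> f t)"

lemma cauchyD: "cauchy F \<Longrightarrow> F n \<in> H0"
  by (simp add: cauchy_def)

lemma approximatesD: "approximates F f \<Longrightarrow> F n \<in> H0" "approximates F f \<Longrightarrow> (\<lambda>n. F n t) \<longlonglongrightarrow> f t"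
  by (simp_all add: approximates_def cauchy_def)

lemma approximates_const: "f \<in> H0 \<Longrightarrow> approximates (\<lambda>n. f) f"
  using pre.nrm_act_le[OF pre.zero_closed, of 0]
  by (auto simp: approximates_def cauchy_def pre.nrm_def zero_fun_def)

lemma cauchy_map:
  assumes F: "cauchy F" and closed: "\<And>f. f \<in> H0 \<Longrightarrow> \<Phi> f \<in> H0"
    and diff: "\<And>f g. f \<in> H0 \<Longrightarrow> g \<in> H0 \<Longrightarrow> \<Phi> (f - g) = \<Phi> f - \<Phi> g"
    and bound: "\<And>f. f \<in> H0 \<Longrightarrow> pre.nrm (\<Phi> f) \<le> C * pre.nrm f" and C: "0 \<le> C"
  shows "cauchy (\<lambda>n. \<Phi> (F n))"
  unfolding cauchy_def
proof (intro conjI allI impI)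
  fix e :: real assume e: "0 < e"
  have C1: "0 < C + 1" using C by simp
  obtain N where N: "\<forall>m\<ge>N. \<forall>n\<ge>N. pre.nrm (F m - F n) < e / (C + 1)"
    using F e C1 unfolding cauchy_def by (meson divide_pos_pos)
  have "pre.nrm (\<Phi> (F m) - \<Phi> (F n)) < e" if "N \<le> m" "N \<le> n" for m n
  proof -
    have d: "F m - F n \<in> H0" using F by (simp add: cauchyD pre.diff_closed)
    have "pre.nrm (\<Phi> (F m) - \<Phi> (F n)) = pre.nrm (\<Phi> (F m - F n))"
      using F by (simp add: diff cauchyD)
    also have "\<dots> \<le> C * pre.nrm (F m - F n)" by (rule bound[OF d])
    also have "\<dots> \<le> (C + 1) * pre.nrm (F m - F n)" by (simp add: algebra_simps)
    also have "\<dots> < (C + 1) * (e / (C + 1))" using N that C1 by (intro mult_strict_left_mono) auto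
    finally show ?thesis using C1 by simp
  qed
  then show "\<exists>N. \<forall>m\<ge>N. \<forall>n\<ge>N. pre.nrm (\<Phi> (F m) - \<Phi> (F n)) < e" by blast
qed (use F closed cauchyD in blast)

lemma cauchy_add:
  assumes "cauchy F" "cauchy G"
  shows "cauchy (\<lambda>n. F n + G n)"
  unfolding cauchy_def
proof (intro conjI allI impI)
  fix e :: real assume e: "0 < e"
  obtain M where M: "\<forall>m\<ge>M. \<forall>n\<ge>M. pre.nrm (F m - F n) < e / 2"
    using assms(1) e unfolding cauchy_def by (meson half_gt_zero)
  obtain N where N: "\<forall>m\<ge>N. \<forall>n\<ge>N. pre.nrm (G m - G n) < e / 2"
    using assms(2) e unfolding cauchy_def by (meson half_gt_zero)
  have "pre.nrm (F m + G m - (F n + G n)) < e" if "max M N \<le> m" "max M N \<le> n" for m n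
  proof -
    have "pre.nrm ((F m - F n) + (G m - G n)) \<le> pre.nrm (F m - F n) + pre.nrm (G m - G n)"
      using assms by (intro pre.nrm_triangle pre.diff_closed cauchyD)
    also have "\<dots> < e / 2 + e / 2" using M N that by (intro add_strict_mono) auto
    finally show ?thesis by (simp add: algebra_simps)
  qed
  then show "\<exists>N. \<forall>m\<ge>N. \<forall>n\<ge>N. pre.nrm (F m + G m - (F n + G n)) < e" by blast
qed (use assms in \<open>simp add: pre.add_closed cauchyD\<close>)

lemma cauchy_act: "cauchy F \<Longrightarrow> cauchy (\<lambda>n t. F n t * a)"
  by (rule cauchy_map[where C = "norm a" and \<Phi> = "\<lambda>f t. f t * a"])
    (auto simp: pre.act_closed pre.nrm_act_le fun_eq_iff left_diff_distrib)

lemma cauchy_diff: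
  assumes "cauchy F" "cauchy G"
  shows "cauchy (\<lambda>n. F n - G n)"
proof -
  have "cauchy (\<lambda>n. F n + (\<lambda>t. G n t * (- 1)))"
    by (intro cauchy_add cauchy_act assms)
  then show ?thesis by (simp add: plus_fun_def fun_diff_def)
qed

lemma approximates_map:
  assumes "approximates F f" "\<And>f. f \<in> H0 \<Longrightarrow> \<Phi> f \<in> H0"
    "\<And>f g. f \<in> H0 \<Longrightarrow> g \<in> H0 \<Longrightarrow> \<Phi> (f - g) = \<Phi> f - \<Phi> g"
    "\<And>f. f \<in> H0 \<Longrightarrow> pre.nrm (\<Phi> f) \<le> C * pre.nrm f" "0 \<le> C"
    "\<And>t. (\<lambda>n. \<Phi> (F n) t) \<longlonglongrightarrow> \<Phi> f t"
  shows "approximates (\<lambda>n. \<Phi> (F n)) (\<Phi> f)"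
  using assms cauchy_map[of F \<Phi> C] by (simp add: approximates_def)

lemma approximates_add: "approximates F f \<Longrightarrow> approximates G g \<Longrightarrow> approximates (\<lambda>n. F n + G n) (f + g)"
  by (auto simp: approximates_def intro: cauchy_add tendsto_add)

lemma approximates_diff: "approximates F f \<Longrightarrow> approximates G g \<Longrightarrow> approximates (\<lambda>n. F n - G n) (f - g)"
  by (auto simp: approximates_def intro: cauchy_diff tendsto_diff)

lemma approximates_act: "approximates F f \<Longrightarrow> approximates (\<lambda>n t. F n t * a) (\<lambda>t. f t * a)"
  by (auto simp: approximates_def intro!: cauchy_act tendsto_intros)

lemma cauchy_nrm: "cauchy F \<Longrightarrow> Cauchy (\<lambda>n. pre.nrm (F n))"
  unfolding Cauchy_altdef2 dist_real_def
  using pre.nrm_diff_ineq cauchyD unfolding cauchy_def by (meson order.refl order.strict_trans1)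

lemma cauchy_bounded:
  assumes "cauchy F"
  obtains B where "0 < B" "\<And>n. pre.nrm (F n) \<le> B"
proof -
  have "Bseq (\<lambda>n. pre.nrm (F n))" by (rule Cauchy_Bseq[OF cauchy_nrm[OF assms]])
  then obtain B where "0 < B" "\<forall>n. norm (pre.nrm (F n)) \<le> B" by (rule BseqE)
  then show thesis using that by simp
qed

lemma pair_tendsto: "(\<And>t. (\<lambda>n. F n t) \<longlonglongrightarrow> f t) \<Longrightarrow> (\<lambda>n. pair L (F n)) \<longlonglongrightarrow> pair L f"
  by (induction L) (auto intro!: tendsto_intros)

text \<open>
  A sequence that is Cauchy in norm and tends to \<open>0\<close> pointwise tends to \<open>0\<close> in norm. This is what
  makes the completion a space of functions.
\<close>

lemma null_in_norm:
  assumes D: "cauchy D" and null: "\<And>t. (\<lambda>n. D n t) \<longlonglongrightarrow> 0"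
  shows "(\<lambda>n. pre.nrm (D n)) \<longlonglongrightarrow> 0"
proof -
  obtain B where B: "0 < B" "\<And>n. pre.nrm (D n) \<le> B" using cauchy_bounded[OF D] by blast
  have "(\<lambda>n. ip0 (D n) (D n)) \<longlonglongrightarrow> 0"
  proof (rule LIMSEQ_I)
    fix e :: real assume e: "0 < e"
    obtain N where N: "\<forall>m\<ge>N. \<forall>n\<ge>N. pre.nrm (D m - D n) < e / (2 * B)"
      using D e B unfolding cauchy_def by (metis divide_pos_pos mult_pos_pos zero_less_numeral)
    obtain L where L: "D N = comb L" using cauchyD[OF D, of N] by (auto simp: H0_def)
    \<comment> \<open>The inner product with the fixed vector \<open>D N\<close> only involves the values of \<open>D n\<close> at
      finitely many points.\<close>
    have "(\<lambda>n. pair L (D n)) \<longlonglongrightarrow> pair L 0" using null by (intro pair_tendsto) simp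
    then have "(\<lambda>n. ip0 (D N) (D n)) \<longlonglongrightarrow> 0" by (simp add: L ip0_comb cauchyD[OF D] pair_zero)
    then obtain M where M: "\<forall>n\<ge>M. norm (ip0 (D N) (D n) - 0) < e / 2"
      using LIMSEQ_D e by (metis half_gt_zero)
    have "norm (ip0 (D n) (D n) - 0) < e" if n: "max M N \<le> n" for n
    proof -
      have "ip0 (D n) (D n) = ip0 (D n - D N) (D n) + ip0 (D N) (D n)"
        by (simp add: pre.ip_diff_left cauchyD[OF D])
      then have "norm (ip0 (D n) (D n)) \<le> norm (ip0 (D n - D N) (D n)) + norm (ip0 (D N) (D n))"
        by (metis norm_triangle_ineq)
      also have "norm (ip0 (D n - D N) (D n)) \<le> pre.nrm (D n - D N) * pre.nrm (D n)"
        by (intro pre.cauchy_schwarz pre.diff_closed cauchyD[OF D])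
      also have "\<dots> \<le> e / (2 * B) * B"
        using N n B e by (intro mult_mono) (auto intro: less_imp_le)
      finally have "norm (ip0 (D n) (D n)) \<le> e / 2 + norm (ip0 (D N) (D n))" using B by simp
      moreover have "norm (ip0 (D N) (D n)) < e / 2" using M n by simp
      ultimately show ?thesis by simp
    qed
    then show "\<exists>no. \<forall>n\<ge>no. norm (ip0 (D n) (D n) - 0) < e" by blast
  qed
  then have "(\<lambda>n. sqrt (norm (ip0 (D n) (D n)))) \<longlonglongrightarrow> sqrt (norm (0::'a))"
    by (intro tendsto_intros)
  then show ?thesis by (simp add: pre.nrm_def)
qed

lemma approximates_unique:
  assumes "approximates F f" "approximates F' f"
  shows "(\<lambda>n. pre.nrm (F n - F' n)) \<longlonglongrightarrow> 0"
proof (rule null_in_norm)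
  have d: "approximates (\<lambda>n. F n - F' n) (f - f)" by (rule approximates_diff[OF assms])
  then show "cauchy (\<lambda>n. F n - F' n)" by (simp add: approximates_def)
  show "(\<lambda>n. (F n - F' n) t) \<longlonglongrightarrow> 0" for t using approximatesD(2)[OF d, of t] by simp
qed

lemma ip0_difference_bound:
  assumes "f \<in> H0" "f' \<in> H0" "g \<in> H0" "g' \<in> H0"
  shows "norm (ip0 f g - ip0 f' g') \<le> pre.nrm (f - f') * pre.nrm g + pre.nrm f' * pre.nrm (g - g')"
proof -
  have "ip0 f g - ip0 f' g' = ip0 (f - f') g + ip0 f' (g - g')"
    using assms by (simp add: pre.ip_diff pre.ip_diff_left)
  also have "norm \<dots> \<le> norm (ip0 (f - f') g) + norm (ip0 f' (g - g'))" by (rule norm_triangle_ineq)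
  also have "\<dots> \<le> pre.nrm (f - f') * pre.nrm g + pre.nrm f' * pre.nrm (g - g')"
    using assms by (intro add_mono pre.cauchy_schwarz pre.diff_closed)
  finally show ?thesis .
qed

lemma ip0_convergent:
  assumes F: "cauchy F" and G: "cauchy G"
  shows "convergent (\<lambda>n. ip0 (F n) (G n))"
proof -
  obtain A where A: "0 < A" "\<And>n. pre.nrm (F n) \<le> A" using cauchy_bounded[OF F] by blast
  obtain B where B: "0 < B" "\<And>n. pre.nrm (G n) \<le> B" using cauchy_bounded[OF G] by blast
  have "Cauchy (\<lambda>n. ip0 (F n) (G n))"
  proof (rule CauchyI)
    fix e :: real assume e: "0 < e"
    obtain M where M: "\<forall>m\<ge>M. \<forall>n\<ge>M. pre.nrm (F m - F n) < e / (2 * B)"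
      using F e B unfolding cauchy_def by (metis divide_pos_pos mult_pos_pos zero_less_numeral)
    obtain N where N: "\<forall>m\<ge>N. \<forall>n\<ge>N. pre.nrm (G m - G n) < e / (2 * A)"
      using G e A unfolding cauchy_def by (metis divide_pos_pos mult_pos_pos zero_less_numeral)
    have "norm (ip0 (F m) (G m) - ip0 (F n) (G n)) < e" if mn: "max M N \<le> m" "max M N \<le> n" for m n
    proof -
      have "norm (ip0 (F m) (G m) - ip0 (F n) (G n))
          \<le> pre.nrm (F m - F n) * pre.nrm (G m) + pre.nrm (F n) * pre.nrm (G m - G n)"
        by (intro ip0_difference_bound cauchyD F G)
      also have "\<dots> \<le> pre.nrm (F m - F n) * B + A * pre.nrm (G m - G n)"
        by (intro add_mono mult_left_mono mult_right_mono A B) auto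
      also have "\<dots> < e / (2 * B) * B + A * (e / (2 * A))"
        using M N mn A B by (intro add_strict_mono mult_strict_left_mono mult_strict_right_mono) auto
      also have "\<dots> = e" using A B by simp
      finally show ?thesis .
    qed
    then show "\<exists>M. \<forall>m\<ge>M. \<forall>n\<ge>M. norm (ip0 (F m) (G m) - ip0 (F n) (G n)) < e" by blast
  qed
  then show ?thesis by (rule Cauchy_convergent)
qed

definition HC :: "('s \<Rightarrow> 'a) set" where
  "HC = {f. \<exists>F. approximates F f}"

definition ipc :: "('s \<Rightarrow> 'a) \<Rightarrow> ('s \<Rightarrow> 'a) \<Rightarrow> 'a" where
  "ipc f g = lim (\<lambda>n. ip0 ((SOME F. approximates F f) n) ((SOME G. approximates G g) n))"

lemma HC_I: "approximates F f \<Longrightarrow> f \<in> HC"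
  by (auto simp: HC_def)

lemma H0_subset_HC: "f \<in> H0 \<Longrightarrow> f \<in> HC"
  by (rule HC_I[OF approximates_const])

lemma ipc_limit:
  assumes F: "approximates F f" and G: "approximates G g"
  shows "(\<lambda>n. ip0 (F n) (G n)) \<longlonglongrightarrow> ipc f g"
proof -
  define F' where "F' = (SOME F. approximates F f)"
  define G' where "G' = (SOME G. approximates G g)"
  have F': "approximates F' f" unfolding F'_def by (rule someI[of _ F]) (rule F)
  have G': "approximates G' g" unfolding G'_def by (rule someI[of _ G]) (rule G)
  have cF: "cauchy F" "cauchy F'" "cauchy G" "cauchy G'"
    using F F' G G' by (auto simp: approximates_def)
  have lim: "(\<lambda>n. ip0 (F' n) (G' n)) \<longlonglongrightarrow> ipc f g"
    using ip0_convergent[OF cF(2,4)] by (simp add: ipc_def F'_def G'_def convergent_LIMSEQ_iff)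
  obtain A where A: "\<And>n. pre.nrm (F' n) \<le> A" using cauchy_bounded[OF cF(2)] by blast
  obtain B where B: "\<And>n. pre.nrm (G n) \<le> B" using cauchy_bounded[OF cF(3)] by blast
  have "(\<lambda>n. pre.nrm (F n - F' n) * B + A * pre.nrm (G n - G' n)) \<longlonglongrightarrow> 0 * B + A * 0"
    by (intro tendsto_intros approximates_unique[OF F F'] approximates_unique[OF G G'])
  then have null: "(\<lambda>n. pre.nrm (F n - F' n) * B + A * pre.nrm (G n - G' n)) \<longlonglongrightarrow> 0" by simp
  have bd: "norm (ip0 (F n) (G n) - ip0 (F' n) (G' n))
      \<le> pre.nrm (F n - F' n) * B + A * pre.nrm (G n - G' n)" for n
  proof -
    have "norm (ip0 (F n) (G n) - ip0 (F' n) (G' n))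
        \<le> pre.nrm (F n - F' n) * pre.nrm (G n) + pre.nrm (F' n) * pre.nrm (G n - G' n)"
      by (intro ip0_difference_bound cauchyD cF)
    also have "\<dots> \<le> pre.nrm (F n - F' n) * B + A * pre.nrm (G n - G' n)"
      by (intro add_mono mult_left_mono mult_right_mono A B) auto
    finally show ?thesis .
  qed
  have "(\<lambda>n. ip0 (F n) (G n) - ip0 (F' n) (G' n)) \<longlonglongrightarrow> 0"
    by (rule Lim_null_comparison[OF _ null]) (intro always_eventually allI bd)
  from tendsto_add[OF this lim] show ?thesis by simp
qed

lemma ipc_eq_ip0: "f \<in> H0 \<Longrightarrow> g \<in> H0 \<Longrightarrow> ipc f g = ip0 f g"
  using ipc_limit[OF approximates_const approximates_const, of f g] by (simp add: LIMSEQ_const_iff)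

lemma ipc_generator:
  assumes "f \<in> HC"
  shows "ipc (generator s) f = f s"
proof -
  obtain F where F: "approximates F f" using assms by (auto simp: HC_def)
  have "(\<lambda>n. ip0 (generator s) (F n)) \<longlonglongrightarrow> ipc (generator s) f"
    by (rule ipc_limit[OF approximates_const[OF generator_in_H0] F])
  then have "(\<lambda>n. F n s) \<longlonglongrightarrow> ipc (generator s) f"
    by (simp add: ip0_generator approximatesD[OF F])
  then show ?thesis using approximatesD(2)[OF F] LIMSEQ_unique by blast
qed

sublocale compl: inner_function_module HC ipc
proof
  show "0 \<in> HC" by (rule H0_subset_HC[OF pre.zero_closed])
  show "f + g \<in> HC" if "f \<in> HC" "g \<in> HC" for f g
    using that approximates_add unfolding HC_def by blast
  show "(\<lambda>t. f t * a) \<in> HC" if "f \<in> HC" for f a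
    using that approximates_act unfolding HC_def by blast
  fix f g h :: "'s \<Rightarrow> 'a" and a assume "f \<in> HC" "g \<in> HC"
  then obtain F G where F: "approximates F f" and G: "approximates G g" by (auto simp: HC_def)
  show "ipc f (g + h) = ipc f g + ipc f h" if "h \<in> HC"
  proof -
    obtain H where H: "approximates H h" using \<open>h \<in> HC\<close> by (auto simp: HC_def)
    have "(\<lambda>n. ip0 (F n) (G n) + ip0 (F n) (H n)) \<longlonglongrightarrow> ipc f g + ipc f h"
      by (intro tendsto_intros ipc_limit F G H)
    moreover have "(\<lambda>n. ip0 (F n) (G n + H n)) \<longlonglongrightarrow> ipc f (g + h)"
      by (intro ipc_limit F approximates_add G H)
    ultimately show ?thesis
      by (simp add: pre.ip_add approximatesD(1)[OF F] approximatesD(1)[OF G] approximatesD(1)[OF H]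
          LIMSEQ_unique)
  qed
  show "ipc f (\<lambda>t. g t * a) = ipc f g * a"
  proof -
    have "(\<lambda>n. ip0 (F n) (G n) * a) \<longlonglongrightarrow> ipc f g * a"
      by (intro tendsto_intros ipc_limit F G)
    moreover have "(\<lambda>n. ip0 (F n) (\<lambda>t. G n t * a)) \<longlonglongrightarrow> ipc f (\<lambda>t. g t * a)"
      by (intro ipc_limit F approximates_act G)
    ultimately show ?thesis
      by (simp add: pre.ip_act approximatesD(1)[OF F] approximatesD(1)[OF G] LIMSEQ_unique)
  qed
  show "ipc g f = star (ipc f g)"
  proof -
    have "(\<lambda>n. star (ip0 (F n) (G n))) \<longlonglongrightarrow> star (ipc f g)"
      by (intro tendsto_intros ipc_limit F G)
    moreover have "star (ip0 (F n) (G n)) = ip0 (G n) (F n)" for n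
      by (rule pre.ip_star[symmetric]) (simp_all add: approximatesD(1)[OF F] approximatesD(1)[OF G])
    ultimately show ?thesis using ipc_limit[OF G F] LIMSEQ_unique by auto
  qed
  show "positive_element (ipc f f)"
    by (rule positive_limit[OF ipc_limit[OF F F]])
      (simp_all add: pre.ip_positive approximatesD(1)[OF F])
qed

lemma compl_nrm_eq: "f \<in> H0 \<Longrightarrow> compl.nrm f = pre.nrm f"
  by (simp add: compl.nrm_def pre.nrm_def ipc_eq_ip0)

lemma nrm_limit:
  assumes "approximates F f"
  shows "(\<lambda>n. pre.nrm (F n)) \<longlonglongrightarrow> compl.nrm f"
  unfolding pre.nrm_def compl.nrm_def by (intro tendsto_intros ipc_limit assms)

lemma approximates_in_norm:
  assumes F: "approximates F f"
  shows "(\<lambda>n. compl.nrm (F n - f)) \<longlonglongrightarrow> 0"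
proof (rule LIMSEQ_I)
  fix e :: real assume e: "0 < e"
  obtain N where N: "\<forall>m\<ge>N. \<forall>n\<ge>N. pre.nrm (F m - F n) < e / 2"
    using F e unfolding approximates_def cauchy_def by (meson half_gt_zero)
  have "norm (compl.nrm (F m - f) - 0) < e" if m: "N \<le> m" for m
  proof -
    have "approximates (\<lambda>n. F m - F n) (F m - f)"
      by (intro approximates_diff approximates_const approximatesD(1)[OF F] F)
    from nrm_limit[OF this] have "compl.nrm (F m - f) \<le> e / 2"
      by (rule LIMSEQ_le_const2) (use N m in \<open>auto intro: less_imp_le\<close>)
    then show ?thesis using e by simp
  qed
  then show "\<exists>no. \<forall>n\<ge>no. norm (compl.nrm (F n - f) - 0) < e" by blast
qed

lemma cauchy_has_limit:
  assumes F: "cauchy F"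
  obtains f where "approximates F f"
proof -
  have "convergent (\<lambda>n. F n t)" for t
  proof (intro Cauchy_convergent CauchyI)
    fix e :: real assume e: "0 < e"
    let ?C = "pre.nrm (generator t) + 1"
    have C: "0 < ?C" by (simp add: add_nonneg_pos)
    obtain N where N: "\<forall>m\<ge>N. \<forall>n\<ge>N. pre.nrm (F m - F n) < e / ?C"
      using F e C unfolding cauchy_def by (meson divide_pos_pos)
    have "norm (F m t - F n t) < e" if "N \<le> m" "N \<le> n" for m n
    proof -
      have "norm ((F m - F n) t) \<le> pre.nrm (generator t) * pre.nrm (F m - F n)"
        by (intro evaluation_bound pre.diff_closed cauchyD[OF F])
      also have "\<dots> \<le> ?C * pre.nrm (F m - F n)" by (simp add: algebra_simps)
      also have "\<dots> < ?C * (e / ?C)" using N that C by (intro mult_strict_left_mono) auto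
      finally show ?thesis using C by simp
    qed
    then show "\<exists>M. \<forall>m\<ge>M. \<forall>n\<ge>M. norm (F m t - F n t) < e" by blast
  qed
  then have "approximates F (\<lambda>t. lim (\<lambda>n. F n t))"
    using F by (simp add: approximates_def convergent_LIMSEQ_iff)
  then show thesis by (rule that)
qed

text \<open>
  A Cauchy sequence in the completion is followed within \<open>1 / (n + 1)\<close> by a sequence of combinations,
  whose pointwise limit is then the limit of both.
\<close>

lemma HC_complete:
  assumes f: "\<And>n. f n \<in> HC"
    and cauchy_f: "\<And>e. 0 < e \<Longrightarrow> \<exists>N. \<forall>m\<ge>N. \<forall>n\<ge>N. compl.nrm (f m - f n) < e"
  obtains l where "l \<in> HC" "(\<lambda>n. compl.nrm (f n - l)) \<longlonglongrightarrow> 0"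
proof -
  have "\<exists>g\<in>H0. compl.nrm (f n - g) < inverse (real (Suc n))" for n
  proof -
    obtain F where F: "approximates F (f n)" using f by (auto simp: HC_def)
    have "eventually (\<lambda>k. compl.nrm (F k - f n) < inverse (real (Suc n))) sequentially"
      by (rule order_tendstoD(2)[OF approximates_in_norm[OF F]]) simp
    then obtain k where "compl.nrm (F k - f n) < inverse (real (Suc n))"
      by (auto simp: eventually_sequentially)
    then show ?thesis
      using compl.nrm_minus_commute[OF H0_subset_HC[OF approximatesD(1)[OF F]] f]
        approximatesD(1)[OF F] by metis
  qed
  then obtain G where G: "\<And>n. G n \<in> H0" "\<And>n. compl.nrm (f n - G n) < inverse (real (Suc n))"
    by metis
  note GC = H0_subset_HC[OF G(1)]
  have inv0: "(\<lambda>n. inverse (real (Suc n))) \<longlonglongrightarrow> 0" by (rule LIMSEQ_inverse_real_of_nat)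
  have "cauchy G"
    unfolding cauchy_def
  proof (intro conjI allI impI)
    fix e :: real assume e: "0 < e"
    obtain M where M: "\<forall>m\<ge>M. \<forall>n\<ge>M. compl.nrm (f m - f n) < e / 3"
      using cauchy_f[of "e / 3"] e by auto
    have "eventually (\<lambda>n. inverse (real (Suc n)) < e / 3) sequentially"
      by (rule order_tendstoD(2)[OF inv0]) (use e in simp)
    then obtain N where N: "\<And>n. N \<le> n \<Longrightarrow> inverse (real (Suc n)) < e / 3"
      by (auto simp: eventually_sequentially)
    have "pre.nrm (G m - G n) < e" if mn: "max M N \<le> m" "max M N \<le> n" for m n
    proof -
      have "pre.nrm (G m - G n) = compl.nrm (G m - G n)"
        by (simp add: compl_nrm_eq pre.diff_closed G(1))
      also have "\<dots> \<le> compl.nrm (G m - f m) + compl.nrm (f m - G n)"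
        by (intro compl.nrm_triangle_diff GC f)
      also have "\<dots> \<le> compl.nrm (f m - G m) + (compl.nrm (f m - f n) + compl.nrm (f n - G n))"
        using compl.nrm_triangle_diff[OF f f GC, of m n n] compl.nrm_minus_commute[OF f GC, of m m]
        by simp
      also have "\<dots> < e / 3 + (e / 3 + e / 3)"
        using M mn order_less_trans[OF G(2) N] by (intro add_strict_mono) auto
      finally show ?thesis by simp
    qed
    then show "\<exists>N. \<forall>m\<ge>N. \<forall>n\<ge>N. pre.nrm (G m - G n) < e" by blast
  qed (rule G(1))
  then obtain l where l: "approximates G l" using cauchy_has_limit by blast
  have lC: "l \<in> HC" by (rule HC_I[OF l])
  have "(\<lambda>n. inverse (real (Suc n)) + compl.nrm (G n - l)) \<longlonglongrightarrow> 0 + 0"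
    by (intro tendsto_add inv0 approximates_in_norm l)
  then have lim: "(\<lambda>n. inverse (real (Suc n)) + compl.nrm (G n - l)) \<longlonglongrightarrow> 0" by simp
  have "compl.nrm (f n - l) \<le> inverse (real (Suc n)) + compl.nrm (G n - l)" for n
    using compl.nrm_triangle_diff[OF f GC lC, of n n] G(2)[of n] by simp
  then have "(\<lambda>n. compl.nrm (f n - l)) \<longlonglongrightarrow> 0"
    by (intro Lim_null_comparison[OF _ lim] always_eventually allI) simp
  with lC show thesis by (rule that)
qed

definition kernel_module :: "('s \<Rightarrow> 'a, 'a) hmodule" where
  "kernel_module = \<lparr>vecs = HC, hadd = (+), hzero = 0, hscale = (\<lambda>c f t. c *\<^sub>C f t),
    hact = (\<lambda>f a t. f t * a), hinner = ipc\<rparr>"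

lemma kernel_module_simps [simp]:
  "vecs kernel_module = HC" "hadd kernel_module = (+)" "hzero kernel_module = 0"
  "hscale kernel_module = (\<lambda>c f t. c *\<^sub>C f t)" "hact kernel_module = (\<lambda>f a t. f t * a)"
  "hinner kernel_module = ipc" "hnorm kernel_module = compl.nrm"
  by (simp_all add: kernel_module_def hnorm_def compl.nrm_def fun_eq_iff)

lemma hilbert_kernel_module: "hilbert_module kernel_module"
proof (rule hilbert_module.intro)
  show "cvector_space_on (vecs kernel_module) (hadd kernel_module) (hzero kernel_module)
    (hscale kernel_module)"
  proof
    fix f assume "f \<in> vecs kernel_module"
    then show "\<exists>g\<in>vecs kernel_module. hadd kernel_module f g = hzero kernel_module"
      by (intro bexI[of _ "- f"]) (auto simp: compl.uminus_closed)
  qed (auto simp: compl.zero_closed compl.add_closed compl.scale_closed fun_eq_iff algebra_simps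
      scaleC_add_left scaleC_add_right scaleC_scaleC)
  have complete: "complete_on (vecs kernel_module) (hadd kernel_module) (hscale kernel_module)
      (hnorm kernel_module)"
  proof -
    have diff: "f + (\<lambda>t. (- 1) *\<^sub>C g t) = f - g" for f g :: "'s \<Rightarrow> 'a"
      by (simp add: fun_eq_iff)
    show ?thesis
      unfolding complete_on_def kernel_module_simps diff using HC_complete by metis
  qed
  show "hilbert_module_axioms kernel_module"
  proof
    fix f assume f: "f \<in> vecs kernel_module" "hinner kernel_module f f = 0"
    then have "compl.nrm f = 0" by (simp add: compl.nrm_def)
    then have "norm (f s) \<le> 0" for s
      using compl.cauchy_schwarz[OF H0_subset_HC[OF generator_in_H0], of f s] f
      by (simp add: ipc_generator)
    then show "f = hzero kernel_module" by (simp add: fun_eq_iff)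
  qed (use complete in \<open>auto simp: compl.act_closed compl.ip_add compl.ip_scale compl.ip_act
      compl.ip_positive fun_eq_iff algebra_simps mult_scaleC_left mult_scaleC_right
      intro: compl.ip_star\<close>)
qed

end


section \<open>The equivariant representation of an equivariant kernel\<close>

text \<open>
  The maps \<open>\<rho>\<close>, \<open>v\<close> and \<open>w\<close> act on the indices of the generators; \<open>w g\<close> is to be the inverse of
  \<open>v g\<close>. All identities are required only after pairing with \<open>K\<close>, since distinct indices may
  name the same vector.
\<close>

locale equivariant_kernel = twisted_system \<alpha> \<sigma> + positive_kernel K
  for \<alpha> :: "'g::group_add \<Rightarrow> 'a::cstar_algebra \<Rightarrow> 'a"
    and \<sigma> :: "'g \<Rightarrow> 'g \<Rightarrow> 'a"
    and K :: "'s \<Rightarrow> 's \<Rightarrow> 'a" +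
  fixes \<rho> :: "'a \<Rightarrow> 's \<Rightarrow> 's" and v w :: "'g \<Rightarrow> 's \<Rightarrow> 's"
  assumes K_rho: "K (\<rho> a s) t = K s (\<rho> (star a) t)"
    and K_rho_add: "K s (\<rho> (a + b) t) = K s (\<rho> a t) + K s (\<rho> b t)"
    and K_rho_scale: "K s (\<rho> (c *\<^sub>C a) t) = c *\<^sub>C K s (\<rho> a t)"
    and K_rho_mult: "K s (\<rho> (a * b) t) = K s (\<rho> a (\<rho> b t))"
    and K_rho_one: "K s (\<rho> 1 t) = K s t"
    and K_v: "K (v g s) (v g t) = \<alpha> g (K s t)"
    and K_v_w: "K s (v g (w g t)) = K s t"
    and K_v_rho: "K s (v g (\<rho> a (w g t))) = K s (\<rho> (\<alpha> g a) t)"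
    and K_v_v: "K s (v g (v h t)) = K s (\<rho> (\<sigma> g h) (v (g + h) t)) * star (\<sigma> g h)"
begin

lemma K_v_w_left: "K (v g (w g s)) t = K s t"
  by (metis K_star K_v_w)

lemma alpha_injective: "\<alpha> g a = \<alpha> g b \<Longrightarrow> a = b"
  by (metis alpha_inv(2))

lemma K_w_v: "K s (w g (v g t)) = K s t"
  by (rule alpha_injective[of g]) (simp add: K_v[symmetric] K_v_w)

text \<open>
  A vector sees its arguments only through the generators. Relations between generators are
  thereby transported to all vectors.
\<close>

lemma vector_eq_ipc: "f \<in> HC \<Longrightarrow> f t = ipc (generator t) f"
  by (simp add: ipc_generator)

lemma generator_in_HC [simp]: "generator t \<in> HC"
  by (rule H0_subset_HC[OF generator_in_H0])

lemma vector_cong: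
  assumes "f \<in> HC" "\<And>s. K s t = K s t'"
  shows "f t = f t'"
  by (simp add: vector_eq_ipc[OF assms(1)] assms(2))

lemma vector_add:
  assumes "f \<in> HC" "\<And>s. K s t = K s t1 + K s t2"
  shows "f t = f t1 + f t2"
proof -
  have "generator t = generator t1 + generator t2" by (simp add: fun_eq_iff assms(2))
  then show ?thesis using assms(1) by (simp add: vector_eq_ipc compl.ip_add_left del: plus_fun_apply)
qed

lemma vector_act:
  assumes "f \<in> HC" "\<And>s. K s t = K s t' * a"
  shows "f t = star a * f t'"
proof -
  have "generator t = (\<lambda>s. generator t' s * a)" by (simp add: fun_eq_iff assms(2))
  then show ?thesis
    using assms(1) compl.ip_act_left[of "generator t'" f a] by (simp add: vector_eq_ipc)
qed

text \<open>
  The operators on functions are forced by their effect on inner products with the generators: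
  \<open>\<langle>k\<^sub>t, \<rho>(a) f\<rangle> = \<langle>\<rho>(star a) k\<^sub>t, f\<rangle>\<close> and \<open>\<langle>k\<^sub>t, v(g) f\<rangle> = \<alpha>\<^sub>g \<langle>v(g)\<inverse> k\<^sub>t, f\<rangle>\<close>. The operator \<open>W g\<close> is the
  inverse of \<open>V g\<close>.
\<close>

definition R :: "'a \<Rightarrow> ('s \<Rightarrow> 'a) \<Rightarrow> 's \<Rightarrow> 'a" where
  "R a f = (\<lambda>t. f (\<rho> (star a) t))"

definition V :: "'g \<Rightarrow> ('s \<Rightarrow> 'a) \<Rightarrow> 's \<Rightarrow> 'a" where
  "V g f = (\<lambda>t. \<alpha> g (f (w g t)))"

definition W :: "'g \<Rightarrow> ('s \<Rightarrow> 'a) \<Rightarrow> 's \<Rightarrow> 'a" where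
  "W g f = (\<lambda>t. inv (\<alpha> g) (f (v g t)))"

lemma R_comb: "R a (comb L) = comb (map (\<lambda>(s, b). (\<rho> a s, b)) L)"
  by (induction L) (auto simp: R_def fun_eq_iff K_rho star_star)

lemma V_comb: "V g (comb L) = comb (map (\<lambda>(s, b). (v g s, \<alpha> g b)) L)"
proof -
  have "\<alpha> g (K (w g t) s) = K t (v g s)" for s t
    by (simp add: K_v[symmetric] K_v_w_left)
  then show ?thesis
    by (induction L) (auto simp: V_def fun_eq_iff alpha_add alpha_mult)
qed

lemma W_comb: "W g (comb L) = comb (map (\<lambda>(s, b). (w g s, inv (\<alpha> g) b)) L)"
proof -
  have "K t (w g s) = inv (\<alpha> g) (K (v g t) s)" for s t
    by (rule alpha_injective[of g]) (simp add: K_v[symmetric] K_v_w)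
  then show ?thesis
    by (induction L)
      (auto simp: W_def fun_eq_iff inv_alpha_add inv_alpha_mult inv_alpha_scale[of g 0 0, simplified])
qed

lemma R_H0: "f \<in> H0 \<Longrightarrow> R a f \<in> H0"
  and V_H0: "f \<in> H0 \<Longrightarrow> V g f \<in> H0"
  and W_H0: "f \<in> H0 \<Longrightarrow> W g f \<in> H0"
  by (auto simp: H0_def R_comb V_comb W_comb)

lemma V_W: "f \<in> HC \<Longrightarrow> V g (W g f) = f"
  by (auto simp: V_def W_def fun_eq_iff intro: vector_cong K_v_w)

lemma W_V: "f \<in> HC \<Longrightarrow> W g (V g f) = f"
  by (auto simp: V_def W_def fun_eq_iff intro: vector_cong K_w_v)

lemma R_add: "f \<in> HC \<Longrightarrow> R (a + b) f = R a f + R b f"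
  by (auto simp: R_def fun_eq_iff star_add intro: vector_add K_rho_add)

lemma R_scale:
  assumes "f \<in> HC"
  shows "R (c *\<^sub>C a) f = (\<lambda>t. c *\<^sub>C R a f t)"
proof
  fix t
  have "f (\<rho> (star (c *\<^sub>C a)) t) = star (cnj c *\<^sub>C 1) * f (\<rho> (star a) t)"
    by (rule vector_act[OF assms]) (simp add: star_scaleC K_rho_scale mult_scaleC_right)
  then show "R (c *\<^sub>C a) f t = c *\<^sub>C R a f t" by (simp add: R_def star_scaleC mult_scaleC_left)
qed

lemma R_mult: "f \<in> HC \<Longrightarrow> R (a * b) f = R a (R b f)"
  by (auto simp: R_def fun_eq_iff star_mult intro: vector_cong K_rho_mult)

lemma R_one: "f \<in> HC \<Longrightarrow> R 1 f = f"
  by (auto simp: R_def fun_eq_iff intro: vector_cong K_rho_one)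

lemma R_adjoint_H0:
  assumes "f \<in> H0" "g \<in> H0"
  shows "ip0 (R a f) g = ip0 f (R (star a) g)"
proof -
  obtain L where L: "f = comb L" using assms(1) by (auto simp: H0_def)
  have "pair (map (\<lambda>(s, b). (\<rho> a s, b)) L) g = pair L (R (star a) g)"
    by (induction L) (auto simp: R_def star_star)
  then show ?thesis using assms by (simp add: L R_comb ip0_comb R_H0)
qed

lemma V_isometric_H0:
  assumes "f \<in> H0" "h \<in> H0"
  shows "ip0 (V g f) (V g h) = \<alpha> g (ip0 f h)"
proof -
  obtain L where L: "f = comb L" using assms(1) by (auto simp: H0_def)
  have "h (w g (v g s)) = h s" for s
    by (rule vector_cong[OF H0_subset_HC[OF assms(2)] K_w_v])
  then have "pair (map (\<lambda>(s, b). (v g s, \<alpha> g b)) L) (V g h) = \<alpha> g (pair L h)"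
    by (induction L) (auto simp: V_def alpha_add alpha_mult alpha_star)
  then show ?thesis using assms V_H0[OF assms(2)] by (simp add: L V_comb ip0_comb)
qed

lemma R_bound_H0:
  assumes f: "f \<in> H0"
  shows "pre.nrm (R a f) \<le> norm a * pre.nrm f"
proof -
  note fC = H0_subset_HC[OF f]
  have square: "ip0 f (R (star b * b) f) = ip0 (R b f) (R b f)" for b
    using R_adjoint_H0[OF f R_H0[OF f]] by (simp add: R_mult[OF fC])
  have "norm (ip0 f (R (star a * a) f)) \<le> (norm a)\<^sup>2 * norm (ip0 f (R 1 f))"
    by (rule positive_map_norm_le)
      (simp_all add: R_add[OF fC] R_scale[OF fC] square pre.ip_add pre.ip_scale pre.ip_positive
        R_H0 f del: plus_fun_apply)
  then have "(pre.nrm (R a f))\<^sup>2 \<le> (norm a * pre.nrm f)\<^sup>2"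
    by (simp add: square R_one[OF fC] pre.nrm_square power_mult_distrib)
  then show ?thesis by (rule power2_le_imp_le) simp
qed

lemma V_bound_H0: "f \<in> H0 \<Longrightarrow> pre.nrm (V g f) = pre.nrm f"
  by (simp add: pre.nrm_def V_isometric_H0 alpha_norm)

lemma W_bound_H0: "f \<in> H0 \<Longrightarrow> pre.nrm (W g f) = pre.nrm f"
  using V_bound_H0[OF W_H0, of f g g] by (simp add: V_W H0_subset_HC)

lemma approximates_R: "approximates F f \<Longrightarrow> approximates (\<lambda>n. R a (F n)) (R a f)"
  by (rule approximates_map[where C = "norm a" and \<Phi> = "R a"])
    (simp_all add: R_H0 R_bound_H0, simp_all add: R_def fun_eq_iff approximatesD)

lemma approximates_V: "approximates F f \<Longrightarrow> approximates (\<lambda>n. V g (F n)) (V g f)"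
  by (rule approximates_map[where C = 1 and \<Phi> = "V g"])
    (simp_all add: V_H0 V_bound_H0, simp_all add: V_def fun_eq_iff alpha_diff approximatesD
      bounded_linear.tendsto[OF bounded_linear_alpha])

lemma approximates_W: "approximates F f \<Longrightarrow> approximates (\<lambda>n. W g (F n)) (W g f)"
  by (rule approximates_map[where C = 1 and \<Phi> = "W g"])
    (simp_all add: W_H0 W_bound_H0, simp_all add: W_def fun_eq_iff approximatesD
      bounded_linear.linear[OF bounded_linear_inv_alpha, THEN linear_diff]
      bounded_linear.tendsto[OF bounded_linear_inv_alpha])

lemma R_HC: "f \<in> HC \<Longrightarrow> R a f \<in> HC"
  and V_HC: "f \<in> HC \<Longrightarrow> V g f \<in> HC"
  and W_HC: "f \<in> HC \<Longrightarrow> W g f \<in> HC"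
  unfolding HC_def using approximates_R approximates_V approximates_W by blast+

lemma R_adjoint:
  assumes "f \<in> HC" "g \<in> HC"
  shows "ipc (R a f) g = ipc f (R (star a) g)"
proof -
  obtain F G where F: "approximates F f" and G: "approximates G g"
    using assms by (auto simp: HC_def)
  have "(\<lambda>n. ip0 (R a (F n)) (G n)) \<longlonglongrightarrow> ipc (R a f) g"
    by (intro ipc_limit approximates_R F G)
  moreover have "(\<lambda>n. ip0 (F n) (R (star a) (G n))) \<longlonglongrightarrow> ipc f (R (star a) g)"
    by (intro ipc_limit approximates_R F G)
  ultimately show ?thesis
    using LIMSEQ_unique by (auto simp: R_adjoint_H0 approximatesD(1)[OF F] approximatesD(1)[OF G])
qed

lemma V_isometric:
  assumes "f \<in> HC" "h \<in> HC"
  shows "ipc (V g f) (V g h) = \<alpha> g (ipc f h)"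
proof -
  obtain F H where F: "approximates F f" and H: "approximates H h"
    using assms by (auto simp: HC_def)
  have "(\<lambda>n. ip0 (V g (F n)) (V g (H n))) \<longlonglongrightarrow> ipc (V g f) (V g h)"
    by (intro ipc_limit approximates_V F H)
  moreover have "(\<lambda>n. \<alpha> g (ip0 (F n) (H n))) \<longlonglongrightarrow> \<alpha> g (ipc f h)"
    by (intro bounded_linear.tendsto[OF bounded_linear_alpha] ipc_limit F H)
  ultimately show ?thesis
    using LIMSEQ_unique by (auto simp: V_isometric_H0 approximatesD(1)[OF F] approximatesD(1)[OF H])
qed

lemma V_norm: "f \<in> HC \<Longrightarrow> compl.nrm (V g f) = compl.nrm f"
  by (simp add: compl.nrm_def V_isometric alpha_norm)

text \<open>
  The relation between \<open>v g\<close>, \<open>v h\<close> and \<open>v (g + h)\<close>, passed to the adjoint side. It carries a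
  coefficient from the algebra, which \<open>vector_act\<close> moves out of the vector.
\<close>

lemma K_w_w:
  "K s (w h (w g t)) = K s (w (g + h) (\<rho> (star (\<sigma> g h)) t)) * inv (\<alpha> (g + h)) (\<sigma> g h)"
proof -
  let ?\<sigma> = "\<sigma> g h" and ?k = "g + h"
  have u: "star ?\<sigma> * ?\<sigma> = 1" using sigma_unitary[of g h] by (simp add: unitary_element_def)
  have "\<alpha> g (\<alpha> h (K s (w h (w g t)))) = K (v g (v h s)) t"
    by (simp add: K_v[symmetric] K_v_w)
  also have "\<dots> = ?\<sigma> * K (\<rho> ?\<sigma> (v ?k s)) t"
    by (subst K_star) (simp add: K_v_v star_mult star_star K_star[of "\<rho> ?\<sigma> (v ?k s)"])
  also have "\<dots> = ?\<sigma> * \<alpha> ?k (K s (w ?k (\<rho> (star ?\<sigma>) t)))"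
    by (simp add: K_rho K_v[symmetric] K_v_w)
  finally have "?\<sigma> * (\<alpha> ?k (K s (w h (w g t))) * star ?\<sigma>)
      = ?\<sigma> * \<alpha> ?k (K s (w ?k (\<rho> (star ?\<sigma>) t)))"
    by (simp add: alpha_alpha mult.assoc)
  then have "star ?\<sigma> * ?\<sigma> * (\<alpha> ?k (K s (w h (w g t))) * star ?\<sigma>)
      = star ?\<sigma> * ?\<sigma> * \<alpha> ?k (K s (w ?k (\<rho> (star ?\<sigma>) t)))"
    by (simp only: mult.assoc)
  then have "\<alpha> ?k (K s (w h (w g t))) * star ?\<sigma> * ?\<sigma>
      = \<alpha> ?k (K s (w ?k (\<rho> (star ?\<sigma>) t))) * ?\<sigma>"
    by (simp add: u)
  then have "\<alpha> ?k (K s (w h (w g t))) = \<alpha> ?k (K s (w ?k (\<rho> (star ?\<sigma>) t))) * ?\<sigma>"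
    by (simp add: mult.assoc u)
  then show ?thesis by - (rule alpha_injective[of ?k], simp add: alpha_mult)
qed

lemma V_V:
  assumes "f \<in> HC"
  shows "V g (V h f) = (\<lambda>t. R (\<sigma> g h) (V (g + h) f) t * star (\<sigma> g h))"
proof
  fix t
  let ?\<sigma> = "\<sigma> g h" and ?k = "g + h"
  have u: "?\<sigma> * star ?\<sigma> = 1" using sigma_unitary[of g h] by (simp add: unitary_element_def)
  have "f (w h (w g t)) = star (inv (\<alpha> ?k) ?\<sigma>) * f (w ?k (\<rho> (star ?\<sigma>) t))"
    by (rule vector_act[OF assms K_w_w])
  then have "V g (V h f) t
      = ?\<sigma> * star ?\<sigma> * \<alpha> ?k (f (w ?k (\<rho> (star ?\<sigma>) t))) * star ?\<sigma>"
    by (simp add: V_def alpha_alpha alpha_mult alpha_star mult.assoc)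
  then show "V g (V h f) t = R ?\<sigma> (V ?k f) t * star ?\<sigma>" by (simp add: u R_def V_def)
qed

lemma V_bij: "bij_betw (V g) HC HC"
  by (rule bij_betw_byWitness[where f' = "W g"]) (auto simp: V_W W_V V_HC W_HC)

lemma inv_V: "f \<in> HC \<Longrightarrow> inv_into HC (V g) f = W g f"
  using V_bij[of g] by (intro inv_into_f_eq) (auto simp: bij_betw_def V_W W_HC)

theorem kernel_representation: "equivariant_rep \<alpha> \<sigma> kernel_module R V"
proof (intro equivariant_rep.intro twisted_system_axioms hilbert_kernel_module
    equivariant_rep_axioms.intro)
  have adj: "adjoint_pair kernel_module (R a) (R (star a))" for a
    by (auto simp: adjoint_pair_def R_HC R_adjoint)
  then have "R a \<in> adjointable kernel_module" for a
    by (auto simp: adjointable_def)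
  with adj show "adjointable_rep kernel_module R"
    by (simp add: adjointable_rep_def R_add R_scale R_mult R_one)
  show "bounded_invertible kernel_module (V g)" for g
    unfolding bounded_invertible_def kernel_module_simps
  proof (intro conjI allI ballI)
    show "bij_betw (V g) HC HC" by (rule V_bij)
    show "\<exists>C. \<forall>f\<in>HC. compl.nrm (V g f) \<le> C * compl.nrm f"
      by (intro exI[of _ 1]) (simp add: V_norm)
    have "compl.nrm (W g f) = compl.nrm f" if "f \<in> HC" for f
      using V_norm[OF W_HC[OF that], of g g] that by (simp add: V_W)
    then show "\<exists>C. \<forall>f\<in>HC. compl.nrm (inv_into HC (V g) f) \<le> C * compl.nrm f"
      by (intro exI[of _ 1]) (simp add: inv_V)
  qed (auto simp: V_def fun_eq_iff alpha_add alpha_scale)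
  show "R (\<alpha> g a) f = V g (R a (inv_into (vecs kernel_module) (V g) f))"
    if "f \<in> vecs kernel_module" for f g a
  proof
    fix t
    have f: "f \<in> HC" using that by simp
    have "f (\<rho> (\<alpha> g (star a)) t) = f (v g (\<rho> (star a) (w g t)))"
      by (rule vector_cong[OF f]) (simp add: K_v_rho)
    then show "R (\<alpha> g a) f t = V g (R a (inv_into (vecs kernel_module) (V g) f)) t"
      by (simp add: inv_V f) (simp add: R_def V_def W_def alpha_star)
  qed
  show "V g (V h f) = hact kernel_module (R (\<sigma> g h) (V (g + h) f)) (star (\<sigma> g h))"
    if "f \<in> vecs kernel_module" for f g h
    using that by (simp add: V_V)
  show "\<alpha> g (hinner kernel_module f h) = hinner kernel_module (V g f) (V g h)"
    if "f \<in> vecs kernel_module" "h \<in> vecs kernel_module" for f h g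
    using that by (simp add: V_isometric)
  show "V g (hact kernel_module f a) = hact kernel_module (V g f) (\<alpha> g a)" for f g a
    by (simp add: V_def alpha_mult)
qed

lemma generator_coefficient:
  "coefficient_map kernel_module R V (generator s) (generator t) g a = K s (\<rho> a (v g t))"
proof -
  have "coefficient_map kernel_module R V (generator s) (generator t) g a
      = R a (V g (generator t)) s"
    by (simp add: coefficient_map_def ipc_generator R_HC V_HC)
  also have "\<dots> = K (v g (w g (\<rho> (star a) s))) (v g t)"
    by (simp add: R_def V_def K_v)
  also have "\<dots> = K s (\<rho> a (v g t))" by (simp add: K_v_w_left K_rho star_star)
  finally show ?thesis .
qed

lemma generator_norm: "(hnorm kernel_module (generator s))\<^sup>2 = norm (K s s)"
  by (simp add: compl.nrm_square ipc_generator)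

lemma sum_fun_apply: "(\<Sum>i\<in>I. f i) t = (\<Sum>i\<in>I. (f i t :: 'a))"
  by (induction I rule: infinite_finite_induct) auto

lemma sum_generators_H0: "(\<Sum>i\<in>I. generator (s i)) \<in> H0"
  by (induction I rule: infinite_finite_induct)
    (simp_all add: pre.zero_closed pre.add_closed generator_in_H0
      del: plus_fun_apply zero_fun_apply)

lemma ip0_sum_generators:
  assumes "finite I" "f \<in> H0"
  shows "ip0 (\<Sum>i\<in>I. generator (s i)) f = (\<Sum>i\<in>I. f (s i))"
  using assms(1)
proof (induction I rule: finite_induct)
  case empty
  show ?case using pre.ip_act_left[OF pre.zero_closed assms(2), of 0] by (simp add: zero_fun_def)
next
  case (insert i I)
  then show ?case
    using assms(2) by (simp add: pre.ip_add_left sum_generators_H0 generator_in_H0 ip0_generator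
        del: plus_fun_apply)
qed

text \<open>
  By orthogonality the squared norm of a section of the series is at most the sum of the norms of
  \<open>K (s n) (s n)\<close> over that section.
\<close>

lemma orthogonal_series:
  assumes orth: "\<And>m n. m \<noteq> n \<Longrightarrow> K (s m) (s n) = 0" and sm: "summable (\<lambda>n. norm (K (s n) (s n)))"
  obtains f where "approximates (\<lambda>N. \<Sum>n<N. generator (s n)) f"
    "(hnorm kernel_module f)\<^sup>2 \<le> (\<Sum>n. norm (K (s n) (s n)))"
proof -
  define F where "F = (\<lambda>N::nat. \<Sum>n<N. generator (s n))"
  have sq: "(pre.nrm (\<Sum>i\<in>I. generator (s i)))\<^sup>2 \<le> (\<Sum>i\<in>I. norm (K (s i) (s i)))"
    if "finite I" for I
  proof -
    have "ip0 (\<Sum>i\<in>I. generator (s i)) (\<Sum>i\<in>I. generator (s i)) = (\<Sum>i\<in>I. \<Sum>j\<in>I. K (s i) (s j))"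
      using that by (simp add: ip0_sum_generators sum_generators_H0 sum_fun_apply)
    also have "\<dots> = (\<Sum>i\<in>I. \<Sum>j\<in>I. if i = j then K (s i) (s i) else 0)"
      by (intro sum.cong refl) (auto simp: orth)
    also have "\<dots> = (\<Sum>i\<in>I. K (s i) (s i))" using that by simp
    finally show ?thesis by (simp add: pre.nrm_square sum_norm_le)
  qed
  have diff: "(pre.nrm (F n - F m))\<^sup>2 \<le> (\<Sum>i\<in>{m..<n}. norm (K (s i) (s i)))" if "m \<le> n" for m n
  proof -
    have "F n = F m + (\<Sum>i\<in>{m..<n}. generator (s i))"
      unfolding F_def using that
      by (subst sum.union_disjoint[symmetric]) (auto intro!: sum.cong)
    then have "F n - F m = (\<Sum>i\<in>{m..<n}. generator (s i))" by simp
    then show ?thesis using sq[of "{m..<n}"] by simp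
  qed
  have FH: "F n \<in> H0" for n unfolding F_def by (rule sum_generators_H0)
  have "cauchy F"
    unfolding cauchy_def
  proof (intro conjI allI impI FH)
    fix e :: real assume e: "0 < e"
    obtain N where N: "\<And>m n. N \<le> m \<Longrightarrow> norm (\<Sum>i\<in>{m..<n}. norm (K (s i) (s i))) < e\<^sup>2"
      using sm e unfolding summable_Cauchy by (meson zero_less_power)
    have lt: "pre.nrm (F n - F m) < e" if "N \<le> m" "m \<le> n" for m n
    proof -
      have "(pre.nrm (F n - F m))\<^sup>2 < e\<^sup>2" using diff[OF that(2)] N[OF that(1), of n] by simp
      then show ?thesis using e by (simp add: power2_less_imp_less)
    qed
    have "pre.nrm (F m - F n) < e" if "N \<le> m" "N \<le> n" for m n
      using lt[of m n] lt[of n m] that pre.nrm_minus_commute[OF FH FH] by (cases "m \<le> n") auto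
    then show "\<exists>N. \<forall>m\<ge>N. \<forall>n\<ge>N. pre.nrm (F m - F n) < e" by blast
  qed
  then obtain f where f: "approximates F f" by (rule cauchy_has_limit)
  have "(\<lambda>n. (pre.nrm (F n))\<^sup>2) \<longlonglongrightarrow> (compl.nrm f)\<^sup>2"
    by (intro tendsto_intros nrm_limit f)
  moreover have "(pre.nrm (F n))\<^sup>2 \<le> (\<Sum>n. norm (K (s n) (s n)))" for n
    using sq[of "{..<n}"] sum_le_suminf[OF sm, of "{..<n}"] by (simp add: F_def)
  ultimately have "(compl.nrm f)\<^sup>2 \<le> (\<Sum>n. norm (K (s n) (s n)))"
    by (intro LIMSEQ_le_const2) auto
  with f show thesis using that by (simp add: F_def)
qed

lemma series_coefficient:
  assumes f: "approximates (\<lambda>N. \<Sum>n<N. generator (s n)) f"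
    and h: "approximates (\<lambda>N. \<Sum>n<N. generator (t n)) h"
    and orth: "\<And>m n. m \<noteq> n \<Longrightarrow> K (s m) (\<rho> a (v g (t n))) = 0"
  shows "(\<lambda>n. K (s n) (\<rho> a (v g (t n)))) sums coefficient_map kernel_module R V f h g a"
proof -
  have lim: "(\<lambda>N. ip0 (\<Sum>n<N. generator (s n)) (R a (V g (\<Sum>n<N. generator (t n)))))
      \<longlonglongrightarrow> coefficient_map kernel_module R V f h g a"
    unfolding coefficient_map_def kernel_module_simps
    by (intro ipc_limit f approximates_R approximates_V h)
  have sum_a: "\<alpha> g (sum f I) = (\<Sum>i\<in>I. \<alpha> g (f i))" for f :: "nat \<Rightarrow> 'a" and I
    by (induction I rule: infinite_finite_induct) (simp_all add: alpha_add)
  have term_eq: "\<alpha> g (K (w g (\<rho> (star a) x)) y) = K x (\<rho> a (v g y))" for x y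
    by (simp add: K_v[symmetric] K_v_w_left K_rho star_star)
  have "ip0 (\<Sum>n<N. generator (s n)) (R a (V g (\<Sum>n<N. generator (t n))))
      = (\<Sum>m<N. \<Sum>n<N. K (s m) (\<rho> a (v g (t n))))" for N
    by (subst ip0_sum_generators)
      (simp_all add: R_H0 V_H0 sum_generators_H0, simp add: R_def V_def sum_fun_apply sum_a term_eq)
  also have "(\<Sum>m<N. \<Sum>n<N. K (s m) (\<rho> a (v g (t n))))
      = (\<Sum>m<N. \<Sum>n<N. if m = n then K (s m) (\<rho> a (v g (t m))) else 0)" for N
    by (intro sum.cong refl) (auto simp: orth)
  finally show ?thesis using lim by (simp add: sums_def)
qed

end

lemma positive_kernelI:
  assumes "\<And>s t. K t s = star (K s t)"
    and pos: "\<And>(I :: nat set) s a. finite I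
      \<Longrightarrow> positive_element (\<Sum>i\<in>I. \<Sum>j\<in>I. star (a i) * K (s i) (s j) * a j)"
  shows "positive_kernel K"
proof
  fix L :: "('a \<times> 'b) list"
  have "(\<Sum>(s, a)\<leftarrow>L. \<Sum>(t, b)\<leftarrow>L. star a * K s t * b)
      = (\<Sum>i<length L. \<Sum>j<length L. star (snd (L ! i)) * K (fst (L ! i)) (fst (L ! j)) * snd (L ! j))"
    by (simp add: sum_list_sum_nth atLeast0LessThan split_def)
  then show "positive_element (\<Sum>(s, a)\<leftarrow>L. \<Sum>(t, b)\<leftarrow>L. star a * K s t * b)"
    using pos[of "{..<length L}"] by simp
qed (rule assms(1))


section \<open>Countable direct sums\<close>

text \<open>
  Indices of generators range over a whole type. A point outside the carrier set of a module is
  read as the zero vector.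
\<close>

definition (in hilbert_module) proj :: "'x \<Rightarrow> 'x" where
  "proj x = (if x \<in> vecs X then x else hzero X)"

lemma (in hilbert_module) proj_closed [simp]: "proj x \<in> vecs X"
  by (simp add: proj_def zero_closed)

lemma (in hilbert_module) proj_id [simp]: "x \<in> vecs X \<Longrightarrow> proj x = x"
  by (simp add: proj_def)

locale equivariant_rep_sequence =
  fixes \<alpha> :: "'g::group_add \<Rightarrow> 'a::cstar_algebra \<Rightarrow> 'a"
    and \<sigma> :: "'g \<Rightarrow> 'g \<Rightarrow> 'a"
    and X :: "nat \<Rightarrow> ('x, 'a) hmodule"
    and \<rho> :: "nat \<Rightarrow> 'a \<Rightarrow> 'x \<Rightarrow> 'x"
    and v :: "nat \<Rightarrow> 'g \<Rightarrow> 'x \<Rightarrow> 'x"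
  assumes reps: "equivariant_rep \<alpha> \<sigma> (X n) (\<rho> n) (v n)"
begin

sublocale rep: equivariant_rep \<alpha> \<sigma> "X n" "\<rho> n" "v n" for n
  by (rule reps)

definition sum_kernel :: "nat \<times> 'x \<Rightarrow> nat \<times> 'x \<Rightarrow> 'a" where
  "sum_kernel = (\<lambda>(m, x) (n, y). if m = n then hinner (X m) (rep.proj m x) (rep.proj m y) else 0)"

definition sum_rho :: "'a \<Rightarrow> nat \<times> 'x \<Rightarrow> nat \<times> 'x" where
  "sum_rho a = (\<lambda>(n, x). (n, \<rho> n a (rep.proj n x)))"

definition sum_v :: "'g \<Rightarrow> nat \<times> 'x \<Rightarrow> nat \<times> 'x" where
  "sum_v g = (\<lambda>(n, x). (n, v n g (rep.proj n x)))"

definition sum_w :: "'g \<Rightarrow> nat \<times> 'x \<Rightarrow> nat \<times> 'x" where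
  "sum_w g = (\<lambda>(n, x). (n, rep.v_inv n g (rep.proj n x)))"

lemma positive_sum_kernel: "positive_kernel sum_kernel"
proof (rule positive_kernelI)
  show "sum_kernel t s = star (sum_kernel s t)" for s t
  proof (cases s; cases t)
    fix m x n y assume "s = (m, x)" "t = (n, y)"
    then show ?thesis
      using rep.inner_star[OF rep.proj_closed rep.proj_closed, of m x y]
      by (simp add: sum_kernel_def star_star)
  qed
  fix I :: "nat set" and s :: "nat \<Rightarrow> nat \<times> 'x" and a :: "nat \<Rightarrow> 'a"
  assume I: "finite I"
  let ?n = "\<lambda>i. fst (s i)"
  define z where "z i = hact (X (?n i)) (rep.proj (?n i) (snd (s i))) (a i)" for i
  have z: "z i \<in> vecs (X (?n i))" for i
    by (simp add: z_def rep.act_closed)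
  have "star (a i) * sum_kernel (s i) (s j) * a j
      = (if ?n j = ?n i then hinner (X (?n i)) (z i) (z j) else 0)" for i j
    by (auto simp: sum_kernel_def z_def split_def rep.inner_act_left rep.inner_act rep.act_closed
        mult.assoc)
  then have "(\<Sum>i\<in>I. \<Sum>j\<in>I. star (a i) * sum_kernel (s i) (s j) * a j)
      = (\<Sum>i\<in>I. \<Sum>j\<in>{j\<in>I. ?n j = ?n i}. hinner (X (?n i)) (z i) (z j))"
    using I by (simp add: sum.inter_filter)
  also have "\<dots> = (\<Sum>n\<in>?n ` I. \<Sum>i\<in>{i\<in>I. ?n i = n}. \<Sum>j\<in>{j\<in>I. ?n j = ?n i}.
      hinner (X (?n i)) (z i) (z j))"
    by (rule sum.image_gen[OF I])
  also have "\<dots> = (\<Sum>n\<in>?n ` I. \<Sum>i\<in>{i\<in>I. ?n i = n}. \<Sum>j\<in>{j\<in>I. ?n j = n}. hinner (X n) (z i) (z j))"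
    by (intro sum.cong refl) auto
  finally have eq: "(\<Sum>i\<in>I. \<Sum>j\<in>I. star (a i) * sum_kernel (s i) (s j) * a j) = \<dots>" .
  have "positive_element (\<Sum>i\<in>{i\<in>I. ?n i = n}. \<Sum>j\<in>{j\<in>I. ?n j = n}. hinner (X n) (z i) (z j))" for n
    by (rule rep.positive_gram_sum) (use I z in auto)
  then show "positive_element (\<Sum>i\<in>I. \<Sum>j\<in>I. star (a i) * sum_kernel (s i) (s j) * a j)"
    unfolding eq by (rule positive_sum)
qed

sublocale sum: equivariant_kernel \<alpha> \<sigma> sum_kernel sum_rho sum_v sum_w
proof (intro equivariant_kernel.intro rep.twisted_system_axioms positive_sum_kernel
    equivariant_kernel_axioms.intro)
  fix s t :: "nat \<times> 'x" and a b g h and c :: complex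
  obtain m x n y where st: "s = (m, x)" "t = (n, y)" by (cases s, cases t) auto
  note simps = st sum_kernel_def sum_rho_def sum_v_def sum_w_def rep.rho_closed rep.v_closed
    rep.v_inv_closed
  show "sum_kernel (sum_rho a s) t = sum_kernel s (sum_rho (star a) t)"
    by (simp add: simps rep.rho_adjoint)
  show "sum_kernel s (sum_rho (a + b) t) = sum_kernel s (sum_rho a t) + sum_kernel s (sum_rho b t)"
    by (simp add: simps rep.rho_add rep.inner_add rep.add_closed)
  show "sum_kernel s (sum_rho (c *\<^sub>C a) t) = c *\<^sub>C sum_kernel s (sum_rho a t)"
    by (simp add: simps rep.rho_scale rep.inner_scale rep.scale_closed)
  show "sum_kernel s (sum_rho (a * b) t) = sum_kernel s (sum_rho a (sum_rho b t))"
    by (simp add: simps rep.rho_mult)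
  show "sum_kernel s (sum_rho 1 t) = sum_kernel s t"
    by (simp add: simps rep.rho_one)
  show "sum_kernel (sum_v g s) (sum_v g t) = \<alpha> g (sum_kernel s t)"
    by (simp add: simps rep.alpha_inner)
  show "sum_kernel s (sum_v g (sum_w g t)) = sum_kernel s t"
    by (simp add: simps rep.v_v_inv)
  show "sum_kernel s (sum_v g (sum_rho a (sum_w g t))) = sum_kernel s (sum_rho (\<alpha> g a) t)"
    by (simp add: simps rep.v_rho rep.v_v_inv)
  show "sum_kernel s (sum_v g (sum_v h t))
      = sum_kernel s (sum_rho (\<sigma> g h) (sum_v (g + h) t)) * star (\<sigma> g h)"
    by (simp add: simps rep.v_v rep.inner_act rep.act_closed)
qed

text \<open>
  The vectors \<open>f\<close> and \<open>h\<close> are the orthogonal series of the \<open>x n\<close> and of the \<open>y n\<close>.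
\<close>

theorem direct_sum_decomposition:
  assumes x: "\<And>n. x n \<in> vecs (X n)" and y: "\<And>n. y n \<in> vecs (X n)"
    and sx: "summable (\<lambda>n. (hnorm (X n) (x n))\<^sup>2)" and sy: "summable (\<lambda>n. (hnorm (X n) (y n))\<^sup>2)"
  obtains f h T where "decomposition \<alpha> \<sigma> sum.kernel_module sum.R sum.V f h T"
    "(hnorm sum.kernel_module f)\<^sup>2 \<le> (\<Sum>n. (hnorm (X n) (x n))\<^sup>2)"
    "(hnorm sum.kernel_module h)\<^sup>2 \<le> (\<Sum>n. (hnorm (X n) (y n))\<^sup>2)"
    "\<And>g a. (\<lambda>n. coefficient_map (X n) (\<rho> n) (v n) (x n) (y n) g a) sums T g a"
proof -
  have K: "sum_kernel (n, z n) (n, z n) = hinner (X n) (z n) (z n)" if "\<And>n. z n \<in> vecs (X n)" for z n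
    using that by (simp add: sum_kernel_def)
  have orth: "sum_kernel (m, z) (n, z') = 0" if "m \<noteq> n" for m n z z'
    using that by (simp add: sum_kernel_def)
  obtain f where f: "sum.approximates (\<lambda>N. \<Sum>n<N. sum.generator (n, x n)) f"
    "(hnorm sum.kernel_module f)\<^sup>2 \<le> (\<Sum>n. (hnorm (X n) (x n))\<^sup>2)"
    using sum.orthogonal_series[of "\<lambda>n. (n, x n)"] sx
    by (auto simp: orth K[OF x] hnorm_square simp del: sum.kernel_module_simps)
  obtain h where h: "sum.approximates (\<lambda>N. \<Sum>n<N. sum.generator (n, y n)) h"
    "(hnorm sum.kernel_module h)\<^sup>2 \<le> (\<Sum>n. (hnorm (X n) (y n))\<^sup>2)"
    using sum.orthogonal_series[of "\<lambda>n. (n, y n)"] sy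
    by (auto simp: orth K[OF y] hnorm_square simp del: sum.kernel_module_simps)
  have "f \<in> sum.HC" "h \<in> sum.HC" using f(1) h(1) by (auto simp: sum.HC_def)
  then have "decomposition \<alpha> \<sigma> sum.kernel_module sum.R sum.V f h
      (coefficient_map sum.kernel_module sum.R sum.V f h)"
    by (simp add: decomposition_def sum.kernel_representation)
  moreover have "(\<lambda>n. coefficient_map (X n) (\<rho> n) (v n) (x n) (y n) g a)
      sums coefficient_map sum.kernel_module sum.R sum.V f h g a" for g a
    using sum.series_coefficient[OF f(1) h(1), of a g] x y
    by (simp add: sum_kernel_def sum_rho_def sum_v_def coefficient_map_def rep.rho_closed rep.v_closed)
  ultimately show thesis using that f(2) h(2) by blast
qed

end


section \<open>Internal tensor products\<close>

lemma sum_insert_square: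
  assumes "finite F" "k \<notin> F"
  shows "(\<Sum>i\<in>insert k F. \<Sum>j\<in>insert k F. f i j)
    = (f k k + (\<Sum>j\<in>F. f k j) + (\<Sum>i\<in>F. f i k) + (\<Sum>i\<in>F. \<Sum>j\<in>F. f i j) :: 'b::comm_monoid_add)"
  using assms by (simp add: sum.distrib ac_simps)

context equivariant_rep
begin

lemma rho_inner_add:
  "x \<in> vecs X \<Longrightarrow> y \<in> vecs X \<Longrightarrow> hinner X x (\<rho> (a + b) y) = hinner X x (\<rho> a y) + hinner X x (\<rho> b y)"
  by (simp add: rho_add inner_add rho_closed)

lemma rho_inner_scaleR:
  "x \<in> vecs X \<Longrightarrow> y \<in> vecs X \<Longrightarrow> hinner X x (\<rho> (r *\<^sub>R a) y) = r *\<^sub>R hinner X x (\<rho> a y)"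
  by (simp add: scaleR_scaleC rho_scale inner_scale rho_closed)

lemma rho_inner_zero: "x \<in> vecs X \<Longrightarrow> y \<in> vecs X \<Longrightarrow> hinner X x (\<rho> 0 y) = 0"
  using rho_inner_scaleR[of x y 0 0] by simp

lemma rho_inner_act:
  assumes "x \<in> vecs X" "y \<in> vecs X"
  shows "hinner X x (\<rho> b (hact X y a)) = hinner X x (\<rho> b y) * a"
  using assms rho_adjoint[of x "hact X y a" "star b"] rho_adjoint[of x y "star b"]
  by (simp add: act_closed rho_closed inner_act star_star)

text \<open>
  The complete positivity of \<open>\<rho>\<close>, by elimination of one row and column: with \<open>q = (g k k + e)\<inverse>\<close>
  the Schur complement \<open>g i j - g i k * q * g k j\<close> is a positive matrix with one index less, and
  the matrix that is subtracted is a Gram matrix.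
\<close>

lemma positive_matrix_form:
  fixes g :: "'i \<Rightarrow> 'i \<Rightarrow> 'a"
  assumes "finite I" "\<And>i j. g j i = star (g i j)"
    "\<And>c. positive_element (\<Sum>i\<in>I. \<Sum>j\<in>I. star (c i) * g i j * c j)"
    "\<And>i. y i \<in> vecs X"
  shows "positive_element (\<Sum>i\<in>I. \<Sum>j\<in>I. hinner X (y i) (\<rho> (g i j) (y j)))"
  using assms(1-3)
proof (induction I arbitrary: g rule: finite_induct)
  case empty
  show ?case by simp
next
  case (insert k F)
  note fin = insert.hyps(1) and kF = insert.hyps(2)
  note g_star = insert.prems(1) and g_pos = insert.prems(2)
  note y = assms(4)
  let ?G = "insert k F"
  let ?p = "g k k"
  have "star (c i) * g i j * c j = (if i = k \<and> j = k then ?p else 0)"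
    if "c = (\<lambda>i. if i = k then 1 else 0)" for c i j
    using that by simp
  then have "positive_element (\<Sum>i\<in>?G. \<Sum>j\<in>?G. if i = k \<and> j = k then ?p else 0)"
    using g_pos[of "\<lambda>i. if i = k then 1 else 0"] by simp
  moreover have "(\<Sum>i\<in>?G. \<Sum>j\<in>?G. if i = k \<and> j = k then ?p else 0) = ?p"
  proof -
    have "(if i = k \<and> j = k then ?p else 0) = 0" if "i \<in> F \<or> j \<in> F" for i j
      using that kF by auto
    then show ?thesis
      unfolding sum_insert_square[OF fin kF] using fin kF by (simp cong: sum.cong)
  qed
  ultimately have p: "positive_element ?p" by simp
  have shifted: "positive_element
      ((\<Sum>i\<in>?G. \<Sum>j\<in>?G. hinner X (y i) (\<rho> (g i j) (y j))) + e *\<^sub>R hinner X (y k) (y k))"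
    if e: "0 < e" for e :: real
  proof -
    obtain q where q: "positive_element q" "two_sided_inverse (?p + e *\<^sub>R 1) q"
      using positive_plus_inverse[OF p e] by blast
    have sq: "star q = q" by (rule positive_selfadjoint[OF q(1)])
    have pq: "(?p + e *\<^sub>R 1) * q = 1" "q * (?p + e *\<^sub>R 1) = 1"
      using q(2) by (simp_all add: two_sided_inverse_def)
    define u where "u i j = g i j + (if i = k \<and> j = k then e *\<^sub>R 1 else 0)" for i j
    define h where "h i j = u i j - u i k * q * u k j" for i j
    have u_star: "u j i = star (u i j)" for i j
      by (simp add: u_def star_add star_star g_star[of i j])
    have h_star: "h j i = star (h i j)" for i j
      using u_star[of i j] u_star[of i k] u_star[of k j]
      by (simp add: h_def star_diff star_mult star_star sq mult.assoc)
    have u_kk: "u k k = ?p + e *\<^sub>R 1" by (simp add: u_def)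
    have h_row: "h k j = 0" and h_col: "h j k = 0" for j
      using pq by (simp_all add: h_def u_kk mult.assoc)
    have h_pos: "positive_element (\<Sum>i\<in>F. \<Sum>j\<in>F. star (c i) * h i j * c j)" for c
    proof -
      define b where "b = (\<Sum>j\<in>F. g k j * c j)"
      define r where "r = (\<Sum>i\<in>F. \<Sum>j\<in>F. star (c i) * g i j * c j)"
      define d where "d = - (q * b)"
      have sb: "star b = (\<Sum>i\<in>F. star (c i) * g i k)"
        by (simp add: b_def star_sum star_mult star_star g_star[of k])
      have neq: "i \<noteq> k" if "i \<in> F" for i using that kF by auto
      have "(\<Sum>i\<in>F. \<Sum>j\<in>F. star (c i) * h i j * c j)
          = (\<Sum>i\<in>F. \<Sum>j\<in>F. star (c i) * g i j * c j - (star (c i) * g i k) * q * (g k j * c j))"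
        by (intro sum.cong refl) (simp add: h_def u_def neq algebra_simps)
      also have "\<dots> = r - (\<Sum>i\<in>F. \<Sum>j\<in>F. (star (c i) * g i k) * q * (g k j * c j))"
        by (simp add: r_def sum_subtractf)
      also have "(\<Sum>i\<in>F. \<Sum>j\<in>F. (star (c i) * g i k) * q * (g k j * c j)) = star b * q * b"
        unfolding sb
        by (subst sum.swap) (simp add: b_def sum_distrib_left sum_distrib_right mult.assoc)
      finally have eq: "(\<Sum>i\<in>F. \<Sum>j\<in>F. star (c i) * h i j * c j) = r - star b * q * b" .
      define c' where "c' = c(k := d)"
      have c': "c' k = d" "\<And>i. i \<in> F \<Longrightarrow> c' i = c i" using neq by (auto simp: c'_def)
      have "(\<Sum>i\<in>?G. \<Sum>j\<in>?G. star (c' i) * g i j * c' j)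
          = star d * ?p * d + (\<Sum>j\<in>F. star d * (g k j * c j)) + (\<Sum>i\<in>F. (star (c i) * g i k) * d) + r"
        unfolding sum_insert_square[OF fin kF] by (simp add: c' r_def mult.assoc cong: sum.cong)
      also have "\<dots> = star d * ?p * d + star d * b + star b * d + r"
        unfolding sb by (simp add: b_def sum_distrib_left sum_distrib_right)
      finally have dr: "positive_element (star d * ?p * d + star d * b + star b * d + r)"
        using g_pos[of c'] by simp
      have dpd: "star d * ?p * d = star b * q * b - e *\<^sub>R (star b * q * q * b)"
      proof -
        have "q * (?p + e *\<^sub>R 1) * q = q" by (simp add: pq)
        then have "q * ?p * q = q - e *\<^sub>R (q * q)" by (simp add: algebra_simps eq_diff_eq)
        then have "star b * (q * ?p * q) * b = star b * (q - e *\<^sub>R (q * q)) * b" by simp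
        then show ?thesis by (simp add: d_def star_mult sq algebra_simps)
      qed
      have "star d * b = - (star b * q * b)" "star b * d = - (star b * q * b)"
        by (simp_all add: d_def star_mult sq mult.assoc)
      then have "star d * ?p * d + star d * b + star b * d + r
          = r - star b * q * b - e *\<^sub>R (star b * q * q * b)"
        unfolding dpd by simp
      with dr have "positive_element (r - star b * q * b - e *\<^sub>R (star b * q * q * b))"
        by simp
      moreover have "positive_element (e *\<^sub>R (star (q * b) * (q * b)))"
        using e by (intro positive_scaleR positive_star_mult) simp
      then have "positive_element (e *\<^sub>R (star b * q * q * b))"
        by (simp add: star_mult sq mult.assoc)
      ultimately have "positive_element ((r - star b * q * b - e *\<^sub>R (star b * q * q * b))
          + e *\<^sub>R (star b * q * q * b))"
        by (rule positive_add)
      then show ?thesis by (simp add: eq)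
    qed
    have "positive_element (\<Sum>i\<in>F. \<Sum>j\<in>F. hinner X (y i) (\<rho> (h i j) (y j)))"
      by (rule insert.IH[OF h_star h_pos])
    then have part1: "positive_element (\<Sum>i\<in>?G. \<Sum>j\<in>?G. hinner X (y i) (\<rho> (h i j) (y j)))"
      unfolding sum_insert_square[OF fin kF] by (simp add: h_row h_col rho_inner_zero y)
    obtain s where s: "q = star s * s" using q(1) by (auto simp: positive_element_def)
    have "u i k * q * u k j = star (s * u k i) * (s * u k j)" for i j
      by (simp add: s star_mult star_star u_star[of k i] mult.assoc)
    then have "hinner X (y i) (\<rho> (u i k * q * u k j) (y j))
        = hinner X (\<rho> (s * u k i) (y i)) (\<rho> (s * u k j) (y j))" for i j
      using y by (simp add: rho_mult[of _ "star (s * u k i)" "s * u k j"] rho_adjoint rho_closed)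
    then have part2: "positive_element (\<Sum>i\<in>?G. \<Sum>j\<in>?G. hinner X (y i) (\<rho> (u i k * q * u k j) (y j)))"
      using fin y by (simp only:) (intro positive_gram_sum, auto intro: rho_closed)
    have "hinner X (y i) (\<rho> (u i j) (y j))
        = hinner X (y i) (\<rho> (h i j) (y j)) + hinner X (y i) (\<rho> (u i k * q * u k j) (y j))" for i j
      using rho_inner_add[OF y y, of i "h i j" "u i k * q * u k j" j] by (simp add: h_def)
    then have "positive_element (\<Sum>i\<in>?G. \<Sum>j\<in>?G. hinner X (y i) (\<rho> (u i j) (y j)))"
      using positive_add[OF part1 part2] by (simp only: sum.distrib)
    moreover have "(\<Sum>i\<in>?G. \<Sum>j\<in>?G. hinner X (y i) (\<rho> (u i j) (y j)))
        = (\<Sum>i\<in>?G. \<Sum>j\<in>?G. hinner X (y i) (\<rho> (g i j) (y j))) + e *\<^sub>R hinner X (y k) (y k)"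
    proof -
      have off: "u i j = g i j" if "i \<in> F \<or> j \<in> F" for i j
        using that kF by (auto simp: u_def)
      have "hinner X (y k) (\<rho> (u k k) (y k))
          = hinner X (y k) (\<rho> ?p (y k)) + e *\<^sub>R hinner X (y k) (y k)"
        using y by (simp add: u_kk rho_inner_add rho_inner_scaleR rho_one)
      then show ?thesis
        unfolding sum_insert_square[OF fin kF] by (simp add: off cong: sum.cong)
    qed
    ultimately show ?thesis by simp
  qed
  let ?S = "\<Sum>i\<in>?G. \<Sum>j\<in>?G. hinner X (y i) (\<rho> (g i j) (y j))"
  have "(\<lambda>n. ?S + inverse (real (Suc n)) *\<^sub>R hinner X (y k) (y k)) \<longlonglongrightarrow> ?S + 0 *\<^sub>R hinner X (y k) (y k)"
    by (intro tendsto_intros LIMSEQ_inverse_real_of_nat)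
  then have "positive_element (?S + 0 *\<^sub>R hinner X (y k) (y k))"
    by (rule positive_limit) (auto intro!: always_eventually shifted)
  then show ?case by simp
qed

end

text \<open>
  The pair \<open>(x1, x2)\<close> names the elementary tensor of \<open>x1\<close> and \<open>x2\<close> in the tensor product of \<open>X1\<close> and
  \<open>X2\<close> over \<open>\<rho>2\<close>, in which \<open>(x1 a) \<otimes> x2 = x1 \<otimes> \<rho>2(a) x2\<close>. The algebra acts by \<open>\<rho>1\<close> on the first factor.
\<close>

locale equivariant_rep_pair =
  left: equivariant_rep \<alpha> \<sigma> X1 \<rho>1 v1 + right: equivariant_rep \<alpha> \<sigma> X2 \<rho>2 v2
  for \<alpha> :: "'g::group_add \<Rightarrow> 'a::cstar_algebra \<Rightarrow> 'a"
    and \<sigma> :: "'g \<Rightarrow> 'g \<Rightarrow> 'a"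
    and X1 :: "('x, 'a) hmodule" and \<rho>1 v1
    and X2 :: "('y, 'a) hmodule" and \<rho>2 v2
begin

definition tensor_kernel :: "'x \<times> 'y \<Rightarrow> 'x \<times> 'y \<Rightarrow> 'a" where
  "tensor_kernel = (\<lambda>(x1, x2) (y1, y2).
    hinner X2 (right.proj x2) (\<rho>2 (hinner X1 (left.proj x1) (left.proj y1)) (right.proj y2)))"

definition tensor_rho :: "'a \<Rightarrow> 'x \<times> 'y \<Rightarrow> 'x \<times> 'y" where
  "tensor_rho a = (\<lambda>(x1, x2). (\<rho>1 a (left.proj x1), x2))"

definition tensor_v :: "'g \<Rightarrow> 'x \<times> 'y \<Rightarrow> 'x \<times> 'y" where
  "tensor_v g = (\<lambda>(x1, x2). (v1 g (left.proj x1), v2 g (right.proj x2)))"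

definition tensor_w :: "'g \<Rightarrow> 'x \<times> 'y \<Rightarrow> 'x \<times> 'y" where
  "tensor_w g = (\<lambda>(x1, x2). (left.v_inv g (left.proj x1), right.v_inv g (right.proj x2)))"

lemma positive_tensor_kernel: "positive_kernel tensor_kernel"
proof (rule positive_kernelI)
  show "tensor_kernel t s = star (tensor_kernel s t)" for s t
  proof (cases s; cases t)
    fix x1 x2 y1 y2 assume st: "s = (x1, x2)" "t = (y1, y2)"
    let ?x1 = "left.proj x1" and ?y1 = "left.proj y1"
    let ?x2 = "right.proj x2" and ?y2 = "right.proj y2"
    have "star (hinner X2 ?x2 (\<rho>2 (hinner X1 ?x1 ?y1) ?y2))
        = hinner X2 (\<rho>2 (hinner X1 ?x1 ?y1) ?y2) ?x2"
      by (rule right.inner_star[symmetric]) (simp_all add: right.rho_closed)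
    also have "\<dots> = hinner X2 ?y2 (\<rho>2 (star (hinner X1 ?x1 ?y1)) ?x2)"
      by (simp add: right.rho_adjoint)
    also have "star (hinner X1 ?x1 ?y1) = hinner X1 ?y1 ?x1"
      by (rule left.inner_star[symmetric]) simp_all
    finally show ?thesis by (simp add: st tensor_kernel_def)
  qed
  fix I :: "nat set" and s :: "nat \<Rightarrow> 'x \<times> 'y" and a :: "nat \<Rightarrow> 'a"
  assume I: "finite I"
  define x where "x i = left.proj (fst (s i))" for i
  define z where "z i = right.proj (snd (s i))" for i
  define y where "y i = hact X2 (z i) (a i)" for i
  have x: "x i \<in> vecs X1" and z: "z i \<in> vecs X2" and y: "y i \<in> vecs X2" for i
    by (simp_all add: x_def y_def z_def right.act_closed)
  have "star (a i) * tensor_kernel (s i) (s j) * a j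
      = hinner X2 (y i) (\<rho>2 (hinner X1 (x i) (x j)) (y j))" for i j
  proof -
    have "tensor_kernel (s i) (s j) = hinner X2 (z i) (\<rho>2 (hinner X1 (x i) (x j)) (z j))"
      by (simp add: tensor_kernel_def split_def x_def z_def)
    moreover have "hinner X2 (y i) (\<rho>2 (hinner X1 (x i) (x j)) (y j))
        = star (a i) * hinner X2 (z i) (\<rho>2 (hinner X1 (x i) (x j)) (y j))"
      unfolding y_def[of i] by (intro right.inner_act_left right.rho_closed y z)
    ultimately show ?thesis by (simp add: y_def[of j] right.rho_inner_act z mult.assoc)
  qed
  moreover have "positive_element (\<Sum>i\<in>I. \<Sum>j\<in>I. hinner X2 (y i) (\<rho>2 (hinner X1 (x i) (x j)) (y j)))"
  proof (rule right.positive_matrix_form[OF I])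
    show "hinner X1 (x j) (x i) = star (hinner X1 (x i) (x j))" for i j
      by (rule left.inner_star[OF x x])
    show "positive_element (\<Sum>i\<in>I. \<Sum>j\<in>I. star (c i) * hinner X1 (x i) (x j) * c j)" for c
    proof -
      have "star (c i) * hinner X1 (x i) (x j) * c j = hinner X1 (hact X1 (x i) (c i)) (hact X1 (x j) (c j))"
        for i j
        by (simp add: left.inner_act_left left.inner_act left.act_closed x mult.assoc)
      then show ?thesis
        using left.positive_gram_sum[OF I, of "\<lambda>i. hact X1 (x i) (c i)"] by (simp add: left.act_closed x)
    qed
  qed (rule y)
  ultimately show "positive_element (\<Sum>i\<in>I. \<Sum>j\<in>I. star (a i) * tensor_kernel (s i) (s j) * a j)"
    by simp
qed

sublocale tensor: equivariant_kernel \<alpha> \<sigma> tensor_kernel tensor_rho tensor_v tensor_w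
proof (intro equivariant_kernel.intro left.twisted_system_axioms positive_tensor_kernel
    equivariant_kernel_axioms.intro)
  fix s t :: "'x \<times> 'y" and a b g h and c :: complex
  obtain x1 x2 y1 y2 where st: "s = (x1, x2)" "t = (y1, y2)" by (cases s, cases t) auto
  note simps = st tensor_kernel_def tensor_rho_def tensor_v_def tensor_w_def
    left.rho_closed left.v_closed left.v_inv_closed right.rho_closed right.v_closed right.v_inv_closed
  show "tensor_kernel (tensor_rho a s) t = tensor_kernel s (tensor_rho (star a) t)"
    by (simp add: simps left.rho_adjoint)
  show "tensor_kernel s (tensor_rho (a + b) t)
      = tensor_kernel s (tensor_rho a t) + tensor_kernel s (tensor_rho b t)"
    by (simp add: simps left.rho_add left.inner_add left.add_closed right.rho_inner_add)
  show "tensor_kernel s (tensor_rho (c *\<^sub>C a) t) = c *\<^sub>C tensor_kernel s (tensor_rho a t)"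
    by (simp add: simps left.rho_scale left.inner_scale left.scale_closed right.rho_scale
        right.inner_scale)
  show "tensor_kernel s (tensor_rho (a * b) t) = tensor_kernel s (tensor_rho a (tensor_rho b t))"
    by (simp add: simps left.rho_mult)
  show "tensor_kernel s (tensor_rho 1 t) = tensor_kernel s t"
    by (simp add: simps left.rho_one)
  show "tensor_kernel (tensor_v g s) (tensor_v g t) = \<alpha> g (tensor_kernel s t)"
    by (simp add: simps left.alpha_inner[symmetric] right.v_rho[symmetric] right.alpha_inner)
  show "tensor_kernel s (tensor_v g (tensor_w g t)) = tensor_kernel s t"
    by (simp add: simps left.v_v_inv right.v_v_inv)
  show "tensor_kernel s (tensor_v g (tensor_rho a (tensor_w g t)))
      = tensor_kernel s (tensor_rho (\<alpha> g a) t)"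
    by (simp add: simps left.v_rho left.v_v_inv right.v_v_inv)
  show "tensor_kernel s (tensor_v g (tensor_v h t))
      = tensor_kernel s (tensor_rho (\<sigma> g h) (tensor_v (g + h) t)) * star (\<sigma> g h)"
  proof -
    have u: "star (\<sigma> g h) * \<sigma> g h = 1"
      using left.sigma_unitary[of g h] by (simp add: unitary_element_def)
    \<comment> \<open>The cocycle of the first factor, moved across the tensor sign, cancels the cocycle on the
      left of the second factor.\<close>
    have "\<rho>2 (d * star (\<sigma> g h)) (\<rho>2 (\<sigma> g h) z) = \<rho>2 d z" if "z \<in> vecs X2" for d z
      using that right.rho_mult[of z "d * star (\<sigma> g h)" "\<sigma> g h"] by (simp add: mult.assoc u)
    then show ?thesis
      by (simp add: simps left.v_v right.v_v left.inner_act left.act_closed right.act_closed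
          right.rho_inner_act)
  qed
qed

text \<open>
  For elementary tensors \<open>\<langle>x1 \<otimes> x2, \<rho>1(a) v1(g) y1 \<otimes> v2(g) y2\<rangle> = \<langle>x2, \<rho>2(\<langle>x1, \<rho>1(a) v1(g) y1\<rangle>) v2(g) y2\<rangle>\<close>,
  and this is one coefficient function applied to the value of the other.
\<close>

theorem tensor_decomposition:
  assumes x1: "x1 \<in> vecs X1" "y1 \<in> vecs X1" and x2: "x2 \<in> vecs X2" "y2 \<in> vecs X2"
  obtains f h where "decomposition \<alpha> \<sigma> tensor.kernel_module tensor.R tensor.V f h
      (L_mult (coefficient_map X2 \<rho>2 v2 x2 y2) (coefficient_map X1 \<rho>1 v1 x1 y1))"
    "hnorm tensor.kernel_module f \<le> hnorm X1 x1 * hnorm X2 x2"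
    "hnorm tensor.kernel_module h \<le> hnorm X1 y1 * hnorm X2 y2"
proof -
  let ?f = "tensor.generator (x1, x2)" and ?h = "tensor.generator (y1, y2)"
  have "L_mult (coefficient_map X2 \<rho>2 v2 x2 y2) (coefficient_map X1 \<rho>1 v1 x1 y1)
      = coefficient_map tensor.kernel_module tensor.R tensor.V ?f ?h"
    unfolding fun_eq_iff tensor.generator_coefficient
    using assms by (simp add: L_mult_def coefficient_map_def tensor_kernel_def tensor_rho_def
        tensor_v_def left.rho_closed left.v_closed right.v_closed)
  then have "decomposition \<alpha> \<sigma> tensor.kernel_module tensor.R tensor.V ?f ?h
      (L_mult (coefficient_map X2 \<rho>2 v2 x2 y2) (coefficient_map X1 \<rho>1 v1 x1 y1))"
    by (simp add: decomposition_def tensor.kernel_representation)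
  moreover have "hnorm tensor.kernel_module (tensor.generator (z1, z2)) \<le> hnorm X1 z1 * hnorm X2 z2"
    if "z1 \<in> vecs X1" "z2 \<in> vecs X2" for z1 z2
  proof -
    have "(hnorm tensor.kernel_module (tensor.generator (z1, z2)))\<^sup>2
        = norm (hinner X2 z2 (\<rho>2 (hinner X1 z1 z1) z2))"
      unfolding tensor.generator_norm using that by (simp add: tensor_kernel_def)
    also have "\<dots> \<le> hnorm X2 z2 * hnorm X2 (\<rho>2 (hinner X1 z1 z1) z2)"
      using that by (intro right.cauchy_schwarz right.rho_closed)
    also have "\<dots> \<le> hnorm X2 z2 * (norm (hinner X1 z1 z1) * hnorm X2 z2)"
      using that by (intro mult_left_mono right.rho_norm) auto
    also have "\<dots> = (hnorm X1 z1 * hnorm X2 z2)\<^sup>2"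
      by (simp add: hnorm_square[symmetric] power2_eq_square mult_ac)
    finally show ?thesis by (rule power2_le_imp_le) simp
  qed
  ultimately show thesis using that assms by blast
qed

end


section \<open>The trivial representation\<close>

text \<open>
  The algebra is a Hilbert module over itself, on which \<open>\<alpha>\<close> acts. The coefficient function of the
  unit vector is \<open>L_one\<close>.
\<close>

definition trivial_module :: "('a, 'a::cstar_algebra) hmodule" where
  "trivial_module = \<lparr>vecs = UNIV, hadd = (+), hzero = 0, hscale = scaleC, hact = (*),
    hinner = (\<lambda>x y. star x * y)\<rparr>"

lemma trivial_module_simps [simp]:
  "vecs trivial_module = UNIV" "hadd trivial_module = (+)" "hzero trivial_module = 0"
  "hscale trivial_module = scaleC" "hact trivial_module = (*)"
  "hinner trivial_module = (\<lambda>x y. star x * y)" "hnorm trivial_module = norm"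
  by (simp_all add: trivial_module_def hnorm_def cstar_identity fun_eq_iff)

lemma hilbert_trivial_module: "hilbert_module (trivial_module :: ('a, 'a::cstar_algebra) hmodule)"
proof (rule hilbert_module.intro)
  show "cvector_space_on (vecs (trivial_module :: ('a, 'a) hmodule)) (hadd trivial_module)
    (hzero trivial_module) (hscale trivial_module)"
  proof
    fix x :: 'a
    show "\<exists>y\<in>vecs trivial_module. hadd trivial_module x y = hzero trivial_module"
      by (intro bexI[of _ "- x"]) simp_all
  qed (simp_all add: algebra_simps scaleC_add_left scaleC_add_right scaleC_scaleC)
  have complete: "complete_on (vecs trivial_module) (hadd trivial_module) (hscale trivial_module)
      (hnorm (trivial_module :: ('a, 'a) hmodule))"
    unfolding complete_on_def trivial_module_simps
  proof (intro allI impI)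
    fix f :: "nat \<Rightarrow> 'a"
    assume "(\<forall>n. f n \<in> UNIV) \<and> (\<forall>e>0. \<exists>n\<^sub>0. \<forall>m\<ge>n\<^sub>0. \<forall>n\<ge>n\<^sub>0. norm (f m + - 1 *\<^sub>C f n) < e)"
    then have "Cauchy f" by (simp add: Cauchy_iff)
    then obtain l where "f \<longlonglongrightarrow> l" using Cauchy_convergent_iff convergent_def by blast
    then have "(\<lambda>n. norm (f n - l)) \<longlonglongrightarrow> 0" by (simp add: tendsto_norm_zero LIM_zero)
    then show "\<exists>l\<in>UNIV. (\<lambda>n. norm (f n + - 1 *\<^sub>C l)) \<longlonglongrightarrow> 0" by auto
  qed
  show "hilbert_module_axioms (trivial_module :: ('a, 'a) hmodule)"
  proof
    fix x :: 'a assume "hinner trivial_module x x = 0"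
    then show "x = hzero trivial_module" using cstar_identity[of x] by simp
  qed (use complete in \<open>simp_all add: algebra_simps mult_scaleC_left mult_scaleC_right star_mult
      star_star\<close>)
qed

lemma (in twisted_system) trivial_representation:
  "equivariant_rep \<alpha> \<sigma> trivial_module (*) \<alpha>"
proof (intro equivariant_rep.intro twisted_system_axioms hilbert_trivial_module
    equivariant_rep_axioms.intro)
  have adj: "adjoint_pair trivial_module ((*) a) ((*) (star a))" for a :: 'a
    by (simp add: adjoint_pair_def star_mult mult.assoc)
  then have "(*) a \<in> adjointable trivial_module" for a :: 'a
    by (auto simp: adjointable_def)
  with adj show "adjointable_rep trivial_module ((*) :: 'a \<Rightarrow> 'a \<Rightarrow> 'a)"
    by (simp add: adjointable_rep_def algebra_simps mult_scaleC_left)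
  show "bounded_invertible trivial_module (\<alpha> g)" for g
    unfolding bounded_invertible_def
    using alpha_bij[of g] by (auto simp: alpha_add alpha_scale alpha_norm inv_alpha_norm intro: exI[of _ 1])
qed (simp_all add: alpha_mult alpha_star alpha_alpha mult.assoc)

section \<open>The norm of the Fourier-Stieltjes algebra\<close>

text \<open>
  Rescaling one vector against the other makes the two norms in a decomposition equal, so that the
  infimum of \<open>hnorm x * hnorm y\<close> is governed by decompositions for which the squares of both norms
  are at most \<open>r\<close>. These bounds are additive under direct sums.
\<close>

definition bounded_coefficient :: "('g::group_add \<Rightarrow> 'a::cstar_algebra \<Rightarrow> 'a) \<Rightarrow> ('g \<Rightarrow> 'g \<Rightarrow> 'a)
    \<Rightarrow> real \<Rightarrow> ('g \<Rightarrow> 'a \<Rightarrow> 'a) \<Rightarrow> bool" where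
  "bounded_coefficient \<alpha> \<sigma> r T \<longleftrightarrow>
     (\<exists>(X :: (('g, 'a) rep_term, 'a) hmodule) \<rho> v x y. decomposition \<alpha> \<sigma> X \<rho> v x y T
        \<and> (hnorm X x)\<^sup>2 \<le> r \<and> (hnorm X y)\<^sup>2 \<le> r)"

lemma decomposition_in_fs:
  assumes "decomposition \<alpha> \<sigma> X \<rho> v x y T"
  shows "T \<in> fourier_stieltjes \<alpha> \<sigma>"
  using equivariant_rep_on_rep_terms[OF assms] unfolding fourier_stieltjes_def by blast

lemma decomposition_scale:
  assumes "decomposition \<alpha> \<sigma> X \<rho> v x y T"
  shows "decomposition \<alpha> \<sigma> X \<rho> v (hscale X b x) (hscale X c y) (L_scale (cnj b * c) T)"
proof -
  interpret equivariant_rep \<alpha> \<sigma> X \<rho> v using assms by (simp add: decomposition_def)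
  have xy: "x \<in> vecs X" "y \<in> vecs X" and T: "T = coefficient_map X \<rho> v x y"
    using assms by (auto simp: decomposition_def)
  have act: "hscale X d z = hact X z (d *\<^sub>C 1)" if "z \<in> vecs X" for d z
    using that by (simp add: act_scale_right act_one)
  have rho_lin: "hinner X x (\<rho> a (hact X z (c *\<^sub>C 1))) = hinner X x (\<rho> a z) * (c *\<^sub>C 1)"
    if "z \<in> vecs X" for a z
    using that xy by (intro rho_inner_act)
  have "hinner X (hscale X b x) (\<rho> a (v g (hscale X c y))) = (cnj b * c) *\<^sub>C hinner X x (\<rho> a (v g y))"
    for g a
    using xy by (simp add: v_scale act[of "v g y"] act[of x] v_closed rho_lin inner_act_left rho_closed
        act_closed star_scaleC mult_scaleC_left mult_scaleC_right scaleC_scaleC mult.commute)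
  then show ?thesis
    using xy assms by (auto simp: decomposition_def T coefficient_map_def L_scale_def fun_eq_iff
        intro: scale_closed)
qed

lemma decomposition_norm_le:
  assumes "decomposition \<alpha> \<sigma> X \<rho> v x y T"
  shows "norm (T g a) \<le> norm a * (hnorm X x * hnorm X y)"
  using assms equivariant_rep.coefficient_norm_le by (auto simp: decomposition_def)

lemma fs_norm_le:
  fixes \<alpha> :: "'g::group_add \<Rightarrow> 'a::cstar_algebra \<Rightarrow> 'a"
  assumes "decomposition \<alpha> \<sigma> X \<rho> v x y T"
  shows "fs_norm \<alpha> \<sigma> T \<le> hnorm X x * hnorm X y"
proof -
  obtain X' :: "(('g, 'a) rep_term, 'a) hmodule" and \<rho>' v' x' y' where d:
    "decomposition \<alpha> \<sigma> X' \<rho>' v' x' y' T" "hnorm X' x' = hnorm X x" "hnorm X' y' = hnorm X y"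
    using equivariant_rep_on_rep_terms[OF assms] by metis
  let ?S = "{hnorm X x * hnorm X y | (X :: (('g, 'a) rep_term, 'a) hmodule) \<rho> v x y.
     decomposition \<alpha> \<sigma> X \<rho> v x y T}"
  have "hnorm X' x' * hnorm X' y' \<in> ?S" using d(1) by blast
  moreover have "bdd_below ?S" by (auto simp: bdd_below_def intro!: exI[of _ 0] mult_nonneg_nonneg)
  ultimately have "fs_norm \<alpha> \<sigma> T \<le> hnorm X' x' * hnorm X' y'"
    unfolding fs_norm_def by (rule cInf_lower)
  then show ?thesis by (simp add: d)
qed

lemma fs_norm_nonneg: "T \<in> fourier_stieltjes \<alpha> \<sigma> \<Longrightarrow> 0 \<le> fs_norm \<alpha> \<sigma> T"
  unfolding fs_norm_def fourier_stieltjes_def by (intro cInf_greatest) auto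

lemma fs_norm_near:
  fixes \<alpha> :: "'g::group_add \<Rightarrow> 'a::cstar_algebra \<Rightarrow> 'a"
  assumes "T \<in> fourier_stieltjes \<alpha> \<sigma>" "fs_norm \<alpha> \<sigma> T < r"
  obtains X :: "(('g, 'a) rep_term, 'a) hmodule" and \<rho> v x y
  where "decomposition \<alpha> \<sigma> X \<rho> v x y T" "hnorm X x * hnorm X y < r"
proof -
  have "\<exists>s\<in>{hnorm X x * hnorm X y | (X :: (('g, 'a) rep_term, 'a) hmodule) \<rho> v x y.
     decomposition \<alpha> \<sigma> X \<rho> v x y T}. s < r"
    using assms unfolding fs_norm_def fourier_stieltjes_def by (intro cInf_lessD) auto
  then show thesis using that by auto
qed

lemma fs_norm_bound:
  fixes \<alpha> :: "'g::group_add \<Rightarrow> 'a::cstar_algebra \<Rightarrow> 'a"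
  assumes "T \<in> fourier_stieltjes \<alpha> \<sigma>"
  shows "norm (T g a) \<le> norm a * fs_norm \<alpha> \<sigma> T"
proof (rule field_le_epsilon)
  fix e :: real assume e: "0 < e"
  have n: "0 < norm a + 1" by (simp add: add_nonneg_pos)
  obtain X :: "(('g, 'a) rep_term, 'a) hmodule" and \<rho> v x y where d:
    "decomposition \<alpha> \<sigma> X \<rho> v x y T" "hnorm X x * hnorm X y < fs_norm \<alpha> \<sigma> T + e / (norm a + 1)"
  proof (rule fs_norm_near[OF assms])
    show "fs_norm \<alpha> \<sigma> T < fs_norm \<alpha> \<sigma> T + e / (norm a + 1)" using e n by simp
  qed blast
  have "norm (T g a) \<le> norm a * (fs_norm \<alpha> \<sigma> T + e / (norm a + 1))"
    using decomposition_norm_le[OF d(1), of g a] d(2)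
    by (meson less_imp_le mult_left_mono norm_ge_zero order_trans)
  also have "\<dots> = norm a * fs_norm \<alpha> \<sigma> T + e * (norm a / (norm a + 1))"
    by (simp add: algebra_simps)
  also have "e * (norm a / (norm a + 1)) \<le> e * 1"
    using e n by (intro mult_left_mono) auto
  finally show "norm (T g a) \<le> norm a * fs_norm \<alpha> \<sigma> T + e" by simp
qed

lemma bounded_coefficientI:
  assumes "decomposition \<alpha> \<sigma> X \<rho> v x y T" "(hnorm X x)\<^sup>2 \<le> r" "(hnorm X y)\<^sup>2 \<le> r"
  shows "bounded_coefficient \<alpha> \<sigma> r T"
  using equivariant_rep_on_rep_terms[OF assms(1)] assms(2,3)
  unfolding bounded_coefficient_def by metis

lemma bounded_coefficientD:
  fixes \<alpha> :: "'g::group_add \<Rightarrow> 'a::cstar_algebra \<Rightarrow> 'a"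
  assumes "bounded_coefficient \<alpha> \<sigma> r T"
  shows "T \<in> fourier_stieltjes \<alpha> \<sigma>" "fs_norm \<alpha> \<sigma> T \<le> r"
proof -
  obtain X :: "(('g, 'a) rep_term, 'a) hmodule" and \<rho> v x y where d:
    "decomposition \<alpha> \<sigma> X \<rho> v x y T" "(hnorm X x)\<^sup>2 \<le> r" "(hnorm X y)\<^sup>2 \<le> r"
    using assms unfolding bounded_coefficient_def by blast
  show "T \<in> fourier_stieltjes \<alpha> \<sigma>" by (rule decomposition_in_fs[OF d(1)])
  have "fs_norm \<alpha> \<sigma> T \<le> hnorm X x * hnorm X y" by (rule fs_norm_le[OF d(1)])
  also have "\<dots> \<le> ((hnorm X x)\<^sup>2 + (hnorm X y)\<^sup>2) / 2"
    using sum_squares_bound[of "hnorm X x" "hnorm X y"] by simp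
  finally show "fs_norm \<alpha> \<sigma> T \<le> r" using d by simp
qed

context twisted_system
begin

lemma bounded_zero: "bounded_coefficient \<alpha> \<sigma> 0 L_zero"
proof (rule bounded_coefficientI)
  show "decomposition \<alpha> \<sigma> trivial_module (*) \<alpha> 0 0 L_zero"
    by (simp add: decomposition_def trivial_representation coefficient_map_def L_zero_def)
qed simp_all

lemma bounded_one: "bounded_coefficient \<alpha> \<sigma> 1 L_one"
proof (rule bounded_coefficientI)
  show "decomposition \<alpha> \<sigma> trivial_module (*) \<alpha> 1 1 L_one"
    by (simp add: decomposition_def trivial_representation coefficient_map_def L_one_def alpha_one)
qed (simp_all add: norm_one_le power_le_one)

lemma bounded_if_norm_less:
  assumes T: "T \<in> fourier_stieltjes \<alpha> \<sigma>" "fs_norm \<alpha> \<sigma> T < r"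
  shows "bounded_coefficient \<alpha> \<sigma> r T"
proof -
  obtain X :: "(('g, 'a) rep_term, 'a) hmodule" and \<rho> v x y where d:
    "decomposition \<alpha> \<sigma> X \<rho> v x y T" "hnorm X x * hnorm X y < r"
    by (rule fs_norm_near[OF T])
  interpret equivariant_rep \<alpha> \<sigma> X \<rho> v using d(1) by (simp add: decomposition_def)
  have xy: "x \<in> vecs X" "y \<in> vecs X" using d(1) by (auto simp: decomposition_def)
  have r: "0 < r" using d(2) by (smt (verit) hnorm_nonneg mult_nonneg_nonneg)
  show ?thesis
  proof (cases "hnorm X x = 0 \<or> hnorm X y = 0")
    case True
    then have "norm (T g a) \<le> 0" for g a using decomposition_norm_le[OF d(1), of g a] by auto
    then have "T = L_zero" by (simp add: L_zero_def fun_eq_iff)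
    then show ?thesis
      using bounded_zero r unfolding bounded_coefficient_def by (meson less_imp_le order_trans)
  next
    case False
    then have pos: "0 < hnorm X x" "0 < hnorm X y"
      using hnorm_nonneg[of X x] hnorm_nonneg[of X y] by linarith+
    \<comment> \<open>\<open>c * x\<close> and \<open>y / c\<close> have equal norms.\<close>
    define c where "c = sqrt (hnorm X y / hnorm X x)"
    have c: "0 < c" "c\<^sup>2 = hnorm X y / hnorm X x" using pos by (simp_all add: c_def)
    have dec: "decomposition \<alpha> \<sigma> X \<rho> v (hscale X (complex_of_real c) x)
        (hscale X (complex_of_real (1 / c)) y) T"
      using decomposition_scale[OF d(1), of "complex_of_real c" "complex_of_real (1 / c)"] c
      by (simp add: L_scale_def)
    have "(hnorm X (hscale X (complex_of_real c) x))\<^sup>2 = hnorm X x * hnorm X y"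
      using pos xy by (simp add: hnorm_scale power_mult_distrib c(2)) (simp add: power2_eq_square)
    moreover have "(hnorm X (hscale X (complex_of_real (1 / c)) y))\<^sup>2 = hnorm X x * hnorm X y"
      using pos xy c(1) by (simp add: hnorm_scale norm_divide power_mult_distrib power_divide c(2))
        (simp add: power2_eq_square)
    ultimately show ?thesis
      using d(2) by (intro bounded_coefficientI[OF dec]) simp_all
  qed
qed

text \<open>
  The direct sum of the representations, with squared norms of the summands dominated by \<open>r n\<close>. Both
  the triangle inequality and completeness are consequences.
\<close>

theorem bounded_series:
  assumes T: "\<And>n. bounded_coefficient \<alpha> \<sigma> (r n) (T n)" and r: "summable r"
  obtains S where "bounded_coefficient \<alpha> \<sigma> (suminf r) S" "\<And>g a. (\<lambda>n. T n g a) sums S g a"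
proof -
  have "\<forall>n. \<exists>(X :: (('g, 'a) rep_term, 'a) hmodule) \<rho> v x y. decomposition \<alpha> \<sigma> X \<rho> v x y (T n)
        \<and> (hnorm X x)\<^sup>2 \<le> r n \<and> (hnorm X y)\<^sup>2 \<le> r n"
    using T by (simp add: bounded_coefficient_def)
  then obtain X :: "nat \<Rightarrow> (('g, 'a) rep_term, 'a) hmodule" and \<rho> v x y where d:
    "\<And>n. decomposition \<alpha> \<sigma> (X n) (\<rho> n) (v n) (x n) (y n) (T n)"
    "\<And>n. (hnorm (X n) (x n))\<^sup>2 \<le> r n" "\<And>n. (hnorm (X n) (y n))\<^sup>2 \<le> r n"
    by metis
  interpret equivariant_rep_sequence \<alpha> \<sigma> X \<rho> v
    using d(1) by (intro equivariant_rep_sequence.intro) (simp add: decomposition_def)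
  have xy: "x n \<in> vecs (X n)" "y n \<in> vecs (X n)" "T n = coefficient_map (X n) (\<rho> n) (v n) (x n) (y n)"
    for n
    using d(1)[of n] by (auto simp: decomposition_def)
  have sx: "summable (\<lambda>n. (hnorm (X n) (x n))\<^sup>2)" and sy: "summable (\<lambda>n. (hnorm (X n) (y n))\<^sup>2)"
    by (rule summable_comparison_test'[OF r, of 0]; use d(2,3) in simp)+
  obtain f h S where S: "decomposition \<alpha> \<sigma> sum.kernel_module sum.R sum.V f h S"
    "(hnorm sum.kernel_module f)\<^sup>2 \<le> (\<Sum>n. (hnorm (X n) (x n))\<^sup>2)"
    "(hnorm sum.kernel_module h)\<^sup>2 \<le> (\<Sum>n. (hnorm (X n) (y n))\<^sup>2)"
    "\<And>g a. (\<lambda>n. coefficient_map (X n) (\<rho> n) (v n) (x n) (y n) g a) sums S g a"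
    using direct_sum_decomposition[of x y, OF xy(1,2) sx sy] by blast
  have "(\<Sum>n. (hnorm (X n) (x n))\<^sup>2) \<le> suminf r" "(\<Sum>n. (hnorm (X n) (y n))\<^sup>2) \<le> suminf r"
    using d(2,3) sx sy r by (auto intro: suminf_le)
  then have "bounded_coefficient \<alpha> \<sigma> (suminf r) S"
    using S(2,3) by (intro bounded_coefficientI[OF S(1)]) linarith+
  moreover have "(\<lambda>n. T n g a) sums S g a" for g a using S(4) by (simp add: xy(3))
  ultimately show thesis by (rule that)
qed

lemma bounded_add:
  assumes "bounded_coefficient \<alpha> \<sigma> r T" "bounded_coefficient \<alpha> \<sigma> s S"
  shows "bounded_coefficient \<alpha> \<sigma> (r + s) (L_add T S)"
proof -
  define U where "U n = (if n = 0 then T else if n = 1 then S else L_zero)" for n :: nat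
  define q where "q n = (if n = 0 then r else if n = 1 then s else 0)" for n :: nat
  have "bounded_coefficient \<alpha> \<sigma> (q n) (U n)" for n
    using assms bounded_zero by (simp add: U_def q_def)
  moreover have q: "q sums (\<Sum>n<2. q n)" by (rule sums_finite) (auto simp: q_def)
  then have "summable q" by (simp add: sums_iff)
  ultimately obtain R where R: "bounded_coefficient \<alpha> \<sigma> (suminf q) R"
    "\<And>g a. (\<lambda>n. U n g a) sums R g a"
    by (rule bounded_series) blast
  have "(\<lambda>n. U n g a) sums (\<Sum>n<2. U n g a)" for g a
    by (rule sums_finite) (auto simp: U_def L_zero_def)
  then have "(\<lambda>n. U n g a) sums (T g a + S g a)" for g a
    by (simp add: numeral_2_eq_2 U_def)
  then have "R = L_add T S"
    using R(2) sums_unique2 by (fastforce simp: L_add_def fun_eq_iff)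
  moreover have "suminf q = r + s" using q by (simp add: sums_iff numeral_2_eq_2 q_def)
  ultimately show ?thesis using R(1) by simp
qed

lemma fs_add:
  assumes "T \<in> fourier_stieltjes \<alpha> \<sigma>" "S \<in> fourier_stieltjes \<alpha> \<sigma>"
  shows "L_add T S \<in> fourier_stieltjes \<alpha> \<sigma>"
    and "fs_norm \<alpha> \<sigma> (L_add T S) \<le> fs_norm \<alpha> \<sigma> T + fs_norm \<alpha> \<sigma> S"
proof -
  have b: "bounded_coefficient \<alpha> \<sigma> ((fs_norm \<alpha> \<sigma> T + e / 2) + (fs_norm \<alpha> \<sigma> S + e / 2)) (L_add T S)"
    if "0 < e" for e
    using that by (intro bounded_add bounded_if_norm_less assms) auto
  show "L_add T S \<in> fourier_stieltjes \<alpha> \<sigma>" using bounded_coefficientD(1)[OF b[of 1]] by simp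
  show "fs_norm \<alpha> \<sigma> (L_add T S) \<le> fs_norm \<alpha> \<sigma> T + fs_norm \<alpha> \<sigma> S"
    by (rule field_le_epsilon) (use bounded_coefficientD(2)[OF b] in \<open>simp add: add_ac\<close>)
qed

lemma fs_zero: "L_zero \<in> fourier_stieltjes \<alpha> \<sigma>" "fs_norm \<alpha> \<sigma> L_zero = 0"
  using bounded_coefficientD[OF bounded_zero] fs_norm_nonneg[of L_zero \<alpha> \<sigma>] by auto

lemma fs_scale_le:
  assumes "T \<in> fourier_stieltjes \<alpha> \<sigma>"
  shows "L_scale c T \<in> fourier_stieltjes \<alpha> \<sigma>"
    and "fs_norm \<alpha> \<sigma> (L_scale c T) \<le> cmod c * fs_norm \<alpha> \<sigma> T"
proof -
  have *: "L_scale c T \<in> fourier_stieltjes \<alpha> \<sigma> \<and> fs_norm \<alpha> \<sigma> (L_scale c T) \<le> cmod c * s"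
    if s: "fs_norm \<alpha> \<sigma> T < s" for s
  proof -
    obtain X :: "(('g, 'a) rep_term, 'a) hmodule" and \<rho> v x y where d:
      "decomposition \<alpha> \<sigma> X \<rho> v x y T" "hnorm X x * hnorm X y < s"
      by (rule fs_norm_near[OF assms s])
    interpret equivariant_rep \<alpha> \<sigma> X \<rho> v using d(1) by (simp add: decomposition_def)
    have xy: "x \<in> vecs X" "y \<in> vecs X" using d(1) by (auto simp: decomposition_def)
    have dec: "decomposition \<alpha> \<sigma> X \<rho> v x (hscale X c y) (L_scale c T)"
      using decomposition_scale[OF d(1), of 1 c] xy by (simp add: scale_one)
    have "fs_norm \<alpha> \<sigma> (L_scale c T) \<le> cmod c * (hnorm X x * hnorm X y)"
      using fs_norm_le[OF dec] xy by (simp add: hnorm_scale mult_ac)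
    also have "\<dots> \<le> cmod c * s" using d(2) by (intro mult_left_mono) auto
    finally show ?thesis using decomposition_in_fs[OF dec] by simp
  qed
  from *[of "fs_norm \<alpha> \<sigma> T + 1"] show "L_scale c T \<in> fourier_stieltjes \<alpha> \<sigma>" by simp
  have "(\<lambda>n. cmod c * (fs_norm \<alpha> \<sigma> T + inverse (real (Suc n)))) \<longlonglongrightarrow> cmod c * (fs_norm \<alpha> \<sigma> T + 0)"
    by (intro tendsto_intros LIMSEQ_inverse_real_of_nat)
  then have "fs_norm \<alpha> \<sigma> (L_scale c T) \<le> cmod c * (fs_norm \<alpha> \<sigma> T + 0)"
    by (rule LIMSEQ_le_const) (use * in auto)
  then show "fs_norm \<alpha> \<sigma> (L_scale c T) \<le> cmod c * fs_norm \<alpha> \<sigma> T" by simp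
qed

lemma fs_norm_scale:
  assumes "T \<in> fourier_stieltjes \<alpha> \<sigma>"
  shows "fs_norm \<alpha> \<sigma> (L_scale c T) = cmod c * fs_norm \<alpha> \<sigma> T"
proof (cases "c = 0")
  case True
  then have "L_scale c T = L_zero" by (simp add: L_scale_def L_zero_def)
  then show ?thesis using True by (simp add: fs_zero)
next
  case False
  have "L_scale (1 / c) (L_scale c T) = T"
    using False by (simp add: L_scale_def scaleC_scaleC)
  then have "fs_norm \<alpha> \<sigma> T \<le> cmod (1 / c) * fs_norm \<alpha> \<sigma> (L_scale c T)"
    using fs_scale_le(2)[OF fs_scale_le(1)[OF assms], of "1 / c" c] by simp
  then have "cmod c * fs_norm \<alpha> \<sigma> T \<le> fs_norm \<alpha> \<sigma> (L_scale c T)"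
    using False by (simp add: norm_divide field_simps)
  then show ?thesis using fs_scale_le(2)[OF assms, of c] by simp
qed

lemma fs_mult:
  assumes T: "T \<in> fourier_stieltjes \<alpha> \<sigma>" and S: "S \<in> fourier_stieltjes \<alpha> \<sigma>"
  shows "L_mult T S \<in> fourier_stieltjes \<alpha> \<sigma>"
    and "fs_norm \<alpha> \<sigma> (L_mult T S) \<le> fs_norm \<alpha> \<sigma> T * fs_norm \<alpha> \<sigma> S"
proof -
  have *: "L_mult T S \<in> fourier_stieltjes \<alpha> \<sigma> \<and> fs_norm \<alpha> \<sigma> (L_mult T S) \<le> t * s"
    if t: "fs_norm \<alpha> \<sigma> T < t" and s: "fs_norm \<alpha> \<sigma> S < s" for s t
  proof -
    obtain X2 :: "(('g, 'a) rep_term, 'a) hmodule" and \<rho>2 v2 x2 y2 where d2: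
      "decomposition \<alpha> \<sigma> X2 \<rho>2 v2 x2 y2 T" "hnorm X2 x2 * hnorm X2 y2 < t"
      by (rule fs_norm_near[OF T t])
    obtain X1 :: "(('g, 'a) rep_term, 'a) hmodule" and \<rho>1 v1 x1 y1 where d1:
      "decomposition \<alpha> \<sigma> X1 \<rho>1 v1 x1 y1 S" "hnorm X1 x1 * hnorm X1 y1 < s"
      by (rule fs_norm_near[OF S s])
    interpret equivariant_rep_pair \<alpha> \<sigma> X1 \<rho>1 v1 X2 \<rho>2 v2
      using d1(1) d2(1) by (intro equivariant_rep_pair.intro) (simp_all add: decomposition_def)
    have m: "x1 \<in> vecs X1" "y1 \<in> vecs X1" "x2 \<in> vecs X2" "y2 \<in> vecs X2"
      and TS: "T = coefficient_map X2 \<rho>2 v2 x2 y2" "S = coefficient_map X1 \<rho>1 v1 x1 y1"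
      using d1(1) d2(1) by (auto simp: decomposition_def)
    obtain f h where fh: "decomposition \<alpha> \<sigma> tensor.kernel_module tensor.R tensor.V f h (L_mult T S)"
      "hnorm tensor.kernel_module f \<le> hnorm X1 x1 * hnorm X2 x2"
      "hnorm tensor.kernel_module h \<le> hnorm X1 y1 * hnorm X2 y2"
      unfolding TS by (rule tensor_decomposition[OF m])
    have "fs_norm \<alpha> \<sigma> (L_mult T S)
        \<le> hnorm tensor.kernel_module f * hnorm tensor.kernel_module h"
      by (rule fs_norm_le[OF fh(1)])
    also have "\<dots> \<le> (hnorm X1 x1 * hnorm X2 x2) * (hnorm X1 y1 * hnorm X2 y2)"
      using fh(2,3) by (intro mult_mono mult_nonneg_nonneg hnorm_nonneg)
    also have "\<dots> = (hnorm X2 x2 * hnorm X2 y2) * (hnorm X1 x1 * hnorm X1 y1)" by simp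
    also have "\<dots> \<le> t * s"
      using d1(2) d2(2) fs_norm_nonneg[OF T] t by (intro mult_mono mult_nonneg_nonneg) auto
    finally show ?thesis using decomposition_in_fs[OF fh(1)] by simp
  qed
  from *[of "fs_norm \<alpha> \<sigma> T + 1" "fs_norm \<alpha> \<sigma> S + 1"]
  show "L_mult T S \<in> fourier_stieltjes \<alpha> \<sigma>" by simp
  let ?e = "\<lambda>n. inverse (real (Suc n))"
  have "(\<lambda>n. (fs_norm \<alpha> \<sigma> T + ?e n) * (fs_norm \<alpha> \<sigma> S + ?e n))
      \<longlonglongrightarrow> (fs_norm \<alpha> \<sigma> T + 0) * (fs_norm \<alpha> \<sigma> S + 0)"
    by (intro tendsto_intros LIMSEQ_inverse_real_of_nat)
  then have "fs_norm \<alpha> \<sigma> (L_mult T S) \<le> (fs_norm \<alpha> \<sigma> T + 0) * (fs_norm \<alpha> \<sigma> S + 0)"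
    by (rule LIMSEQ_le_const) (use * in auto)
  then show "fs_norm \<alpha> \<sigma> (L_mult T S) \<le> fs_norm \<alpha> \<sigma> T * fs_norm \<alpha> \<sigma> S" by simp
qed

lemma fs_one: "L_one \<in> fourier_stieltjes \<alpha> \<sigma>" "fs_norm \<alpha> \<sigma> L_one \<le> 1"
  using bounded_coefficientD[OF bounded_one] by auto

lemma fs_norm_eq_zero:
  assumes "T \<in> fourier_stieltjes \<alpha> \<sigma>"
  shows "fs_norm \<alpha> \<sigma> T = 0 \<longleftrightarrow> T = L_zero"
proof
  assume "fs_norm \<alpha> \<sigma> T = 0"
  then have "norm (T g a) \<le> 0" for g a using fs_norm_bound[OF assms, of g a] by simp
  then show "T = L_zero" by (simp add: L_zero_def fun_eq_iff)
qed (simp add: fs_zero)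

lemma fs_linear:
  assumes "T \<in> fourier_stieltjes \<alpha> \<sigma>"
  shows "T g (a + b) = T g a + T g b" "T g (c *\<^sub>C a) = c *\<^sub>C T g a"
proof -
  obtain X :: "(('g, 'a) rep_term, 'a) hmodule" and \<rho> v x y where d:
    "decomposition \<alpha> \<sigma> X \<rho> v x y T"
    using assms by (auto simp: fourier_stieltjes_def)
  interpret equivariant_rep \<alpha> \<sigma> X \<rho> v using d by (simp add: decomposition_def)
  have "x \<in> vecs X" "y \<in> vecs X" and T: "T = coefficient_map X \<rho> v x y"
    using d by (auto simp: decomposition_def)
  then show "T g (a + b) = T g a + T g b" "T g (c *\<^sub>C a) = c *\<^sub>C T g a"
    by (simp_all add: coefficient_map_def rho_inner_add v_closed rho_scale inner_scale rho_closed)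
qed

text \<open>
  A subsequence whose successive differences have norm below \<open>(1/2)\<^sup>n\<close> is the sequence of partial
  sums of a series. By \<open>bounded_series\<close> that series has a sum in the algebra, and the norm of its
  tail from \<open>m\<close> on is at most \<open>2 * (1/2)\<^sup>m\<close>.
\<close>

lemma fs_complete: "complete_on (fourier_stieltjes \<alpha> \<sigma>) L_add L_scale (fs_norm \<alpha> \<sigma>)"
  unfolding complete_on_def
proof (intro allI impI, elim conjE)
  fix f :: "nat \<Rightarrow> 'g \<Rightarrow> 'a \<Rightarrow> 'a"
  define D where "D T S = L_add T (L_scale (- 1) S)" for T S :: "'g \<Rightarrow> 'a \<Rightarrow> 'a"
  let ?N = "fs_norm \<alpha> \<sigma>"
  assume f: "\<forall>n. f n \<in> fourier_stieltjes \<alpha> \<sigma>"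
    and c: "\<forall>e>0. \<exists>n\<^sub>0. \<forall>m\<ge>n\<^sub>0. \<forall>n\<ge>n\<^sub>0. ?N (L_add (f m) (L_scale (- 1) (f n))) < e"
  have D: "D T S \<in> fourier_stieltjes \<alpha> \<sigma>"
    if "T \<in> fourier_stieltjes \<alpha> \<sigma>" "S \<in> fourier_stieltjes \<alpha> \<sigma>" for T S
    unfolding D_def using that by (intro fs_add fs_scale_le)
  have D_app: "D T S g a = T g a - S g a" for T S g a
    by (simp add: D_def L_add_def L_scale_def)
  have tri: "?N (D T S) \<le> ?N (D T U) + ?N (D U S)"
    if "T \<in> fourier_stieltjes \<alpha> \<sigma>" "S \<in> fourier_stieltjes \<alpha> \<sigma>" "U \<in> fourier_stieltjes \<alpha> \<sigma>"
    for T S U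
  proof -
    have "D T S = L_add (D T U) (D U S)" by (simp add: fun_eq_iff D_app L_add_def)
    then show ?thesis using fs_add(2)[OF D D] that by simp
  qed
  have "\<forall>n. \<exists>k. \<forall>i\<ge>k. \<forall>j\<ge>k. ?N (D (f i) (f j)) < (1/2)^n"
    using c by (simp add: D_def)
  then obtain k where k: "\<And>n i j. k n \<le> i \<Longrightarrow> k n \<le> j \<Longrightarrow> ?N (D (f i) (f j)) < (1/2)^n"
    by metis
  \<comment> \<open>An increasing sequence of indices above the \<open>k n\<close>.\<close>
  define l where "l n = (\<Sum>i\<le>n. k i)" for n
  have l_k: "k n \<le> l n" for n
    unfolding l_def by (rule member_le_sum) auto
  have l_mono: "l n \<le> l (Suc n)" for n by (simp add: l_def)
  define d where "d n = D (f (l (Suc n))) (f (l n))" for n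
  have d: "d n \<in> fourier_stieltjes \<alpha> \<sigma>" for n using f by (simp add: d_def D)
  have "?N (d n) < (1/2)^n" for n
    unfolding d_def using l_k[of n] l_mono[of n] by (intro k) auto
  then have bd: "bounded_coefficient \<alpha> \<sigma> ((1/2)^n) (d n)" for n
    by (intro bounded_if_norm_less d)
  have geo: "(\<lambda>n. (1/2)^(n + m)) sums (2 * (1/2)^m :: real)" for m
    using sums_mult2[OF geometric_sums[of "1/2 :: real"], of "(1/2)^m"] by (simp add: power_add)
  have "\<exists>S. bounded_coefficient \<alpha> \<sigma> (2 * (1/2)^m) S \<and> (\<forall>g a. (\<lambda>n. d (n + m) g a) sums S g a)" for m
  proof -
    obtain S where "bounded_coefficient \<alpha> \<sigma> (\<Sum>n. (1/2)^(n + m)) S"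
      "\<And>g a. (\<lambda>n. d (n + m) g a) sums S g a"
      by (rule bounded_series[of "\<lambda>n. (1/2)^(n + m)" "\<lambda>n. d (n + m)"])
        (use bd geo[of m] in \<open>auto simp: sums_iff\<close>)
    then show ?thesis using geo[of m] by (auto simp: sums_iff)
  qed
  then obtain S where S: "\<And>m. bounded_coefficient \<alpha> \<sigma> (2 * (1/2)^m) (S m)"
    "\<And>m g a. (\<lambda>n. d (n + m) g a) sums S m g a"
    by metis
  define L where "L = L_add (f (l 0)) (S 0)"
  have SB: "S m \<in> fourier_stieltjes \<alpha> \<sigma>" "?N (S m) \<le> 2 * (1/2)^m" for m
    using bounded_coefficientD[OF S(1)] by auto
  have LB: "L \<in> fourier_stieltjes \<alpha> \<sigma>" unfolding L_def using f SB by (intro fs_add) auto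
  have tail: "D L (f (l m)) = S m" for m
  proof (intro ext)
    fix g a
    have "(\<lambda>n. d n g a) sums S 0 g a" using S(2)[of 0 g a] by simp
    then have "(\<lambda>n. d (n + m) g a) sums (S 0 g a - (\<Sum>i<m. d i g a))"
      by (rule sums_split_initial_segment)
    then have "S m g a = S 0 g a - (\<Sum>i<m. d i g a)"
      using S(2)[of m g a] sums_unique2 by blast
    also have "(\<Sum>i<m. d i g a) = f (l m) g a - f (l 0) g a"
      by (simp add: d_def D_app sum_lessThan_telescope[of "\<lambda>i. f (l i) g a"])
    finally show "D L (f (l m)) g a = S m g a" by (simp add: D_app L_def L_add_def)
  qed
  have "(\<lambda>n. ?N (D (f n) L)) \<longlonglongrightarrow> 0"
  proof (rule LIMSEQ_I)
    fix e :: real assume e: "0 < e"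
    obtain m where m: "(1/2)^m < e / 3" using real_arch_pow_inv[of "e / 3" "1/2"] e by auto
    have "norm (?N (D (f n) L) - 0) < e" if n: "k m \<le> n" for n
    proof -
      have swap: "D (f (l m)) L = L_scale (- 1) (D L (f (l m)))"
        by (simp add: fun_eq_iff D_app L_scale_def)
      have "?N (D (f (l m)) L) = ?N (S m)"
        unfolding swap using D[OF LB, of "f (l m)"] f by (simp add: fs_norm_scale tail)
      then have "?N (D (f (l m)) L) \<le> 2 * (1/2)^m" using SB(2)[of m] by simp
      moreover have "?N (D (f n) (f (l m))) < (1/2)^m" by (rule k[OF n l_k])
      moreover have "?N (D (f n) L) \<le> ?N (D (f n) (f (l m))) + ?N (D (f (l m)) L)"
        using f LB by (intro tri) auto
      moreover have "0 \<le> ?N (D (f n) L)" using f LB by (intro fs_norm_nonneg D) auto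
      ultimately show ?thesis using m by simp
    qed
    then show "\<exists>no. \<forall>n\<ge>no. norm (?N (D (f n) L) - 0) < e" by blast
  qed
  then show "\<exists>l\<in>fourier_stieltjes \<alpha> \<sigma>. (\<lambda>n. ?N (L_add (f n) (L_scale (- 1) l))) \<longlonglongrightarrow> 0"
    using LB by (auto simp: D_def)
qed

end

theorem proposition3p3:
  fixes \<alpha> :: "'g::group_add \<Rightarrow> 'a::cstar_algebra \<Rightarrow> 'a"
    and \<sigma> :: "'g \<Rightarrow> 'g \<Rightarrow> 'a"
  assumes "twisted_system \<alpha> \<sigma>"
  shows "fourier_stieltjes \<alpha> \<sigma> \<subseteq> L_carrier \<and>
    unital_banach_algebra_on (fourier_stieltjes \<alpha> \<sigma>) L_add L_zero L_scale L_mult L_one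
      (fs_norm \<alpha> \<sigma>)"
proof
  interpret twisted_system \<alpha> \<sigma> by (rule assms)
  let ?B = "fourier_stieltjes \<alpha> \<sigma>"
  show "?B \<subseteq> L_carrier"
    by (auto simp: L_carrier_def clinear_def fs_linear)
  show "unital_banach_algebra_on ?B L_add L_zero L_scale L_mult L_one (fs_norm \<alpha> \<sigma>)"
  proof
    show "\<exists>S\<in>?B. L_add T S = L_zero" if "T \<in> ?B" for T
      using fs_scale_le(1)[OF that, of "- 1"]
      by (intro bexI[of _ "L_scale (- 1) T"]) (simp_all add: L_add_def L_scale_def L_zero_def)
    show "fs_norm \<alpha> \<sigma> L_one = 1" if "(L_one :: 'g \<Rightarrow> 'a \<Rightarrow> 'a) \<noteq> L_zero"
    proof (rule antisym)
      let ?n = "fs_norm \<alpha> \<sigma> L_one"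
      have "L_mult L_one L_one = (L_one :: 'g \<Rightarrow> 'a \<Rightarrow> 'a)" by (simp add: L_mult_def L_one_def)
      then have "?n \<le> ?n * ?n" using fs_mult(2)[OF fs_one(1) fs_one(1)] by simp
      moreover have "0 < ?n"
        using fs_norm_nonneg[OF fs_one(1)] fs_norm_eq_zero[OF fs_one(1)] that by (simp add: less_le)
      ultimately show "1 \<le> ?n" by simp
    qed (rule fs_one(2))
  qed (simp_all add: fs_add fs_zero(1) fs_one(1) fs_scale_le(1) fs_norm_scale fs_mult fs_norm_nonneg
      fs_norm_eq_zero fs_complete,
      simp_all add: fs_linear L_add_def L_scale_def L_mult_def L_zero_def L_one_def fun_eq_iff
      algebra_simps scaleC_add_left scaleC_add_right scaleC_scaleC)
qed

end
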